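(* Let $\varphi:\mathbb{R}\to\mathbb{R}$ be a smooth function, let $\Omega=\{(x_1,x_2)\in\mathbb{R}^2: x_2>\varphi(x_1)\}$, and let $W$ be a double well potential satisfying (W1)–(W5) (listed in the context). Suppose the overdetermined problem $$\Delta u=W'(u),\quad u>0\ \text{ in }\Omega,\qquad u=0\ \text{ on }\partial\Omega,\qquad \frac{\partial u}{\partial\nu}=\text{const. on }\partial\Omega$$ (the constant not being prescribed a priori) has a solution $u$. Then $\Omega$ must be a half space and, up to an isometry of $\mathbb{R}^2$, $\Omega=\{x\cdot e>0\}$ and $u(x)=g(x\cdot e)$ for $x\in\Omega$, for some unit vector $e$, where $g$ is the one-dimensional profile defined in the context.
   Context: Here $\nu$ is the outer unit normal to $\partial\Omega$; a solution is a classical one, $u\in C^2(\Omega)\cap C^1(\overline\Omega)$. Assumptions on $W\in C^2([0,+\infty))$: (W1) $W\ge 0$, $W(1)=0$ and $W>0$ in $[0,1)$; (W2) for some $\gamma\in(0,1)$, $W'<0$ on $(\gamma,1)$; (W3) there is a constant $\kappa>0$ with $W''(s)\ge\kappa$ for all $s\ge\gamma$; (W4) there are constants $p>1$ and $c>0$ with $W'(s)\ge c(s-1)^p$ for $s>1$; (W5) $W'<0$ in $(0,1)$, and either $W'(0)\ne0$, or $W'(0)=0$ and $W''(0)\neq0$. The profile $g:[0,+\infty)\to[0,1)$ is the unique function satisfying $g''=W'(g)$ on $[0,+\infty)$, $g(0)=0$, $\lim_{t\to+\infty}g(t)=1$. It satisfies $g'(t)=\sqrt{2W(g(t))}>0$.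 *)

theory Defs
  imports "HOL-Analysis.Analysis"
begin
text \<open>Derivative of a function on \<open>[0,\<infinity>)\<close>; it is one-sided at \<open>0\<close> and does not depend on the values
  of the function on the negative reals.\<close>

definition hderiv :: "(real \<Rightarrow> real) \<Rightarrow> real \<Rightarrow> real"
  where "hderiv f s = vector_derivative f (at s within {0..})"

definition C2_halfline :: "(real \<Rightarrow> real) \<Rightarrow> bool"
  where "C2_halfline f \<longleftrightarrow>
    (\<forall>s\<ge>0. f differentiable (at s within {0..})) \<and>
    (\<forall>s\<ge>0. hderiv f differentiable (at s within {0..})) \<and>
    continuous_on {0..} (hderiv (hderiv f))"

text \<open>Only the values of \<open>W\<close> on \<open>[0,\<infinity>)\<close> matter.  The conditions \<open>W' < 0\<close> on \<open>(\<gamma>,1)\<close> and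
  \<open>W'' \<ge> \<kappa>\<close> on \<open>[\<gamma>,\<infinity>)\<close> refer to the same \<open>\<gamma>\<close>.\<close>

definition double_well :: "(real \<Rightarrow> real) \<Rightarrow> bool"
  where "double_well W \<longleftrightarrow>
    C2_halfline W \<and>
    ((\<forall>s\<ge>0. W s \<ge> 0) \<and> W 1 = 0 \<and> (\<forall>s\<in>{0..<1}. W s > 0)) \<and>
    (\<exists>\<gamma>\<in>{0<..<1}.
      (\<forall>s\<in>{\<gamma><..<1}. hderiv W s < 0) \<and>
      (\<exists>\<kappa>>0. \<forall>s\<ge>\<gamma>. hderiv (hderiv W) s \<ge> \<kappa>)) \<and>
    (\<exists>p>1. \<exists>c>0. \<forall>s>1. hderiv W s \<ge> c * (s - 1) powr p) \<and>
    ((\<forall>s\<in>{0<..<1}. hderiv W s < 0) \<and>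
      (hderiv W 0 \<noteq> 0 \<or> hderiv W 0 = 0 \<and> hderiv (hderiv W) 0 \<noteq> 0))"

definition is_profile :: "(real \<Rightarrow> real) \<Rightarrow> (real \<Rightarrow> real) \<Rightarrow> bool"
  where "is_profile W g \<longleftrightarrow>
    (\<forall>t\<ge>0. 0 \<le> g t \<and> g t < 1) \<and>
    (\<forall>t\<ge>0. g differentiable (at t within {0..})) \<and>
    (\<forall>t\<ge>0. (hderiv g has_real_derivative hderiv W (g t)) (at t within {0..})) \<and>
    g 0 = 0 \<and> (g \<longlongrightarrow> 1) at_top"

text \<open>The profile is a function on \<open>[0,\<infinity>)\<close>; extending it by \<open>0\<close> makes the total function unique.\<close>

definition profile :: "(real \<Rightarrow> real) \<Rightarrow> real \<Rightarrow> real"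
  where "profile W = (THE g. is_profile W g \<and> (\<forall>t<0. g t = 0))"

definition smooth :: "(real \<Rightarrow> real) \<Rightarrow> bool"
  where "smooth f \<longleftrightarrow> (\<forall>k x. (deriv ^^ k) f differentiable (at x))"

definition partial :: "2 \<Rightarrow> (real^2 \<Rightarrow> real) \<Rightarrow> real^2 \<Rightarrow> real"
  where "partial i f x = frechet_derivative f (at x) (axis i 1)"

definition grad :: "(real^2 \<Rightarrow> real) \<Rightarrow> real^2 \<Rightarrow> real^2"
  where "grad f x = (\<chi> i. partial i f x)"

definition laplacian :: "(real^2 \<Rightarrow> real) \<Rightarrow> real^2 \<Rightarrow> real"
  where "laplacian f x = (\<Sum>i\<in>UNIV. partial i (partial i f) x)"

text \<open>This is \<open>C\<^sup>k\<close> regularity only for open \<open>S\<close>: the derivatives are two-sided.\<close>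

fun Ck_on :: "nat \<Rightarrow> (real^2) set \<Rightarrow> (real^2 \<Rightarrow> real) \<Rightarrow> bool"
  where
    "Ck_on 0 S f \<longleftrightarrow> continuous_on S f"
  | "Ck_on (Suc k) S f \<longleftrightarrow> (\<forall>x\<in>S. f differentiable (at x)) \<and> (\<forall>i. Ck_on k S (partial i f))"

text \<open>For open \<open>S\<close>, \<open>f\<close> lies in \<open>C\<^sup>1\<close> of the closure iff \<open>f\<close> is \<open>C\<^sup>1\<close> in \<open>S\<close>, is continuous up to the
  boundary, and its gradient extends continuously to the closure.  The values of the extension at
  boundary points are then the limits given by \<open>bdry_grad\<close>; no derivative of \<open>f\<close> across the boundary
  is involved.\<close>

definition C1_closure :: "(real^2) set \<Rightarrow> (real^2 \<Rightarrow> real) \<Rightarrow> bool"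
  where "C1_closure S f \<longleftrightarrow>
    Ck_on 1 S f \<and> continuous_on (closure S) f \<and>
    (\<exists>G. continuous_on (closure S) G \<and> (\<forall>x\<in>S. G x = grad f x))"

definition bdry_grad :: "(real^2) set \<Rightarrow> (real^2 \<Rightarrow> real) \<Rightarrow> real^2 \<Rightarrow> real^2"
  where "bdry_grad S f x = Lim (at x within S) (grad f)"

definition epigraph2 :: "(real \<Rightarrow> real) \<Rightarrow> (real^2) set"
  where "epigraph2 \<phi> = {x. x$2 > \<phi> (x$1)}"

text \<open>Outer unit normal to the epigraph: the normalisation of the downward normal \<open>(\<phi>', -1)\<close> to the
  graph of \<open>\<phi>\<close>.\<close>

definition outer_normal :: "(real \<Rightarrow> real) \<Rightarrow> real^2 \<Rightarrow> real^2"
  where "outer_normal \<phi> x = sgn (vector [deriv \<phi> (x$1), -1])"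

lemma outer_normal_unit: "norm (outer_normal \<phi> x) = 1"
proof -
  have "(vector [deriv \<phi> (x$1), -1] :: real^2) $ 2 \<noteq> 0 $ 2" by simp
  then have "(vector [deriv \<phi> (x$1), -1] :: real^2) \<noteq> 0" by metis
  then show ?thesis by (simp add: outer_normal_def norm_sgn)
qed

lemma outer_normal_orthogonal_tangent:
  "outer_normal \<phi> x \<bullet> vector [1, deriv \<phi> (x$1)] = 0"
  by (simp add: outer_normal_def sgn_div_norm inner_vec_def sum_2)

lemma outer_normal_points_down: "outer_normal \<phi> x $ 2 < 0"
proof -
  have "(vector [deriv \<phi> (x$1), -1] :: real^2) $ 2 \<noteq> 0 $ 2" by simp
  then have "(vector [deriv \<phi> (x$1), -1] :: real^2) \<noteq> 0" by metis
  then show ?thesis by (simp add: outer_normal_def sgn_div_norm)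
qed

definition normal_deriv :: "(real \<Rightarrow> real) \<Rightarrow> (real^2 \<Rightarrow> real) \<Rightarrow> real^2 \<Rightarrow> real"
  where "normal_deriv \<phi> u x = bdry_grad (epigraph2 \<phi>) u x \<bullet> outer_normal \<phi> x"

definition overdetermined_solution ::
    "(real \<Rightarrow> real) \<Rightarrow> (real \<Rightarrow> real) \<Rightarrow> (real^2 \<Rightarrow> real) \<Rightarrow> bool"
  where "overdetermined_solution W \<phi> u \<longleftrightarrow>
    Ck_on 2 (epigraph2 \<phi>) u \<and> C1_closure (epigraph2 \<phi>) u \<and>
    (\<forall>x\<in>epigraph2 \<phi>. laplacian u x = hderiv W (u x) \<and> u x > 0) \<and>
    (\<forall>x\<in>frontier (epigraph2 \<phi>). u x = 0) \<and>
    (\<exists>c. \<forall>x\<in>frontier (epigraph2 \<phi>). normal_deriv \<phi> u x = c)"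

definition half_space :: "(real^2) set \<Rightarrow> bool"
  where "half_space S \<longleftrightarrow> (\<exists>a b. a \<noteq> 0 \<and> S = {x. x \<bullet> a > b})"

definition plane_isometry :: "(real^2 \<Rightarrow> real^2) \<Rightarrow> bool"
  where "plane_isometry T \<longleftrightarrow> surj T \<and> (\<forall>x y. dist (T x) (T y) = dist x y)"

end

theory Submission
  imports Defs
begin

text \<open>All estimates are maximum principles for functions of class \<open>C\<^sup>2\<close>, tested along the two axes.
  Keller--Osserman barriers give \<open>u \<le> 1\<close>; comparison with a product of cosines and with a
  paraboloid shows that \<open>1 - u = O(d\<^sup>-\<^sup>2)\<close> at depth \<open>d\<close>.  For perturbations \<open>F\<close> of \<open>W\<close> let \<open>G = arclen F\<close>, that is,
  \<open>G(s) = \<integral>\<^sub>0\<^sup>s dt / sqrt (2 F(t))\<close>.  Comparing \<open>G(u)\<close> with the distance to the centre of large balls that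
  touch the boundary from inside and from outside shows that the constant normal derivative \<open>c\<close>
  satisfies \<open>c\<^sup>2 = 2 W(0)\<close>.  Then a two-point maximum principle for \<open>G(u(x)) - G(u(y)) - \<bar>x - y\<bar>\<close> gives
  Modica's inequality \<open>\<bar>\<nabla>u\<bar>\<^sup>2 \<le> 2 W(u)\<close>.

  Modica's inequality says that the stress tensor \<open>(\<bar>\<nabla>u\<bar>\<^sup>2 / 2 + W(u)) I - \<nabla>u \<otimes> \<nabla>u\<close>, which is divergence
  free, is positive semidefinite, and \<open>c\<^sup>2 = 2 W(0)\<close> says that its normal component vanishes on the
  boundary.  Extended by zero, it is therefore the rotated Hessian of a convex function \<open>\<Psi>\<close> which
  vanishes outside \<open>\<Omega>\<close>.  Along a line that meets the complement of \<open>\<Omega>\<close> in two points the derivative of \<open>\<Psi>\<close>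
  is monotone and vanishes at both points, so \<open>u\<close> is constant on the part of the line between them
  that lies in \<open>\<Omega>\<close>; hence \<open>\<phi>\<close> is concave.  If \<open>\<phi>\<close> were not affine, some
  tangent line would diverge from the boundary at both ends; by the decay of \<open>1 - u\<close> the derivative
  of \<open>\<Psi>\<close> along it has the same limit at both ends, so it is constant, which is again impossible.
  Finally, in a half plane the ball barriers of infinite radius give \<open>G(u) = d\<close> with \<open>F = W\<close>, where \<open>d\<close> is the distance
  to the boundary.\<close>

section \<open>Second derivative tests\<close>

text \<open>For a one-dimensional solution, \<open>arclen W (u x)\<close> is the distance of
  \<open>x\<close> to the boundary; the ball barriers and Modica's inequality both measure the
  deviation from this. With \<open>w = arclen F (u x)\<close> and
  \<open>q = sqrt (2 * F (u x))\<close>, q times the Laplacian of w is W'(u) - F'(u) |grad w|^2, so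
  where |grad w| = 1 only W' - F' is left. This is zero for F = W; the perturbations give it a
  strict sign, as a maximum principle requires, and move the singularity of \<open>arclen W\<close>
  at 1. Modica's inequality says that w is 1-Lipschitz in the limit F = W. Its usual proof
  differentiates |grad u|^2 twice and uses compactness under translations; here u is only C^2 and
  nothing controls the boundary at infinity. The two-point function needs second derivatives of u
  only, and a small quadratic penalty replaces compactness. Constancy of the normal derivative
  carries what large balls reveal at single contact points over to the whole boundary. The convex
  function \<Psi> is never constructed: only its derivative along a line occurs, as an integral over
  vertical segments.\<close>

definition twice_deriv :: "(real \<Rightarrow> real) \<Rightarrow> real \<Rightarrow> real \<Rightarrow> real \<Rightarrow> bool"
  where "twice_deriv f a p q \<longleftrightarrow>
    (\<exists>f'. (\<forall>\<^sub>F t in nhds a. (f has_real_derivative f' t) (at t)) \<and> f' a = p \<and>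
      (f' has_real_derivative q) (at a))"

lemma twice_derivI:
  assumes "open S" "a \<in> S" "\<And>t. t \<in> S \<Longrightarrow> (f has_real_derivative f' t) (at t)"
    and "(f' has_real_derivative q) (at a)"
  shows "twice_deriv f a (f' a) q"
  unfolding twice_deriv_def eventually_nhds using assms by blast

lemma twice_deriv_DERIV: "twice_deriv f a p q \<Longrightarrow> (f has_real_derivative p) (at a)"
  unfolding twice_deriv_def using eventually_nhds_x_imp_x by blast

lemma twice_deriv_cong:
  assumes "twice_deriv f a p q" "p = p'" "q = q'"
  shows "twice_deriv f a p' q'"
  using assms by simp

lemma twice_deriv_add:
  assumes "twice_deriv f a p q" "twice_deriv g a r s"
  shows "twice_deriv (\<lambda>t. f t + g t) a (p + r) (q + s)"
proof -
  obtain f' g' where f: "\<forall>\<^sub>F t in nhds a. (f has_real_derivative f' t) (at t)" "f' a = p"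
      "(f' has_real_derivative q) (at a)"
    and g: "\<forall>\<^sub>F t in nhds a. (g has_real_derivative g' t) (at t)" "g' a = r"
      "(g' has_real_derivative s) (at a)"
    using assms unfolding twice_deriv_def by blast
  have "\<forall>\<^sub>F t in nhds a. ((\<lambda>t. f t + g t) has_real_derivative f' t + g' t) (at t)"
    using f(1) g(1) by eventually_elim (rule DERIV_add)
  then show ?thesis unfolding twice_deriv_def
    using f g DERIV_add[OF f(3) g(3)] by (intro exI[of _ "\<lambda>t. f' t + g' t"]) auto
qed

lemma twice_deriv_cmult:
  assumes "twice_deriv f a p q"
  shows "twice_deriv (\<lambda>t. c * f t) a (c * p) (c * q)"
proof -
  obtain f' where f: "\<forall>\<^sub>F t in nhds a. (f has_real_derivative f' t) (at t)" "f' a = p"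
      "(f' has_real_derivative q) (at a)"
    using assms unfolding twice_deriv_def by blast
  have "\<forall>\<^sub>F t in nhds a. ((\<lambda>t. c * f t) has_real_derivative c * f' t) (at t)"
    using f(1) by eventually_elim (rule DERIV_cmult)
  then show ?thesis unfolding twice_deriv_def
    using f DERIV_cmult[OF f(3)] by (intro exI[of _ "\<lambda>t. c * f' t"]) auto
qed

lemma twice_deriv_minus:
  assumes "twice_deriv f a p q"
  shows "twice_deriv (\<lambda>t. - f t) a (- p) (- q)"
  using twice_deriv_cmult[OF assms, of "-1"] by simp

lemma twice_deriv_diff:
  assumes "twice_deriv f a p q" "twice_deriv g a r s"
  shows "twice_deriv (\<lambda>t. f t - g t) a (p - r) (q - s)"
  using twice_deriv_add[OF assms(1) twice_deriv_minus[OF assms(2)]] by simp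

lemma twice_deriv_const: "twice_deriv (\<lambda>t. c) a 0 0"
  unfolding twice_deriv_def by (intro exI[of _ "\<lambda>t. 0"]) auto

lemma twice_deriv_compose:
  assumes "twice_deriv f a p q" "twice_deriv g (f a) r s"
  shows "twice_deriv (\<lambda>t. g (f t)) a (r * p) (s * p\<^sup>2 + r * q)"
proof -
  obtain f' g' where f: "\<forall>\<^sub>F t in nhds a. (f has_real_derivative f' t) (at t)" "f' a = p"
      "(f' has_real_derivative q) (at a)"
    and g: "\<forall>\<^sub>F t in nhds (f a). (g has_real_derivative g' t) (at t)" "g' (f a) = r"
      "(g' has_real_derivative s) (at (f a))"
    using assms unfolding twice_deriv_def by blast
  have fa: "(f has_real_derivative p) (at a)" using assms(1) by (rule twice_deriv_DERIV)
  then have "isCont f a" by (rule DERIV_isCont)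
  then have lim: "filterlim f (nhds (f a)) (nhds a)"
    by (metis tendsto_at_iff_tendsto_nhds isCont_def)
  have "\<forall>\<^sub>F t in nhds a. ((\<lambda>t. g (f t)) has_real_derivative g' (f t) * f' t) (at t)"
    using f(1) filterlim_iff[THEN iffD1, OF lim, rule_format, OF g(1)]
    by eventually_elim (rule DERIV_chain2)
  moreover have "((\<lambda>t. g' (f t) * f' t) has_real_derivative s * p\<^sup>2 + r * q) (at a)"
    using f(2) g(2) by (auto intro!: derivative_eq_intros DERIV_chain2[OF g(3) fa] f(3)
      simp: power2_eq_square algebra_simps)
  ultimately show ?thesis unfolding twice_deriv_def
    using f g by (intro exI[of _ "\<lambda>t. g' (f t) * f' t"]) auto
qed

lemma twice_deriv_local_max:
  assumes "twice_deriv f a p q" "\<forall>\<^sub>F t in nhds a. f t \<le> f a"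
  shows "p = 0" "q \<le> 0"
proof -
  obtain f' where f: "\<forall>\<^sub>F t in nhds a. (f has_real_derivative f' t) (at t)" "f' a = p"
      "(f' has_real_derivative q) (at a)"
    using assms unfolding twice_deriv_def by blast
  have "\<forall>\<^sub>F t in nhds a. (f has_real_derivative f' t) (at t) \<and> f t \<le> f a"
    using f(1) assms(2) by eventually_elim auto
  then obtain d where d: "d > 0"
    "\<And>t. dist t a < d \<Longrightarrow> (f has_real_derivative f' t) (at t) \<and> f t \<le> f a"
    unfolding eventually_nhds_metric by blast
  show p: "p = 0"
    by (rule DERIV_local_max[OF twice_deriv_DERIV[OF assms(1)] d(1)])
      (use d in \<open>auto simp: dist_real_def abs_minus_commute\<close>)
  show "q \<le> 0"
  proof (rule ccontr)
    assume "\<not> q \<le> 0"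
    then have "q > 0" by simp
    from DERIV_pos_inc_right[OF f(3) this] obtain e where
      e: "e > 0" "\<And>h. h > 0 \<Longrightarrow> h < e \<Longrightarrow> f' a < f' (a + h)" by blast
    define h where "h = min d e / 2"
    have h: "h > 0" "h < d" "h < e" using d(1) e(1) by (auto simp: h_def)
    have "\<exists>z. a < z \<and> z < a + h \<and> f (a + h) - f a = (a + h - a) * f' z"
      by (rule MVT2) (use h d(2) in \<open>auto simp: dist_real_def\<close>)
    then obtain z where z: "a < z" "z < a + h" "f (a + h) - f a = h * f' z" by auto
    have "f' z > 0" using e(2)[of "z - a"] z h f(2) p by auto
    then have "f (a + h) > f a" using z(3) h(1) mult_pos_pos[of h "f' z"] by linarith
    then show False using d(2)[of "a + h"] h by (auto simp: dist_real_def)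
  qed
qed

lemma twice_deriv_shift_square: "twice_deriv (\<lambda>t. (c + t)\<^sup>2) 0 (2 * c) 2"
proof -
  have "twice_deriv (\<lambda>t. (c + t)\<^sup>2) 0 (2 * (c + 0)) 2"
    by (rule twice_derivI[of UNIV]) (auto intro!: derivative_eq_intros)
  then show ?thesis by simp
qed

section \<open>Distances along the coordinate axes\<close>

lemma axis_norm_square:
  fixes z :: "real^2"
  shows "(norm (z + t *\<^sub>R axis i 1))\<^sup>2 = (norm z)\<^sup>2 - (z$i)\<^sup>2 + (z$i + t)\<^sup>2"
proof -
  have "(norm (z + t *\<^sub>R axis i 1))\<^sup>2 = (z + t *\<^sub>R axis i 1) \<bullet> (z + t *\<^sub>R axis i 1)"
    by (simp add: power2_norm_eq_inner)
  also have "\<dots> = z \<bullet> z + 2 * t * (z$i) + t\<^sup>2"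
    by (simp add: inner_add_left inner_add_right inner_axis inner_axis_axis inner_commute
      power2_eq_square)
  finally show ?thesis by (simp add: power2_norm_eq_inner) (simp add: power2_eq_square algebra_simps)
qed

text \<open>Over the two axes the second derivatives add up to \<open>1 / norm (x - y)\<close>. This
  curvature term is all that a comparison with a ball costs, and it fades as the radius
  grows.\<close>

lemma twice_deriv_norm_axis:
  fixes x y :: "real^2"
  assumes "x \<noteq> y"
  shows "twice_deriv (\<lambda>t. norm (x + t *\<^sub>R axis i 1 - y)) 0 ((x - y)$i / norm (x - y))
    (1 / norm (x - y) - ((x - y)$i)\<^sup>2 / norm (x - y) ^ 3)"
proof -
  let ?z = "x - y"
  have n: "norm ?z > 0" using assms by simp
  define a where "a = ?z $ i"
  define N where "N = norm ?z"
  have eq: "norm (x + t *\<^sub>R axis i 1 - y) = sqrt ((N\<^sup>2 - a\<^sup>2) + (a + t)\<^sup>2)" for t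
  proof -
    have "norm (x + t *\<^sub>R axis i 1 - y) = norm (?z + t *\<^sub>R axis i 1)"
      by (simp add: algebra_simps)
    also have "\<dots> = sqrt ((norm (?z + t *\<^sub>R axis i 1))\<^sup>2)" by simp
    finally show ?thesis unfolding axis_norm_square a_def N_def .
  qed
  have 1: "twice_deriv (\<lambda>t. (N\<^sup>2 - a\<^sup>2) + (a + t)\<^sup>2) 0 (0 + 2 * a) (0 + 2)"
    by (intro twice_deriv_add twice_deriv_const twice_deriv_shift_square)
  have N: "N > 0" using n N_def by simp
  have "((\<lambda>s. 1 / (2 * sqrt s)) has_real_derivative - 1 / (4 * N ^ 3)) (at (N\<^sup>2))"
    using N by (auto intro!: derivative_eq_intros simp: field_simps power3_eq_cube power2_eq_square)
  moreover have "(sqrt has_real_derivative 1 / (2 * sqrt s)) (at s)" if "s \<in> {0<..}" for s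
    using DERIV_real_sqrt[of s] that by (simp add: field_simps)
  ultimately have "twice_deriv sqrt (N\<^sup>2) (1 / (2 * sqrt (N\<^sup>2))) (- 1 / (4 * N ^ 3))"
    using N by (intro twice_derivI[of "{0<..}"]) auto
  then have 2: "twice_deriv sqrt ((N\<^sup>2 - a\<^sup>2) + (a + 0)\<^sup>2) (1 / (2 * N)) (- 1 / (4 * N ^ 3))"
    using N by simp
  have "twice_deriv (\<lambda>t. sqrt ((N\<^sup>2 - a\<^sup>2) + (a + t)\<^sup>2)) 0 (1 / (2 * N) * (0 + 2 * a))
    (- 1 / (4 * N ^ 3) * (0 + 2 * a)\<^sup>2 + 1 / (2 * N) * (0 + 2))"
    by (rule twice_deriv_compose[OF 1 2])
  then show ?thesis unfolding eq a_def[symmetric] N_def[symmetric]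
    by (rule twice_deriv_cong) (use N in \<open>auto simp: field_simps power2_eq_square\<close>)
qed

lemma twice_deriv_norm_square_axis:
  fixes x :: "real^2"
  shows "twice_deriv (\<lambda>t. (norm (x + t *\<^sub>R axis i 1))\<^sup>2) 0 (2 * x$i) 2"
  unfolding axis_norm_square
  using twice_deriv_add[OF twice_deriv_const[of "(norm x)\<^sup>2 - (x$i)\<^sup>2"] twice_deriv_shift_square[of "x$i"]]
  by simp

section \<open>The inverse of the one-dimensional solution\<close>

lemma inverse_sqrt_has_derivative:
  assumes "(F has_real_derivative F') (at s)" "0 < F s"
  shows "((\<lambda>s. 1 / sqrt (2 * F s)) has_real_derivative - F' / (sqrt (2 * F s)) ^ 3) (at s)"
proof -
  define q where "q = sqrt (2 * F s)"
  have q: "q > 0" "2 * F s = q\<^sup>2" using assms(2) by (auto simp: q_def)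
  show ?thesis
    using assms(2) q by (auto intro!: derivative_eq_intros assms(1)
       simp flip: q_def simp: field_simps power2_eq_square power3_eq_cube)
qed

text \<open>The inverse function of the solution of \<open>g' = sqrt (2 * F (g))\<close>,
  \<open>g 0 = 0\<close>; for \<open>F = W\<close> it is the inverse of the profile.\<close>

definition arclen :: "(real \<Rightarrow> real) \<Rightarrow> real \<Rightarrow> real"
  where "arclen F s = integral {0..s} (\<lambda>t. 1 / sqrt (2 * F t))"

lemma arclen_0 [simp]: "arclen F 0 = 0"
  by (simp add: arclen_def)

context
  fixes F :: "real \<Rightarrow> real" and b :: real
  assumes cont: "continuous_on {0..b} F" and pos: "\<And>t. 0 \<le> t \<Longrightarrow> t \<le> b \<Longrightarrow> F t > 0"
begin

lemma arclen_integrand_continuous: "continuous_on {0..b} (\<lambda>t. 1 / sqrt (2 * F t))"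
  using pos by (intro continuous_intros cont) (auto simp: less_imp_neq[symmetric] dest: pos)

lemma arclen_has_derivative_within:
  assumes "0 \<le> s" "s \<le> b"
  shows "(arclen F has_real_derivative 1 / sqrt (2 * F s)) (at s within {0..b})"
  unfolding arclen_def
  by (rule integral_has_real_derivative[OF arclen_integrand_continuous]) (use assms in auto)

lemma arclen_has_derivative:
  assumes "0 < s" "s < b"
  shows "(arclen F has_real_derivative 1 / sqrt (2 * F s)) (at s)"
proof -
  have "at s within {0..b} = at s" using assms by (intro at_within_interior) auto
  then show ?thesis using arclen_has_derivative_within[of s] assms by simp
qed

lemma arclen_continuous: "continuous_on {0..b} (arclen F)"
  using arclen_has_derivative_within
  by (intro DERIV_continuous_on[where D="\<lambda>s. 1 / sqrt (2 * F s)"]) auto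

lemma arclen_mvt:
  assumes "0 \<le> r" "r < s" "s \<le> b"
  obtains z where "r < z" "z < s" "arclen F s - arclen F r = (s - r) / sqrt (2 * F z)"
proof -
  have "\<exists>z. r < z \<and> z < s \<and> (arclen F has_real_derivative (1 / sqrt (2 * F z))) (at z) \<and>
      arclen F s - arclen F r = (s - r) * (1 / sqrt (2 * F z))"
  proof -
    have "\<exists>l z. z > r \<and> z < s \<and> (arclen F has_real_derivative l) (at z) \<and>
        arclen F s - arclen F r = (s - r) * l"
    proof (rule MVT)
      show "continuous_on {r..s} (arclen F)"
        by (rule continuous_on_subset[OF arclen_continuous]) (use assms in auto)
      show "arclen F differentiable (at x)" if "r < x" "x < s" for x
        using arclen_has_derivative[of x] that assms real_differentiable_def by auto
    qed (use assms in auto)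
    then obtain l z where z: "z > r" "z < s" "(arclen F has_real_derivative l) (at z)"
      "arclen F s - arclen F r = (s - r) * l" by blast
    have "l = 1 / sqrt (2 * F z)"
      using DERIV_unique[OF z(3) arclen_has_derivative] z assms by auto
    then show ?thesis using z by blast
  qed
  then show ?thesis using that by auto
qed

lemma arclen_strict_mono:
  assumes "0 \<le> r" "r < s" "s \<le> b"
  shows "arclen F r < arclen F s"
proof -
  obtain z where z: "r < z" "z < s" "arclen F s - arclen F r = (s - r) / sqrt (2 * F z)"
    using arclen_mvt[OF assms] .
  have "F z > 0" using pos z assms by auto
  then have "(s - r) / sqrt (2 * F z) > 0" using assms by simp
  then show ?thesis using z(3) by simp
qed

lemma arclen_mono:
  assumes "0 \<le> r" "r \<le> s" "s \<le> b"
  shows "arclen F r \<le> arclen F s"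
  using arclen_strict_mono[of r s] assms by (cases "r = s") auto

lemma arclen_nonneg:
  assumes "0 \<le> s" "s \<le> b"
  shows "0 \<le> arclen F s"
  using arclen_mono[of 0 s] assms by simp

lemma arclen_twice_deriv:
  assumes "0 < s" "s < b" and D: "(F has_real_derivative F') (at s)"
  shows "twice_deriv (arclen F) s (1 / sqrt (2 * F s)) (- F' / (sqrt (2 * F s)) ^ 3)"
  by (rule twice_derivI[of "{0<..<b}"])
    (use assms arclen_has_derivative inverse_sqrt_has_derivative[OF D] pos in auto)

end

section \<open>The potential\<close>

locale double_well_potential =
  fixes W :: "real \<Rightarrow> real"
  assumes double_well: "double_well W"
begin

abbreviation W1 :: "real \<Rightarrow> real" where "W1 \<equiv> hderiv W"
abbreviation W2 :: "real \<Rightarrow> real" where "W2 \<equiv> hderiv (hderiv W)"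

lemma W_deriv_within: "0 \<le> s \<Longrightarrow> (W has_real_derivative W1 s) (at s within {0..})"
  using double_well unfolding double_well_def C2_halfline_def hderiv_def
  by (simp add: has_real_derivative_iff_has_vector_derivative vector_derivative_works[symmetric])

lemma W1_deriv_within: "0 \<le> s \<Longrightarrow> (W1 has_real_derivative W2 s) (at s within {0..})"
proof -
  assume "0 \<le> s"
  then have "W1 differentiable (at s within {0..})"
    using double_well unfolding double_well_def C2_halfline_def by blast
  then show ?thesis
    unfolding hderiv_def[of "hderiv W"]
    by (simp add: has_real_derivative_iff_has_vector_derivative vector_derivative_works[symmetric])
qed

lemma at_within_halfline: "0 < (s::real) \<Longrightarrow> at s within {0..} = at s"
  by (rule at_within_interior) simp

lemma W_deriv: "0 < s \<Longrightarrow> (W has_real_derivative W1 s) (at s)"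
  using W_deriv_within[of s] at_within_halfline[of s] by simp

lemma W1_deriv: "0 < s \<Longrightarrow> (W1 has_real_derivative W2 s) (at s)"
  using W1_deriv_within[of s] at_within_halfline[of s] by simp

lemma W_continuous: "continuous_on {0..} W"
  by (rule DERIV_continuous_on[where D=W1]) (simp add: W_deriv_within)

lemma W1_continuous: "continuous_on {0..} W1"
  by (rule DERIV_continuous_on[where D=W2]) (simp add: W1_deriv_within)

lemma W2_continuous: "continuous_on {0..} W2"
  using double_well unfolding double_well_def C2_halfline_def by blast

lemma W_nonneg: "0 \<le> s \<Longrightarrow> 0 \<le> W s" and W_1 [simp]: "W 1 = 0"
  and W_pos: "0 \<le> s \<Longrightarrow> s < 1 \<Longrightarrow> 0 < W s"
  and W1_neg: "0 < s \<Longrightarrow> s < 1 \<Longrightarrow> W1 s < 0"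
  using double_well unfolding double_well_def by auto

lemma W1_1 [simp]: "W1 1 = 0"
proof (rule DERIV_local_min[of W _ 1 1])
  show "(W has_real_derivative W1 1) (at 1)" by (rule W_deriv) simp
  show "\<forall>y. \<bar>1 - y\<bar> < 1 \<longrightarrow> W 1 \<le> W y" using W_nonneg by (auto simp: abs_if split: if_splits)
qed simp

lemma W1_tendsto_0: "(W1 \<longlongrightarrow> W1 0) (at_right 0)"
proof -
  have "(W1 \<longlongrightarrow> W1 0) (at 0 within {0..})"
    using W1_continuous by (simp add: continuous_on_def)
  then show ?thesis by (rule tendsto_within_subset) auto
qed

lemma W1_0_nonpos: "W1 0 \<le> 0"
proof (rule tendsto_upperbound[OF W1_tendsto_0])
  have "\<forall>\<^sub>F s in at_right (0::real). s \<in> {0<..<1}"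
    by (rule eventually_at_right_real) simp
  then show "\<forall>\<^sub>F s in at_right 0. W1 s \<le> 0"
    by eventually_elim (use W1_neg in \<open>auto intro: less_imp_le\<close>)
qed simp

lemma W1_nonpos: "0 \<le> s \<Longrightarrow> s \<le> 1 \<Longrightarrow> W1 s \<le> 0"
  using W1_neg[of s] W1_0_nonpos by (cases "s = 0"; cases "s = 1") auto

lemma W_MVT:
  assumes "0 \<le> r" "r < s"
  obtains z where "r < z" "z < s" "W s - W r = (s - r) * W1 z"
proof -
  have "\<exists>l z. z > r \<and> z < s \<and> (W has_real_derivative l) (at z) \<and> W s - W r = (s - r) * l"
  proof (rule MVT[OF assms(2)])
    show "continuous_on {r..s} W"
      by (rule continuous_on_subset[OF W_continuous]) (use assms in auto)
    show "W differentiable (at x)" if "r < x" "x < s" for x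
      using W_deriv[of x] that assms real_differentiable_def by auto
  qed
  then obtain l z where z: "z > r" "z < s" "(W has_real_derivative l) (at z)"
    "W s - W r = (s - r) * l" by blast
  then show ?thesis using DERIV_unique[OF z(3) W_deriv] assms that by auto
qed

lemma W1_MVT:
  assumes "0 \<le> r" "r < s"
  obtains z where "r < z" "z < s" "W1 s - W1 r = (s - r) * W2 z"
proof -
  have "\<exists>l z. z > r \<and> z < s \<and> (W1 has_real_derivative l) (at z) \<and> W1 s - W1 r = (s - r) * l"
  proof (rule MVT[OF assms(2)])
    show "continuous_on {r..s} W1"
      by (rule continuous_on_subset[OF W1_continuous]) (use assms in auto)
    show "W1 differentiable (at x)" if "r < x" "x < s" for x
      using W1_deriv[of x] that assms real_differentiable_def by auto
  qed
  then obtain l z where z: "z > r" "z < s" "(W1 has_real_derivative l) (at z)"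
    "W1 s - W1 r = (s - r) * l" by blast
  then show ?thesis using DERIV_unique[OF z(3) W1_deriv] assms that by auto
qed

lemma W_antimono:
  assumes "0 \<le> r" "r \<le> s" "s \<le> 1"
  shows "W s \<le> W r"
proof (cases "r = s")
  case False
  then obtain z where z: "r < z" "z < s" "W s - W r = (s - r) * W1 z"
    using W_MVT[of r s] assms by auto
  have "W1 z \<le> 0" using W1_nonpos z assms by auto
  then show ?thesis using z mult_nonneg_nonpos[of "s - r" "W1 z"] by linarith
qed simp

text \<open>(W3) integrated by the mean value theorem. With \<open>s = 1\<close> it bounds
  \<open>- W1 r\<close> below by \<open>\<kappa> * (1 - r)\<close>, the linear damping behind
  \<open>u_decay\<close>.\<close>

lemma W1_growth:
  obtains \<gamma> \<kappa> where "0 < \<gamma>" "\<gamma> < 1" "0 < \<kappa>"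
    "\<And>r s. \<gamma> \<le> r \<Longrightarrow> r \<le> s \<Longrightarrow> \<kappa> * (s - r) \<le> W1 s - W1 r"
proof -
  obtain \<gamma> \<kappa> where g: "0 < \<gamma>" "\<gamma> < 1" "0 < \<kappa>" "\<And>s. \<gamma> \<le> s \<Longrightarrow> \<kappa> \<le> W2 s"
    using double_well unfolding double_well_def by auto
  have "\<kappa> * (s - r) \<le> W1 s - W1 r" if rs: "\<gamma> \<le> r" "r \<le> s" for r s
  proof (cases "r = s")
    case False
    then obtain z where z: "r < z" "z < s" "W1 s - W1 r = (s - r) * W2 z"
      using W1_MVT[of r s] rs g by auto
    then show ?thesis using g(4)[of z] rs mult_left_mono[of \<kappa> "W2 z" "s - r"]
      by (simp add: mult.commute)
  qed simp
  then show ?thesis using that g by blast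
qed

lemma W1_superlinear:
  obtains p c where "1 < p" "0 < c" "\<And>s. 1 < s \<Longrightarrow> c * (s - 1) powr p \<le> W1 s"
  using double_well unfolding double_well_def by blast

text \<open>Near 0 this is (W5): either \<open>W1 0 < 0\<close> and continuity suffices, or
  \<open>W1 s / s\<close> tends to \<open>W2 0 < 0\<close>. Away from 0, \<open>W1\<close> has a
  negative maximum on a compact interval. The linear rate lets an eigenfunction of the Laplacian
  serve as a barrier in \<open>u_lower_bound\<close>.\<close>

lemma W1_linear_bound:
  assumes "0 < a" "a < 1"
  obtains k where "0 < k" "\<And>s. 0 < s \<Longrightarrow> s \<le> a \<Longrightarrow> k * s < - W1 s"
proof -
  have near: "\<exists>k e. 0 < k \<and> 0 < e \<and> (\<forall>s. 0 < s \<and> s < e \<and> s \<le> a \<longrightarrow> k * s < - W1 s)"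
  proof (cases "W1 0 < 0")
    case True
    have "\<forall>\<^sub>F s in at_right 0. W1 s < W1 0 / 2"
      by (rule order_tendstoD[OF W1_tendsto_0]) (use True in simp)
    then obtain e where e: "e > 0" "\<And>s. 0 < s \<Longrightarrow> s < e \<Longrightarrow> W1 s < W1 0 / 2"
      by (auto simp: eventually_at_right_field)
    have "- W1 0 / 2 * s < - W1 s" if "0 < s" "s < e" "s \<le> a" for s
    proof -
      have "- W1 0 / 2 * s \<le> - W1 0 / 2 * 1"
        by (rule mult_left_mono) (use True that assms in auto)
      then show ?thesis using e(2)[OF that(1,2)] by simp
    qed
    then show ?thesis using e(1) True by (intro exI[of _ "- W1 0 / 2"] exI[of _ e]) auto
  next
    case False
    then have z: "W1 0 = 0" "W2 0 \<noteq> 0"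
      using W1_0_nonpos double_well unfolding double_well_def by auto
    have "((\<lambda>s. W1 s / s) \<longlongrightarrow> W2 0) (at 0 within {0..})"
      using W1_deriv_within[of 0] z by (simp add: has_field_derivative_iff)
    then have lim: "((\<lambda>s. W1 s / s) \<longlongrightarrow> W2 0) (at_right 0)"
      by (rule tendsto_within_subset) auto
    have "W2 0 \<le> 0"
    proof (rule tendsto_upperbound[OF lim])
      have "\<forall>\<^sub>F s in at_right (0::real). s \<in> {0<..<1}"
        by (rule eventually_at_right_real) simp
      then show "\<forall>\<^sub>F s in at_right 0. W1 s / s \<le> 0"
        by eventually_elim (auto simp: divide_le_0_iff W1_neg less_imp_le)
    qed simp
    then have n: "W2 0 < 0" using z by simp
    have "\<forall>\<^sub>F s in at_right 0. W1 s / s < W2 0 / 2"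
      by (rule order_tendstoD[OF lim]) (use n in simp)
    then obtain e where e: "e > 0" "\<And>s. 0 < s \<Longrightarrow> s < e \<Longrightarrow> W1 s / s < W2 0 / 2"
      by (auto simp: eventually_at_right_field)
    have "- W2 0 / 2 * s < - W1 s" if "0 < s" "s < e" for s
      using e(2)[OF that] that by (simp add: field_simps)
    then show ?thesis using e(1) n by (intro exI[of _ "- W2 0 / 2"] exI[of _ e]) auto
  qed
  then obtain k e where ke: "0 < k" "0 < e"
    "\<And>s. 0 < s \<Longrightarrow> s < e \<Longrightarrow> s \<le> a \<Longrightarrow> k * s < - W1 s" by blast
  \<comment> \<open>Strictly inside the neighbourhood of 0 already treated, so that
    \<open>{e'..a}\<close> is compact, nonempty and covers the rest.\<close>
  define e' where "e' = min e a / 2"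
  have e': "0 < e'" "e' < e" "e' \<le> a" using ke assms by (auto simp: e'_def)
  have "\<exists>x\<in>{e'..a}. \<forall>y\<in>{e'..a}. W1 y \<le> W1 x"
    by (rule continuous_attains_sup)
      (use e' in \<open>auto intro: continuous_on_subset[OF W1_continuous]\<close>)
  then obtain x where x: "x \<in> {e'..a}" "\<And>y. y \<in> {e'..a} \<Longrightarrow> W1 y \<le> W1 x" by blast
  have xn: "W1 x < 0" using W1_neg[of x] x e' assms by auto
  have "min k (- W1 x) * s < - W1 s" if s: "0 < s" "s \<le> a" for s
  proof (cases "s < e")
    case True
    have "min k (- W1 x) * s \<le> k * s" using s by (intro mult_right_mono) auto
    then show ?thesis using ke(3)[OF s(1) True s(2)] by simp
  next
    case False
    have "min k (- W1 x) * s \<le> (- W1 x) * s" using s by (intro mult_right_mono) auto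
    also have "\<dots> < - W1 x * 1" by (rule mult_strict_left_mono) (use xn s assms in auto)
    finally show ?thesis using x(2)[of s] False s e' by auto
  qed
  then show ?thesis using that[of "min k (- W1 x)"] ke xn by auto
qed

lemma W1_lipschitz:
  obtains M where "0 < M" "\<And>r s. 0 \<le> r \<Longrightarrow> r \<le> s \<Longrightarrow> s \<le> 1 \<Longrightarrow> W1 s - W1 r \<le> M * (s - r)"
proof -
  have "\<exists>x\<in>{0..1}. \<forall>y\<in>{0..1}. W2 y \<le> W2 x"
    by (rule continuous_attains_sup) (auto intro: continuous_on_subset[OF W2_continuous])
  then obtain x where x: "\<And>y. 0 \<le> y \<Longrightarrow> y \<le> 1 \<Longrightarrow> W2 y \<le> W2 x"
    unfolding Ball_def atLeastAtMost_iff by blast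
  define M where "M = max 1 (W2 x)"
  have "W1 s - W1 r \<le> M * (s - r)" if rs: "0 \<le> r" "r \<le> s" "s \<le> 1" for r s
  proof (cases "r = s")
    case False
    then obtain z where z: "r < z" "z < s" "W1 s - W1 r = (s - r) * W2 z"
      using W1_MVT[of r s] rs by auto
    have "W2 z \<le> M" using x[of z] z rs by (simp add: M_def)
    then have "(s - r) * W2 z \<le> (s - r) * M" using rs by (intro mult_left_mono) auto
    then show ?thesis using z by (simp add: mult.commute)
  qed simp
  moreover have "0 < M" by (simp add: M_def)
  ultimately show ?thesis using that by blast
qed

text \<open>\<open>W\<close> and \<open>W1\<close> vanish at 1, so the one-sided Lipschitz bound
  makes \<open>W\<close> vanish quadratically there. The square serves \<open>u_less_1\<close>, the
  linear bound the decay of the flux, and the bound on \<open>- W1\<close> the two-point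
  estimate.\<close>

lemma W_bounds:
  "\<exists>C>0. \<forall>s. 0 \<le> s \<and> s \<le> 1 \<longrightarrow> W s \<le> C * (1 - s) \<and> W s \<le> C * (1 - s)\<^sup>2 \<and> - W1 s \<le> C"
proof -
  obtain C where C: "0 < C" "\<And>r s. 0 \<le> r \<Longrightarrow> r \<le> s \<Longrightarrow> s \<le> 1 \<Longrightarrow> W1 s - W1 r \<le> C * (s - r)"
    using W1_lipschitz by blast
  have 1: "- W1 s \<le> C * (1 - s)" if s: "0 \<le> s" "s \<le> 1" for s
    using C(2)[of s 1] s by simp
  have 2: "W s \<le> C * (1 - s)\<^sup>2" if s: "0 \<le> s" "s \<le> 1" for s
  proof (cases "s = 1")
    case False
    then obtain z where z: "s < z" "z < 1" "W 1 - W s = (1 - s) * W1 z"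
      using W_MVT[of s 1] s by auto
    have "- W1 z \<le> C * (1 - z)" using 1[of z] z s by simp
    also have "\<dots> \<le> C * (1 - s)" using z C by (intro mult_left_mono) auto
    finally have "(1 - s) * (- W1 z) \<le> (1 - s) * (C * (1 - s))"
      using s by (intro mult_left_mono) auto
    then show ?thesis using z by (simp add: power2_eq_square algebra_simps)
  qed simp
  have 3: "C * (1 - s)\<^sup>2 \<le> C * (1 - s)" "C * (1 - s) \<le> C" if s: "0 \<le> s" "s \<le> 1" for s
    using s C(1) by (auto simp: power2_eq_square mult_left_le intro!: mult_left_mono)
  show ?thesis
  proof (intro exI[of _ C] conjI allI impI C(1))
    fix s :: real assume "0 \<le> s \<and> s \<le> 1"
    then have s: "0 \<le> s" "s \<le> 1" by auto
    show "W s \<le> C * (1 - s)" "W s \<le> C * (1 - s)\<^sup>2" "- W1 s \<le> C"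
      using 1[OF s] 2[OF s] 3[OF s] by linarith+
  qed
qed

end

section \<open>The plane and epigraphs\<close>

definition pt :: "real \<Rightarrow> real \<Rightarrow> real^2"
  where "pt a b = vector [a, b]"

lemma pt_nth [simp]: "pt a b $ 1 = a" "pt a b $ 2 = b"
  by (simp_all add: pt_def)

lemma pt_eq_iff: "pt a b = x \<longleftrightarrow> a = x$1 \<and> b = x$2"
  by (auto simp: vec_eq_iff forall_2)

lemma pt_surj [simp]: "pt (x$1) (x$2) = x"
  by (simp add: pt_eq_iff)

lemma pt_arith: "pt a b + pt c d = pt (a + c) (b + d)" "pt a b - pt c d = pt (a - c) (b - d)"
  "t *\<^sub>R pt a b = pt (t * a) (t * b)"
  by (simp_all add: vec_eq_iff forall_2)

lemma axis_pt: "axis 1 1 = pt 1 0" "axis 2 1 = pt 0 1"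
  by (simp_all add: vec_eq_iff forall_2 axis_def)

lemma inner_real2: "(x::real^2) \<bullet> y = x$1 * y$1 + x$2 * y$2"
  by (simp add: inner_vec_def sum_2)

lemma norm_real2: "norm (x::real^2) = sqrt ((x$1)\<^sup>2 + (x$2)\<^sup>2)"
  by (simp add: norm_vec_def L2_set_def sum_2)

lemma continuous_on_pt [continuous_intros]:
  assumes "continuous_on S f" "continuous_on S g"
  shows "continuous_on S (\<lambda>x. pt (f x) (g x))"
proof -
  have eq: "pt a b = a *\<^sub>R axis 1 1 + b *\<^sub>R axis 2 1" for a b
    by (simp add: axis_pt pt_arith)
  show ?thesis unfolding eq by (intro continuous_intros assms)
qed

lemma pt_has_vector_derivative:
  assumes "(f has_real_derivative f') (at t)" "(g has_real_derivative g') (at t)"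
  shows "((\<lambda>t. pt (f t) (g t)) has_vector_derivative pt f' g') (at t)"
proof -
  have eq: "pt a b = a *\<^sub>R axis 1 1 + b *\<^sub>R axis 2 1" for a b
    by (simp add: axis_pt pt_arith)
  show ?thesis unfolding eq
    using assms unfolding has_real_derivative_iff_has_vector_derivative
    by (intro has_vector_derivative_add
      bounded_linear.has_vector_derivative[OF bounded_linear_scaleR_left])
qed

lemma grad_has_derivative:
  assumes "f differentiable (at x)"
  shows "(f has_derivative (\<lambda>h. grad f x \<bullet> h)) (at x)"
proof -
  let ?D = "frechet_derivative f (at x)"
  have D: "(f has_derivative ?D) (at x)"
    using assms frechet_derivative_works by blast
  then have lin: "linear ?D" by (rule has_derivative_linear)
  have "?D h = grad f x \<bullet> h" for h
  proof -
    have "h = h$1 *\<^sub>R axis 1 1 + h$2 *\<^sub>R axis 2 1" by (simp add: axis_pt pt_arith)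
    then have "?D h = ?D (h$1 *\<^sub>R axis 1 1 + h$2 *\<^sub>R axis 2 1)" by (rule arg_cong)
    also have "\<dots> = h$1 * ?D (axis 1 1) + h$2 * ?D (axis 2 1)"
      by (simp add: linear_add[OF lin] linear_scale[OF lin])
    finally show ?thesis by (simp add: inner_real2 grad_def partial_def)
  qed
  then have "?D = (\<lambda>h. grad f x \<bullet> h)" by auto
  with D show ?thesis by simp
qed

lemma grad_chain:
  assumes "f differentiable (at (\<gamma> t))" "(\<gamma> has_vector_derivative v) (at t)"
  shows "((\<lambda>t. f (\<gamma> t)) has_real_derivative grad f (\<gamma> t) \<bullet> v) (at t)"
proof -
  have "((\<lambda>t. f (\<gamma> t)) has_derivative (\<lambda>h. grad f (\<gamma> t) \<bullet> (h *\<^sub>R v))) (at t)"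
    using has_derivative_compose[OF assms(2)[unfolded has_vector_derivative_def]
      grad_has_derivative[OF assms(1)]] .
  moreover have "(\<lambda>h. grad f (\<gamma> t) \<bullet> (h *\<^sub>R v)) = (*) (grad f (\<gamma> t) \<bullet> v)"
    by (auto simp: fun_eq_iff)
  ultimately show ?thesis by (simp add: has_field_derivative_def)
qed

lemma line_has_vector_derivative: "((\<lambda>t. x + t *\<^sub>R v) has_vector_derivative v) (at t)"
  by (auto intro!: derivative_eq_intros)

lemma grad_nth: "grad f x $ i = partial i f x"
  by (simp add: grad_def)

lemma twice_deriv_axis:
  assumes "open S" "x \<in> S" "Ck_on 2 S f"
  shows "twice_deriv (\<lambda>t. f (x + t *\<^sub>R axis i 1)) 0 (partial i f x) (partial i (partial i f) x)"
proof -
  have d: "f differentiable (at y)" "partial i f differentiable (at y)" if "y \<in> S" for y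
    using assms(3) that by (auto simp: numeral_2_eq_2)
  have c: "continuous_on UNIV (\<lambda>t::real. x + t *\<^sub>R axis i (1::real))"
    by (intro continuous_intros)
  have op: "open {t. x + t *\<^sub>R axis i 1 \<in> S}"
    using open_vimage[OF assms(1) c] by (simp add: vimage_def)
  have ax: "grad g y \<bullet> axis i 1 = partial i g y" for g y
    by (simp add: inner_axis grad_nth)
  have "twice_deriv (\<lambda>t. f (x + t *\<^sub>R axis i 1)) 0 (partial i f (x + 0 *\<^sub>R axis i 1))
      (partial i (partial i f) (x + 0 *\<^sub>R axis i 1))"
  proof (rule twice_derivI[OF op])
    show "((\<lambda>t. f (x + t *\<^sub>R axis i 1)) has_real_derivative
        partial i f (x + t *\<^sub>R axis i 1)) (at t)"
      if "t \<in> {t. x + t *\<^sub>R axis i 1 \<in> S}" for t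
      using grad_chain[OF d(1) line_has_vector_derivative, of x t "axis i 1"] that
      by (simp add: ax)
    show "((\<lambda>t. partial i f (x + t *\<^sub>R axis i 1)) has_real_derivative
        partial i (partial i f) (x + 0 *\<^sub>R axis i 1)) (at 0)"
      using grad_chain[OF d(2) line_has_vector_derivative, of x 0 "axis i 1"] assms(2)
      by (simp add: ax)
  qed (use assms in auto)
  then show ?thesis by simp
qed

lemma open_epigraph2:
  assumes "continuous_on UNIV \<phi>"
  shows "open (epigraph2 \<phi>)"
  unfolding epigraph2_def
  by (intro open_Collect_less continuous_intros continuous_on_compose2[OF assms]) auto

lemma closed_epigraph:
  assumes "continuous_on UNIV \<phi>"
  shows "closed {x::real^2. \<phi> (x$1) \<le> x$2}"
  by (intro closed_Collect_le continuous_intros continuous_on_compose2[OF assms]) auto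

lemma closure_epigraph2:
  assumes "continuous_on UNIV \<phi>"
  shows "closure (epigraph2 \<phi>) = {x. \<phi> (x$1) \<le> x$2}"
proof
  show "closure (epigraph2 \<phi>) \<subseteq> {x. \<phi> (x$1) \<le> x$2}"
    by (rule closure_minimal[OF _ closed_epigraph[OF assms]]) (auto simp: epigraph2_def)
  show "{x. \<phi> (x$1) \<le> x$2} \<subseteq> closure (epigraph2 \<phi>)"
  proof
    fix x :: "real^2" assume x: "x \<in> {x. \<phi> (x$1) \<le> x$2}"
    show "x \<in> closure (epigraph2 \<phi>)"
    proof (rule closure_sequential[THEN iffD2], intro exI conjI allI)
      show "x + (1 / real (Suc n)) *\<^sub>R axis 2 1 \<in> epigraph2 \<phi>" for n
      proof -
        have "\<phi> (x$1) \<le> x$2" "0 < 1 / real (Suc n)" using x by auto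
        then have "\<phi> (x$1) < x$2 + 1 / real (Suc n)" by (rule order.strict_trans1[OF _ less_add_same_cancel1[THEN iffD2]])
        then show ?thesis by (simp add: epigraph2_def axis_def)
      qed
      have "(\<lambda>n. x + (1 / real (Suc n)) *\<^sub>R axis 2 (1::real)) \<longlonglongrightarrow> x + 0 *\<^sub>R axis 2 1"
        by (intro tendsto_intros LIMSEQ_Suc lim_1_over_n)
      then show "(\<lambda>n. x + (1 / real (Suc n)) *\<^sub>R axis 2 (1::real)) \<longlonglongrightarrow> x" by simp
    qed
  qed
qed

lemma frontier_epigraph2:
  assumes "continuous_on UNIV \<phi>"
  shows "frontier (epigraph2 \<phi>) = {x. x$2 = \<phi> (x$1)}"
  using closure_epigraph2[OF assms] interior_open[OF open_epigraph2[OF assms]]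
  by (auto simp: frontier_def epigraph2_def)

section \<open>Boundary values of the gradient\<close>

locale overdetermined = double_well_potential +
  fixes \<phi> :: "real \<Rightarrow> real" and u :: "real^2 \<Rightarrow> real"
  assumes smooth: "smooth \<phi>" and solution: "overdetermined_solution W \<phi> u"
begin

abbreviation \<Omega> :: "(real^2) set" where "\<Omega> \<equiv> epigraph2 \<phi>"
abbreviation \<phi>' :: "real \<Rightarrow> real" where "\<phi>' \<equiv> deriv \<phi>"

lemma \<phi>_deriv: "(\<phi> has_real_derivative \<phi>' s) (at s)"
  using smooth unfolding smooth_def
  by (metis DERIV_deriv_iff_real_differentiable funpow_0)

lemma \<phi>_continuous: "continuous_on S \<phi>"
  using \<phi>_deriv by (meson DERIV_continuous_on has_field_derivative_at_within)

lemma \<phi>'_continuous: "continuous_on S \<phi>'"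
proof -
  have "\<phi>' differentiable (at s)" for s
    using smooth[unfolded smooth_def, rule_format, of 1 s] by simp
  then show ?thesis
    by (meson differentiable_at_withinI differentiable_imp_continuous_on differentiable_on_def)
qed

lemma in_\<Omega>: "x \<in> \<Omega> \<longleftrightarrow> \<phi> (x$1) < x$2"
  by (simp add: epigraph2_def)

lemma open_\<Omega>: "open \<Omega>"
  by (rule open_epigraph2[OF \<phi>_continuous])

lemma in_closure: "x \<in> closure \<Omega> \<longleftrightarrow> \<phi> (x$1) \<le> x$2"
  by (simp add: closure_epigraph2[OF \<phi>_continuous])

lemma in_frontier: "x \<in> frontier \<Omega> \<longleftrightarrow> x$2 = \<phi> (x$1)"
  by (simp add: frontier_epigraph2[OF \<phi>_continuous])

lemma closure_cases:
  assumes "x \<in> closure \<Omega>"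
  obtains "x \<in> \<Omega>" | "x \<in> frontier \<Omega>"
  using assms in_closure in_\<Omega> in_frontier by force

lemma C2: "Ck_on 2 \<Omega> u" and C1: "C1_closure \<Omega> u"
  and equation: "x \<in> \<Omega> \<Longrightarrow> laplacian u x = W1 (u x)"
  and u_pos: "x \<in> \<Omega> \<Longrightarrow> 0 < u x"
  and u_frontier: "x \<in> frontier \<Omega> \<Longrightarrow> u x = 0"
  using solution unfolding overdetermined_solution_def by auto

lemma u_continuous: "continuous_on (closure \<Omega>) u"
  using C1 unfolding C1_closure_def by blast

lemma u_nonneg: "x \<in> closure \<Omega> \<Longrightarrow> 0 \<le> u x"
  using u_pos u_frontier by (metis closure_cases less_imp_le order_refl)

lemma u_differentiable: "x \<in> \<Omega> \<Longrightarrow> u differentiable (at x)"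
  using C2 by (simp add: numeral_2_eq_2)

lemma laplacian_sum:
  "x \<in> \<Omega> \<Longrightarrow> partial 1 (partial 1 u) x + partial 2 (partial 2 u) x = W1 (u x)"
  using equation[of x] by (simp add: laplacian_def sum_2)

lemmas u_twice_deriv = twice_deriv_axis[OF open_\<Omega> _ C2]

text \<open>The continuous extension of the gradient to the closed domain. It replaces the limits in
  \<open>bdry_grad\<close>, with which it agrees by \<open>bdry_grad_eq\<close>.\<close>

definition Du :: "real^2 \<Rightarrow> real^2"
  where "Du = (SOME G. continuous_on (closure \<Omega>) G \<and> (\<forall>x\<in>\<Omega>. G x = grad u x))"

lemma Du: "continuous_on (closure \<Omega>) Du" "x \<in> \<Omega> \<Longrightarrow> Du x = grad u x"
proof -
  have "\<exists>G. continuous_on (closure \<Omega>) G \<and> (\<forall>x\<in>\<Omega>. G x = grad u x)"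
    using C1 unfolding C1_closure_def by blast
  from someI_ex[OF this] show "continuous_on (closure \<Omega>) Du" "x \<in> \<Omega> \<Longrightarrow> Du x = grad u x"
    unfolding Du_def by auto
qed

lemma Du_nth: "x \<in> \<Omega> \<Longrightarrow> Du x $ i = partial i u x"
  by (simp add: Du grad_nth)

lemma u_has_derivative: "x \<in> \<Omega> \<Longrightarrow> (u has_derivative (\<lambda>h. Du x \<bullet> h)) (at x)"
  using grad_has_derivative[OF u_differentiable] by (simp add: Du)

lemma u_chain:
  assumes "\<gamma> t \<in> \<Omega>" "(\<gamma> has_vector_derivative v) (at t)"
  shows "((\<lambda>t. u (\<gamma> t)) has_real_derivative Du (\<gamma> t) \<bullet> v) (at t)"
  using grad_chain[OF u_differentiable[OF assms(1)] assms(2)] assms by (simp add: Du)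

lemma bdry_grad_eq:
  assumes "x \<in> frontier \<Omega>"
  shows "bdry_grad \<Omega> u x = Du x"
proof -
  have x: "x \<in> closure \<Omega>" "x \<notin> \<Omega>" using assms in_frontier in_closure in_\<Omega> by auto
  then have nt: "at x within \<Omega> \<noteq> bot"
    by (metis Diff_empty Diff_insert0 at_within_eq_bot_iff)
  have "(Du \<longlongrightarrow> Du x) (at x within closure \<Omega>)"
    using Du(1) x by (simp add: continuous_on_def)
  then have "(Du \<longlongrightarrow> Du x) (at x within \<Omega>)"
    by (rule tendsto_within_subset) (rule closure_subset)
  moreover have "\<forall>\<^sub>F y in at x within \<Omega>. Du y = grad u y"
    by (auto simp: eventually_at_filter Du)
  ultimately have "(grad u \<longlongrightarrow> Du x) (at x within \<Omega>)"
    using tendsto_cong by blast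
  then show ?thesis unfolding bdry_grad_def by (rule tendsto_Lim[OF nt])
qed

definition slope :: real
  where "slope = (SOME c. \<forall>x\<in>frontier \<Omega>. normal_deriv \<phi> u x = c)"

lemma normal_component:
  assumes "x \<in> frontier \<Omega>"
  shows "Du x \<bullet> outer_normal \<phi> x = slope"
proof -
  have "\<exists>c. \<forall>x\<in>frontier \<Omega>. normal_deriv \<phi> u x = c"
    using solution unfolding overdetermined_solution_def by blast
  from someI_ex[OF this] have "normal_deriv \<phi> u x = slope"
    using assms unfolding slope_def by blast
  then show ?thesis using bdry_grad_eq[OF assms] by (simp add: normal_deriv_def)
qed

text \<open>No derivative across the boundary is available, so \<open>u = 0\<close> cannot simply be
  differentiated along the graph. The graph lifted by \<open>e\<close> lies in \<Omega>: a nonzero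
  limit of the tangential derivative would make \<open>u\<close> vary by a fixed amount along a
  piece of every lifted graph, whereas the values at the two ends of that piece tend to 0.\<close>

lemma tangential_component: "Du (pt s (\<phi> s)) \<bullet> pt 1 (\<phi>' s) = 0"
proof -
  define H where "H = (\<lambda>(r, e). Du (pt r (\<phi> r + e)) \<bullet> pt 1 (\<phi>' r))"
  have H: "continuous_on (UNIV \<times> {0..}) H"
    unfolding H_def split_def
    by (intro continuous_intros continuous_on_compose2[OF Du(1)]
        continuous_on_compose2[OF \<phi>_continuous[of UNIV]]
        continuous_on_compose2[OF \<phi>'_continuous[of UNIV]]) (auto simp: in_closure)
  \<comment> \<open>The factor \<open>b\<close> treats both signs of the tangential derivative at
    once.\<close>
  have no: False if b: "b = 1 \<or> b = (-1::real)" and pos: "b * H (s, 0) > 0" for b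
  proof -
    have cont: "continuous_on (UNIV \<times> {0..}) (\<lambda>z. b * H z)" by (intro continuous_intros H)
    define m where "m = b * H (s, 0)"
    obtain d where d: "d > 0" "\<And>z. z \<in> UNIV \<times> {0..} \<Longrightarrow> dist z (s, 0) < d \<Longrightarrow>
        dist (b * H z) (b * H (s, 0)) < m / 2"
      using cont[unfolded continuous_on_iff, rule_format, of "(s, 0)" "m / 2"] pos m_def by auto
    define h where "h = d / 2"
    have h: "h > 0" using d by (simp add: h_def)
    have near: "b * H (r, e) \<ge> m / 2" if "\<bar>r - s\<bar> \<le> h" "0 \<le> e" "e < h" for r e
    proof -
      have "dist (r, e) (s, 0) \<le> \<bar>r - s\<bar> + \<bar>e\<bar>"
        using sqrt_sum_squares_le_sum_abs[of "r - s" e] by (simp add: dist_Pair_Pair dist_real_def)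
      also have "\<dots> < d" using that h_def by auto
      finally have "dist (b * H (r, e)) m < m / 2" using d(2)[of "(r, e)"] that m_def by auto
      then show ?thesis by (simp add: dist_real_def abs_if split: if_splits)
    qed
    have incr: "b * (u (pt (s + h) (\<phi> (s + h) + e)) - u (pt s (\<phi> s + e))) \<ge> h * (m / 2)"
      if e: "0 < e" "e < h" for e
    proof -
      have der: "((\<lambda>r. u (pt r (\<phi> r + e))) has_real_derivative H (r, e)) (at r)" for r
        unfolding H_def split_conv
        by (rule u_chain) (use e in \<open>auto simp: in_\<Omega> intro!: pt_has_vector_derivative
          derivative_eq_intros \<phi>_deriv\<close>)
      have "\<exists>z. s < z \<and> z < s + h \<and> u (pt (s + h) (\<phi> (s + h) + e)) - u (pt s (\<phi> s + e))
          = (s + h - s) * H (z, e)"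
        by (rule MVT2) (use h der in auto)
      then obtain z where z: "s < z" "z < s + h"
        "u (pt (s + h) (\<phi> (s + h) + e)) - u (pt s (\<phi> s + e)) = h * H (z, e)" by auto
      have "h * (m / 2) \<le> h * (b * H (z, e))"
        using near[of z e] z e h by (intro mult_left_mono) auto
      then show ?thesis using z(3) by (simp add: mult.left_commute)
    qed
    have lim: "((\<lambda>e. u (pt r (\<phi> r + e))) \<longlongrightarrow> 0) (at_right 0)" for r
    proof -
      have "continuous_on {0..} (\<lambda>e. u (pt r (\<phi> r + e)))"
        by (intro continuous_intros continuous_on_compose2[OF u_continuous]) (auto simp: in_closure)
      then have "((\<lambda>e. u (pt r (\<phi> r + e))) \<longlongrightarrow> u (pt r (\<phi> r + 0))) (at 0 within {0..})"
        unfolding continuous_on_def by (rule bspec) simp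
      then have "((\<lambda>e. u (pt r (\<phi> r + e))) \<longlongrightarrow> u (pt r (\<phi> r + 0))) (at_right 0)"
        by (rule tendsto_within_subset) auto
      then show ?thesis using u_frontier[of "pt r (\<phi> r)"] in_frontier by simp
    qed
    have "((\<lambda>e. b * (u (pt (s + h) (\<phi> (s + h) + e)) - u (pt s (\<phi> s + e)))) \<longlongrightarrow> b * (0 - 0))
        (at_right 0)"
      by (intro tendsto_intros lim)
    moreover have "\<forall>\<^sub>F e in at_right 0.
        b * (u (pt (s + h) (\<phi> (s + h) + e)) - u (pt s (\<phi> s + e))) \<ge> h * (m / 2)"
      using eventually_at_right_real[OF h] by eventually_elim (use incr in auto)
    ultimately have "h * (m / 2) \<le> b * (0 - 0)"
      by (rule tendsto_lowerbound) simp
    then show False using mult_pos_pos[OF h, of "m / 2"] pos m_def by auto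
  qed
  have "H (s, 0) = 0" using no[of 1] no[of "-1"] by (cases "H (s, 0)" "0::real" rule: linorder_cases) auto
  then show ?thesis by (simp add: H_def)
qed

lemma Du_frontier:
  assumes "x \<in> frontier \<Omega>"
  shows "Du x = slope *\<^sub>R outer_normal \<phi> x"
proof -
  define d where "d = \<phi>' (x$1)"
  have x: "x = pt (x$1) (\<phi> (x$1))" using assms in_frontier by (simp add: vec_eq_iff forall_2)
  have t: "Du x $ 1 + Du x $ 2 * d = 0"
    using tangential_component[of "x$1"] x by (simp add: inner_real2 d_def)
  have n: "Du x \<bullet> outer_normal \<phi> x = slope" by (rule normal_component[OF assms])
  define N where "N = sqrt (1 + d\<^sup>2)"
  have N: "N > 0" "N\<^sup>2 = 1 + d\<^sup>2" unfolding N_def by (auto intro: add_pos_nonneg)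
  have on: "outer_normal \<phi> x = (1 / N) *\<^sub>R pt d (-1)"
    unfolding outer_normal_def sgn_div_norm d_def[symmetric] pt_def[symmetric]
    by (simp add: norm_real2 N_def add.commute inverse_eq_divide)
  define a where "a = Du x $ 1"
  define b where "b = Du x $ 2"
  have a: "a = - b * d" using t by (simp add: a_def b_def)
  have "(a * d - b) / N = slope" using n by (simp add: on inner_real2 a_def b_def diff_divide_distrib)
  moreover have "a * d - b = - b * N\<^sup>2" unfolding N(2) by (simp add: a power2_eq_square algebra_simps)
  ultimately have sl: "slope = - b * N" using N(1) by (simp add: power2_eq_square)
  have "a = slope * d / N \<and> b = - slope / N" using N a sl by simp
  then show ?thesis by (simp add: on vec_eq_iff forall_2 a_def b_def)
qed

lemma norm_Du_frontier: "x \<in> frontier \<Omega> \<Longrightarrow> norm (Du x) = \<bar>slope\<bar>"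
  by (simp add: Du_frontier outer_normal_unit)

text \<open>The end points may lie on the boundary, where \<open>u\<close> is known to be continuous
  but has no two-sided derivative.\<close>

lemma u_segment_MVT:
  assumes "0 < t" "\<And>s. 0 < s \<Longrightarrow> s < t \<Longrightarrow> x + s *\<^sub>R v \<in> \<Omega>"
    and "x \<in> closure \<Omega>" "x + t *\<^sub>R v \<in> closure \<Omega>"
  obtains s where "0 < s" "s < t" "u (x + t *\<^sub>R v) - u x = t * (Du (x + s *\<^sub>R v) \<bullet> v)"
proof -
  have cl: "x + s *\<^sub>R v \<in> closure \<Omega>" if "0 \<le> s" "s \<le> t" for s
    using assms(2)[of s] assms(3,4) closure_subset that by (cases "s = 0"; cases "s = t") auto
  have "\<exists>l z. z > 0 \<and> z < t \<and> ((\<lambda>s. u (x + s *\<^sub>R v)) has_real_derivative l) (at z) \<and>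
      u (x + t *\<^sub>R v) - u (x + 0 *\<^sub>R v) = (t - 0) * l"
  proof (rule MVT[OF assms(1)])
    show "continuous_on {0..t} (\<lambda>s. u (x + s *\<^sub>R v))"
      by (intro continuous_intros continuous_on_compose2[OF u_continuous]) (use cl in auto)
    show "(\<lambda>s. u (x + s *\<^sub>R v)) differentiable (at s)" if "0 < s" "s < t" for s
      using u_chain[OF assms(2)[OF that] line_has_vector_derivative] real_differentiable_def by blast
  qed
  then obtain l z where z: "z > 0" "z < t" "((\<lambda>s. u (x + s *\<^sub>R v)) has_real_derivative l) (at z)"
    "u (x + t *\<^sub>R v) - u x = t * l" by auto
  have "l = Du (x + z *\<^sub>R v) \<bullet> v"
    using DERIV_unique[OF z(3) u_chain[OF assms(2)[OF z(1,2)] line_has_vector_derivative]] .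
  then show ?thesis using that z by blast
qed

end

section \<open>Bounds on the solution\<close>

lemma eventually_axis:
  fixes x :: "real^2"
  assumes "\<forall>\<^sub>F y in nhds x. P y"
  shows "\<forall>\<^sub>F t in nhds 0. P (x + t *\<^sub>R axis i 1)"
proof -
  have "((\<lambda>t::real. x + t *\<^sub>R axis i (1::real)) \<longlongrightarrow> x + 0 *\<^sub>R axis i 1) (nhds 0)"
    by (intro tendsto_intros) (simp add: filterlim_ident)
  then have "filterlim (\<lambda>t::real. x + t *\<^sub>R axis i (1::real)) (nhds x) (nhds 0)" by simp
  from filterlim_iff[THEN iffD1, OF this, rule_format, OF assms] show ?thesis .
qed

lemma axis_local_max:
  fixes x :: "real^2"
  assumes "\<forall>\<^sub>F y in nhds x. \<Phi> y \<le> \<Phi> x"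
    and "twice_deriv (\<lambda>t. \<Phi> (x + t *\<^sub>R axis i 1)) 0 p q"
  shows "p = 0" "q \<le> 0"
  using twice_deriv_local_max[OF assms(2)] eventually_axis[OF assms(1), of i] by simp_all

text \<open>Squares instead of discs, because the barriers on them are sums or products of functions
  of one coordinate.\<close>

definition sq :: "real^2 \<Rightarrow> real \<Rightarrow> (real^2) set"
  where "sq x L = {y. \<bar>y$1 - x$1\<bar> \<le> L \<and> \<bar>y$2 - x$2\<bar> \<le> L}"

lemma sq_cbox: "sq x L = cbox (x - pt L L) (x + pt L L)"
  by (auto simp: sq_def mem_box_cart forall_2 abs_le_iff algebra_simps)

lemma compact_sq: "compact (sq x L)"
  by (simp add: sq_cbox compact_cbox)

lemma sq_subset:
  assumes "y \<in> sq x a" "a + b \<le> c"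
  shows "sq y b \<subseteq> sq x c"
proof
  fix z assume z: "z \<in> sq y b"
  have "\<bar>z$i - x$i\<bar> \<le> \<bar>z$i - y$i\<bar> + \<bar>y$i - x$i\<bar>" for i by simp
  from this[of 1] this[of 2] show "z \<in> sq x c" using z assms unfolding sq_def by simp
qed

lemma eventually_sq:
  assumes "\<bar>y$1 - x$1\<bar> < L" "\<bar>y$2 - x$2\<bar> < L"
  shows "\<forall>\<^sub>F z in nhds y. z \<in> sq x L"
proof -
  have "open {z::real^2. \<bar>z$1 - x$1\<bar> < L \<and> \<bar>z$2 - x$2\<bar> < L}"
    by (intro open_Collect_conj open_Collect_less continuous_intros)
  then have "\<forall>\<^sub>F z in nhds y. z \<in> {z. \<bar>z$1 - x$1\<bar> < L \<and> \<bar>z$2 - x$2\<bar> < L}"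
    using assms by (auto simp: eventually_nhds)
  then show ?thesis by eventually_elim (auto simp: sq_def)
qed

lemma center_in_sq: "0 \<le> L \<Longrightarrow> x \<in> sq x L"
  by (simp add: sq_def)

lemma twice_deriv_inverse_power:
  assumes "(y::real) > 0"
  shows "twice_deriv (\<lambda>s. 1 / s ^ n) y (- real n / y ^ (n + 1)) (real n * (real n + 1) / y ^ (n + 2))"
proof -
  have D: "((\<lambda>s. inverse s ^ k) has_real_derivative - (real k * inverse s ^ (k + 1))) (at s)"
    if "s > 0" for s :: real and k
    using DERIV_power[OF DERIV_inverse, of s k] that by (cases k) (simp_all add: algebra_simps)
  have "twice_deriv (\<lambda>s. inverse s ^ n) y (- (real n * inverse y ^ (n + 1)))
      (real n * (real n + 1) * inverse y ^ (n + 2))"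
  proof (rule twice_derivI[of "{0<..}"])
    show "((\<lambda>s. - (real n * inverse s ^ (n + 1))) has_real_derivative
        real n * (real n + 1) * inverse y ^ (n + 2)) (at y)"
      using DERIV_cmult[OF D[OF assms, of "n + 1"], of "- real n"] by (simp add: algebra_simps)
  qed (use assms D in auto)
  then show ?thesis by (simp add: divide_inverse power_inverse)
qed

context overdetermined
begin

lemma u_attains_sup_on_compact:
  assumes "compact K" "x0 \<in> K" "K \<subseteq> closure \<Omega>"
  obtains M where "\<And>x. x \<in> K \<Longrightarrow> u x \<le> M"
proof -
  have "\<exists>x\<in>K. \<forall>y\<in>K. u y \<le> u x"
    using assms by (intro continuous_attains_sup continuous_on_subset[OF u_continuous]) auto
  then show ?thesis using that by blast
qed

text \<open>Keller--Osserman: the barrier is \<open>1\<close> plus a sum of two functions of one variable blowing up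
  on the sides of a large square.\<close>

lemma u_le_1:
  assumes "x \<in> closure \<Omega>"
  shows "u x \<le> 1"
proof (rule ccontr)
  assume "\<not> u x \<le> 1"
  then have ux: "u x > 1" by simp
  then have x: "x \<in> \<Omega>" using assms u_frontier by (metis closure_cases not_one_less_zero)
  obtain p c where pc: "1 < p" "0 < c" "\<And>s. 1 < s \<Longrightarrow> c * (s - 1) powr p \<le> W1 s"
    using W1_superlinear by blast
  obtain \<gamma> \<kappa> where g: "0 < \<gamma>" "\<gamma> < 1" "0 < \<kappa>"
    "\<And>r s. \<gamma> \<le> r \<Longrightarrow> r \<le> s \<Longrightarrow> \<kappa> * (s - r) \<le> W1 s - W1 r"
    using W1_growth by blast
  \<comment> \<open>The barrier equals \<open>1 + 2 * B\<close> at the centre, halfway between 1 and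
    \<open>u x\<close>.\<close>
  define B where "B = (u x - 1) / 4"
  have B: "B > 0" using ux by (simp add: B_def)
  \<comment> \<open>Two derivatives of \<open>1 / Y ^ q\<close> cost the power \<open>q + 2\<close>,
    while (W4) yields the power \<open>q * p\<close>; this \<open>q\<close> lets the latter
    win.\<close>
  define q where "q = nat \<lceil>2 / (p - 1)\<rceil>"
  have "2 / (p - 1) \<le> real q" unfolding q_def by linarith
  then have q: "real q + 2 \<le> real q * p" using pc(1) by (simp add: field_simps)
  define A where "A = 2 * real q + 4 * real q * (real q + 1)"
  have A: "A \<ge> 0" by (simp add: A_def)
  \<comment> \<open>\<open>A / R\<^sup>2\<close> bounds the second derivative of
    \<open>1 / Y ^ q\<close> in units of \<open>1 / Y ^ (q + 2)\<close>; \<open>R\<close> is so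
    large that each axis costs less than half of the growth in (W4).\<close>
  define R where "R = sqrt (B * (A + 1) / (c / 2 * B powr p))"
  have Bp: "B powr p > 0" using B by simp
  have R: "R > 0" "R\<^sup>2 * (c / 2 * B powr p) = B * (A + 1)"
    using A B pc(2) Bp by (auto simp: R_def)
  have RA: "B * A / R\<^sup>2 < c / 2 * B powr p"
  proof -
    have "B * A < R\<^sup>2 * (c / 2 * B powr p)" unfolding R(2) using B by simp
    then show ?thesis using R(1) by (simp add: field_simps)
  qed
  obtain M where M: "\<And>y. y \<in> sq x R \<inter> closure \<Omega> \<Longrightarrow> u y \<le> M"
    by (rule u_attains_sup_on_compact[of "sq x R \<inter> closure \<Omega>" x])
      (use compact_sq assms center_in_sq R in \<open>auto intro: compact_Int_closed\<close>)
  have q1: "q \<ge> 1" using q pc(1) by (cases q) auto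
  \<comment> \<open>Stopping at \<open>Y = m\<close> instead of 0 keeps the barrier finite and
    continuous on a closed square, and \<open>m\<close> is so small that the barrier already exceeds
    \<open>M\<close> on its sides.\<close>
  define m where "m = min (1 / 2) (B / (\<bar>M\<bar> + 1))"
  have m: "0 < m" "m < 1" "m * (\<bar>M\<bar> + 1) \<le> B"
  proof -
    have "m \<le> B / (\<bar>M\<bar> + 1)" by (simp add: m_def)
    then show "m * (\<bar>M\<bar> + 1) \<le> B" by (simp add: pos_le_divide_eq)
  qed (use B in \<open>auto simp: m_def\<close>)
  have mq: "\<bar>M\<bar> + 1 \<le> B * (1 / m ^ q)"
  proof -
    have "m ^ q \<le> m" using power_decreasing[OF q1, of m] m by simp
    then have "m ^ q * (\<bar>M\<bar> + 1) \<le> m * (\<bar>M\<bar> + 1)" by (rule mult_right_mono) simp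
    then show ?thesis using m by (simp add: field_simps)
  qed
  define r where "r = R * sqrt (1 - m)"
  have r: "0 < r" "r\<^sup>2 = R\<^sup>2 * (1 - m)" "r < R"
    using R(1) m by (auto simp: r_def power_mult_distrib)
  define Y where "Y = (\<lambda>c. 1 - c\<^sup>2 / R\<^sup>2)"
  have Y: "m \<le> Y c" "Y c \<le> 1" "c\<^sup>2 \<le> R\<^sup>2" if "\<bar>c\<bar> \<le> r" for c
  proof -
    have "c\<^sup>2 \<le> r\<^sup>2" using that r(1) by (simp add: abs_le_square_iff[symmetric])
    then have c: "c\<^sup>2 \<le> R\<^sup>2 * (1 - m)" by (simp only: r(2))
    then show "m \<le> Y c" "Y c \<le> 1" using R(1) by (auto simp: Y_def field_simps)
    have "R\<^sup>2 * (1 - m) \<le> R\<^sup>2 * 1" using m by (intro mult_left_mono) auto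
    then show "c\<^sup>2 \<le> R\<^sup>2" using c by simp
  qed
  define f where "f = (\<lambda>c. B * (1 / Y c ^ q))"
  have f0: "0 < f c" if "\<bar>c\<bar> \<le> r" for c using Y(1)[OF that] m B by (simp add: f_def)
  define v where "v = (\<lambda>y::real^2. 1 + f (y$1 - x$1) + f (y$2 - x$2))"
  define K where "K = sq x r \<inter> closure \<Omega>"
  have K: "compact K" using compact_sq by (auto simp: K_def intro: compact_Int_closed)
  have xK: "x \<in> K" using assms center_in_sq r by (auto simp: K_def)
  have KY: "\<bar>y$i - x$i\<bar> \<le> r" if "y \<in> K" for y i
    using that exhaust_2[of i] by (auto simp: K_def sq_def)
  have cont: "continuous_on K (\<lambda>y. u y - v y)"
  proof -
    have "continuous_on K u" by (rule continuous_on_subset[OF u_continuous]) (simp add: K_def)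
    moreover have "continuous_on K (\<lambda>y. Y (y$i - x$i))" for i
      unfolding Y_def by (intro continuous_intros) (use R in auto)
    moreover have "Y (y$i - x$i) ^ q \<noteq> 0" if "y \<in> K" for y i
      using Y(1)[OF KY[OF that], of i] m(1) by simp
    ultimately show ?thesis unfolding v_def f_def
      by (intro continuous_on_diff continuous_on_add continuous_on_mult continuous_on_divide
        continuous_on_const continuous_on_power) auto
  qed
  obtain z where z: "z \<in> K" "\<And>y. y \<in> K \<Longrightarrow> u y - v y \<le> u z - v z"
    using continuous_attains_sup[OF K _ cont] xK by blast
  have "v x = 1 + 2 * B" by (simp add: v_def f_def Y_def)
  then have "u x - v x > 0" using ux by (simp add: B_def field_simps)
  then have pos: "v z < u z" using z(2)[OF xK] by simp
  have vz: "1 < v z" using f0[OF KY[OF z(1)], of 1] f0[OF KY[OF z(1)], of 2] by (simp add: v_def)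
  have zO: "z \<in> \<Omega>"
    using z(1) u_frontier[of z] pos vz by (auto simp: K_def elim: closure_cases)
  have uM: "u z \<le> M" by (rule M) (use z(1) r in \<open>auto simp: K_def sq_def\<close>)
  have strict: "\<bar>z$i - x$i\<bar> < r" for i
  proof (rule ccontr)
    assume "\<not> \<bar>z$i - x$i\<bar> < r"
    then have "\<bar>z$i - x$i\<bar> = r" using KY[OF z(1)] by (metis order.order_iff_strict)
    then have "(z$i - x$i)\<^sup>2 = r\<^sup>2" by (metis power2_abs)
    then have "Y (z$i - x$i) = m" unfolding Y_def r(2) using R(1) by simp
    then have "f (z$i - x$i) \<ge> \<bar>M\<bar> + 1" unfolding f_def using mq by simp
    then have "v z > M" using f0[OF KY[OF z(1)], of 1] f0[OF KY[OF z(1)], of 2] exhaust_2[of i]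
      by (auto simp: v_def)
    then show False using pos uM by simp
  qed
  have ev: "\<forall>\<^sub>F y in nhds z. u y - v y \<le> u z - v z"
    using eventually_sq[OF strict strict] eventually_nhds_in_open[OF open_\<Omega> zO]
    by eventually_elim (use z(2) closure_subset in \<open>auto simp: K_def\<close>)
  define Z where "Z = (\<lambda>i. 1 / Y (z$i - x$i))"
  have Z: "1 \<le> Z i" for i
    using Y(1,2)[OF KY[OF z(1), of i]] m(1) by (simp add: Z_def)
  have le: "partial i (partial i u) z \<le> B * A / R\<^sup>2 * Z i ^ (q + 2)" for i
  proof -
    define c where "c = z$i - x$i"
    have Yc: "0 < Y c" "Y c \<le> 1" "c\<^sup>2 \<le> R\<^sup>2"
      using Y[OF KY[OF z(1), of i]] m(1) by (auto simp: c_def)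
    have 1: "twice_deriv (\<lambda>t. 1 - 1 / R\<^sup>2 * (c + t)\<^sup>2) 0 (0 - 1 / R\<^sup>2 * (2 * c)) (0 - 1 / R\<^sup>2 * 2)"
      by (intro twice_deriv_diff twice_deriv_const twice_deriv_cmult twice_deriv_shift_square)
    have 2: "twice_deriv (\<lambda>s. 1 / s ^ q) (1 - 1 / R\<^sup>2 * (c + 0)\<^sup>2) (- real q / Y c ^ (q + 1))
        (real q * (real q + 1) / Y c ^ (q + 2))"
      using twice_deriv_inverse_power[OF Yc(1), of q] by (simp add: Y_def)
    define S where "S = real q * (real q + 1) / Y c ^ (q + 2) * (0 - 1 / R\<^sup>2 * (2 * c))\<^sup>2
        + - real q / Y c ^ (q + 1) * (0 - 1 / R\<^sup>2 * 2)"
    define k where "k = v z - f c"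
    have vi: "v (z + t *\<^sub>R axis i 1) = B * (1 / (1 - 1 / R\<^sup>2 * (c + t)\<^sup>2) ^ q) + k" for t
    proof -
      consider "i = 1" | "i = 2" using exhaust_2[of i] by blast
      then show ?thesis
        by cases (simp_all add: axis_pt k_def c_def v_def f_def Y_def algebra_simps)
    qed
    have "twice_deriv (\<lambda>t. u (z + t *\<^sub>R axis i 1) - v (z + t *\<^sub>R axis i 1)) 0
        (partial i u z - (B * (- real q / Y c ^ (q + 1) * (0 - 1 / R\<^sup>2 * (2 * c))) + 0))
        (partial i (partial i u) z - (B * S + 0))"
      unfolding vi S_def
      by (intro twice_deriv_diff twice_deriv_add twice_deriv_const twice_deriv_cmult
          u_twice_deriv[OF zO] twice_deriv_compose[OF 1 2])
    from axis_local_max(2)[OF ev this] have "partial i (partial i u) z \<le> B * S" by simp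
    also have "S \<le> A / R\<^sup>2 * (1 / Y c ^ (q + 2))"
    proof -
      have "(0 - 1 / R\<^sup>2 * (2 * c))\<^sup>2 = 4 * c\<^sup>2 / (R\<^sup>2 * R\<^sup>2)" by (simp add: power2_eq_square)
      also have "\<dots> \<le> 4 * R\<^sup>2 / (R\<^sup>2 * R\<^sup>2)" using Yc(3) by (intro divide_right_mono) auto
      also have "\<dots> = 4 / R\<^sup>2" using R(1) by (intro nonzero_mult_divide_mult_cancel_right) simp
      finally have "real q * (real q + 1) / Y c ^ (q + 2) * (0 - 1 / R\<^sup>2 * (2 * c))\<^sup>2 \<le>
          real q * (real q + 1) / Y c ^ (q + 2) * (4 / R\<^sup>2)"
        using Yc(1) by (intro mult_left_mono) auto
      moreover have "real q / Y c ^ (q + 1) \<le> real q / Y c ^ (q + 2)"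
        using Yc(1,2) by (intro divide_left_mono power_decreasing) auto
      then have "real q / Y c ^ (q + 1) * (2 / R\<^sup>2) \<le> real q / Y c ^ (q + 2) * (2 / R\<^sup>2)"
        by (rule mult_right_mono) simp
      moreover have "real q * (real q + 1) / Y c ^ (q + 2) * (4 / R\<^sup>2) +
          real q / Y c ^ (q + 2) * (2 / R\<^sup>2) = A / R\<^sup>2 * (1 / Y c ^ (q + 2))"
        using R(1) Yc(1) by (simp add: A_def field_simps)
      ultimately show ?thesis unfolding S_def by simp
    qed
    then have "B * S \<le> B * (A / R\<^sup>2 * (1 / Y c ^ (q + 2)))" using B by (intro mult_left_mono) auto
    also have "\<dots> = B * A / R\<^sup>2 * Z i ^ (q + 2)" by (simp add: Z_def c_def power_one_over)
    finally show ?thesis .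
  qed
  \<comment> \<open>\<open>v z - 1\<close> dominates each of its two summands, so each axis may
    claim half of the nonlinear term.\<close>
  have low: "c / 2 * B powr p * Z i ^ (q + 2) \<le> c * (v z - 1) powr p / 2" for i
  proof -
    have "Z i ^ (q + 2) = Z i powr real (q + 2)"
      using Z[of i] by (intro powr_realpow[symmetric]) simp
    also have "\<dots> \<le> Z i powr (real q * p)" using q Z[of i] by (intro powr_mono) auto
    also have "\<dots> = (Z i ^ q) powr p"
      using Z[of i] by (simp add: powr_powr[symmetric] powr_realpow)
    finally have "B powr p * Z i ^ (q + 2) \<le> B powr p * (Z i ^ q) powr p"
      by (intro mult_left_mono) auto
    also have "\<dots> = (B * Z i ^ q) powr p"
      using B Z[of i] by (intro powr_mult[symmetric])
    also have "\<dots> \<le> (v z - 1) powr p"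
    proof (rule powr_mono2)
      have "B * Z i ^ q = f (z$i - x$i)" by (simp add: f_def Z_def power_one_over)
      then show "B * Z i ^ q \<le> v z - 1"
        using f0[OF KY[OF z(1)], of 1] f0[OF KY[OF z(1)], of 2] exhaust_2[of i]
        by (auto simp: v_def)
    qed (use pc B Z[of i] in auto)
    finally have "c / 2 * (B powr p * Z i ^ (q + 2)) \<le> c / 2 * (v z - 1) powr p"
      using pc by (intro mult_left_mono) auto
    then show ?thesis by simp
  qed
  \<comment> \<open>At the contact point the Laplacian of \<open>u\<close> is at most that of the
    barrier, which is less than \<open>W1 (v z)\<close>; monotonicity of \<open>W1\<close> above 1
    closes the circle.\<close>
  have "W1 (u z) \<le> B * A / R\<^sup>2 * Z 1 ^ (q + 2) + B * A / R\<^sup>2 * Z 2 ^ (q + 2)"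
    using le[of 1] le[of 2] laplacian_sum[OF zO] by simp
  also have "\<dots> < c / 2 * B powr p * Z 1 ^ (q + 2) + c / 2 * B powr p * Z 2 ^ (q + 2)"
    using RA Z[of 1] Z[of 2] by (intro add_strict_mono mult_strict_right_mono) auto
  also have "\<dots> \<le> c * (v z - 1) powr p" using low[of 1] low[of 2] by simp
  also have "\<dots> \<le> W1 (v z)" by (rule pc(3)[OF vz])
  also have "\<dots> \<le> W1 (u z)"
  proof -
    have "\<kappa> * (u z - v z) \<le> W1 (u z) - W1 (v z)" using g(2) vz pos by (intro g(4)) auto
    moreover have "0 < \<kappa> * (u z - v z)" using pos g by simp
    ultimately show ?thesis by simp
  qed
  finally show False by simp
qed

text \<open>The cosine product \<psi> is a Dirichlet eigenfunction of the square for the eigenvalue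
  \<open>k\<close>. Scale it until it touches \<open>u\<close> from below, at \<open>z\<close>. If
  \<open>u x < a\<close>, the scaled function has maximum below \<open>a\<close>, so
  \<open>u z < a\<close> and \<open>W1 (u z) < - k * u z\<close>. But the scaled function has
  Laplacian \<open>- k * u z\<close> at \<open>z\<close>, and this cannot exceed the Laplacian of
  \<open>u\<close> there.\<close>

lemma u_lower_bound:
  assumes "0 < a" "a < 1"
  obtains L where "0 < L" "\<And>x. sq x L \<subseteq> \<Omega> \<Longrightarrow> a \<le> u x"
proof -
  obtain k where k: "0 < k" "\<And>s. 0 < s \<Longrightarrow> s \<le> a \<Longrightarrow> k * s < - W1 s"
    using W1_linear_bound[OF assms] by blast
  \<comment> \<open>Two factors of frequency \<open>w\<close> give the eigenvalue
    \<open>2 * w\<^sup>2 = k\<close>; \<open>L\<close> is their first zero.\<close>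
  define w where "w = sqrt (k / 2)"
  have w: "w > 0" "2 * w\<^sup>2 = k" using k by (auto simp: w_def)
  define L where "L = pi / (2 * w)"
  have L: "L > 0" "w * L = pi / 2" using w by (auto simp: L_def)
  have "a \<le> u x" if sqx: "sq x L \<subseteq> \<Omega>" for x
  proof (rule ccontr)
    assume less: "\<not> a \<le> u x"
    define \<psi> where "\<psi> = (\<lambda>y::real^2. cos (w * (y$1 - x$1)) * cos (w * (y$2 - x$2)))"
    have up: "u y > 0" if "y \<in> sq x L" for y using sqx that u_pos by blast
    have "\<exists>z\<in>sq x L. \<forall>y\<in>sq x L. \<psi> y / u y \<le> \<psi> z / u z"
    proof (rule continuous_attains_sup[OF compact_sq])
      show "sq x L \<noteq> {}" using center_in_sq[of L x] L by auto
      have "continuous_on (sq x L) u"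
        using sqx closure_subset by (intro continuous_on_subset[OF u_continuous]) blast
      then show "continuous_on (sq x L) (\<lambda>y. \<psi> y / u y)"
        unfolding \<psi>_def using up by (intro continuous_intros) (auto dest: up)
    qed
    then obtain z where z: "z \<in> sq x L" "\<And>y. y \<in> sq x L \<Longrightarrow> \<psi> y / u y \<le> \<psi> z / u z" by blast
    define s where "s = \<psi> z / u z"
    have xs: "x \<in> sq x L" using center_in_sq L by auto
    have "1 / u x \<le> s" using z(2)[OF xs] by (simp add: s_def \<psi>_def)
    moreover have "1 / a < 1 / u x" using less up[OF xs] by (simp add: frac_less2)
    ultimately have s: "s > 1 / a" by simp
    then have s0: "s > 0" using assms by (metis divide_pos_pos less_trans zero_less_one)
    have \<psi>z: "\<psi> z = s * u z" using up[OF z(1)] by (simp add: s_def)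
    then have \<psi>pos: "\<psi> z > 0" using s0 up[OF z(1)] by simp
    have strict: "\<bar>z$i - x$i\<bar> < L" for i
    proof (rule ccontr)
      assume "\<not> \<bar>z$i - x$i\<bar> < L"
      moreover have "\<bar>z$i - x$i\<bar> \<le> L" using z(1) exhaust_2[of i] by (auto simp: sq_def)
      ultimately have "\<bar>z$i - x$i\<bar> = L" by simp
      then have "z$i - x$i = L \<or> z$i - x$i = - L" by (auto simp: abs_if split: if_splits)
      moreover have "cos (w * L) = 0" unfolding L(2) by (rule cos_pi_half)
      ultimately have "cos (w * (z$i - x$i)) = 0" by (metis mult_minus_right cos_minus)
      then show False using \<psi>pos exhaust_2[of i] by (auto simp: \<psi>_def)
    qed
    have ev: "\<forall>\<^sub>F y in nhds z. \<psi> y / s - u y \<le> \<psi> z / s - u z"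
      using eventually_sq[OF strict strict]
    proof eventually_elim
      case (elim y)
      have "\<psi> y \<le> s * u y" using z(2)[OF elim] up[OF elim] by (simp add: s_def field_simps)
      then show ?case using s0 \<psi>z by (simp add: field_simps)
    qed
    have zO: "z \<in> \<Omega>" using z(1) sqx by blast
    have d: "twice_deriv (\<lambda>t. cos (w * (b + t))) 0 (- w * sin (w * b)) (- w\<^sup>2 * cos (w * b))" for b
    proof -
      have "twice_deriv (\<lambda>t. cos (w * (b + t))) 0 (- w * sin (w * (b + 0))) (- w\<^sup>2 * cos (w * b))"
        by (rule twice_derivI[of UNIV])
          (auto intro!: derivative_eq_intros simp: power2_eq_square)
      then show ?thesis by simp
    qed
    have \<psi>dd: "\<exists>p. twice_deriv (\<lambda>t. \<psi> (z + t *\<^sub>R axis i 1)) 0 p (- w\<^sup>2 * \<psi> z)" for i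
    proof -
      consider "i = 1" | "i = 2" using exhaust_2[of i] by blast
      then show ?thesis
      proof cases
        case 1
        have "(\<lambda>t. \<psi> (z + t *\<^sub>R axis i 1)) =
            (\<lambda>t. cos (w * (z$2 - x$2)) * cos (w * ((z$1 - x$1) + t)))"
          unfolding 1 axis_pt \<psi>_def by (auto simp: algebra_simps)
        then show ?thesis
          using twice_deriv_cmult[OF d[of "z$1 - x$1"], of "cos (w * (z$2 - x$2))"]
          by (auto simp: \<psi>_def mult_ac)
      next
        case 2
        have "(\<lambda>t. \<psi> (z + t *\<^sub>R axis i 1)) =
            (\<lambda>t. cos (w * (z$1 - x$1)) * cos (w * ((z$2 - x$2) + t)))"
          unfolding 2 axis_pt \<psi>_def by (auto simp: algebra_simps)
        then show ?thesis
          using twice_deriv_cmult[OF d[of "z$2 - x$2"], of "cos (w * (z$1 - x$1))"]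
          by (auto simp: \<psi>_def mult_ac)
      qed
    qed
    have le: "1 / s * (- w\<^sup>2 * \<psi> z) - partial i (partial i u) z \<le> 0" for i
    proof -
      obtain p where "twice_deriv (\<lambda>t. \<psi> (z + t *\<^sub>R axis i 1)) 0 p (- w\<^sup>2 * \<psi> z)"
        using \<psi>dd by blast
      from twice_deriv_diff[OF twice_deriv_cmult[OF this, of "1 / s"] u_twice_deriv[OF zO]]
      have "twice_deriv (\<lambda>t. \<psi> (z + t *\<^sub>R axis i 1) / s - u (z + t *\<^sub>R axis i 1)) 0
        (1 / s * p - partial i u z) (1 / s * (- w\<^sup>2 * \<psi> z) - partial i (partial i u) z)" by simp
      from axis_local_max(2)[OF ev this] show ?thesis .
    qed
    have "1 / s * (- w\<^sup>2 * \<psi> z) = - (w\<^sup>2 * u z)" using \<psi>z s0 by simp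
    moreover have "k * u z = 2 * (w\<^sup>2 * u z)" unfolding w(2)[symmetric] by simp
    ultimately have "- W1 (u z) \<le> k * u z"
      using le[of 1] le[of 2] laplacian_sum[OF zO] by linarith
    moreover have "u z \<le> a"
    proof -
      have "\<bar>\<psi> z\<bar> \<le> 1" unfolding \<psi>_def abs_mult by (intro mult_le_one) auto
      then have "\<psi> z \<le> 1" by simp
      then have "u z \<le> 1 / s" using \<psi>z s0 by (simp add: field_simps)
      also have "\<dots> < a" using s assms s0 by (simp add: field_simps)
      finally show ?thesis by simp
    qed
    ultimately show False using k(2)[of "u z"] up[OF z(1)] by auto
  qed
  then show ?thesis using that L by blast
qed

text \<open>Where \<open>u \<ge> \<gamma>\<close>, (W3) makes the Laplacian of \<open>1 - u\<close>
  at least \<open>\<kappa> * (1 - u)\<close>. A paraboloid with Laplacian at most \<kappa> times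
  itself, and larger than 1 on the sides of the square, therefore lies above
  \<open>1 - u\<close>.\<close>

lemma u_decay:
  obtains C where "0 < C" "\<And>x L. 0 < L \<Longrightarrow> sq x L \<subseteq> \<Omega> \<Longrightarrow> 1 - u x \<le> C / L\<^sup>2"
proof -
  obtain \<gamma> \<kappa> where g: "0 < \<gamma>" "\<gamma> < 1" "0 < \<kappa>"
    "\<And>r s. \<gamma> \<le> r \<Longrightarrow> r \<le> s \<Longrightarrow> \<kappa> * (s - r) \<le> W1 s - W1 r"
    using W1_growth by blast
  obtain L0 where L0: "0 < L0" "\<And>x. sq x L0 \<subseteq> \<Omega> \<Longrightarrow> \<gamma> \<le> u x"
    using u_lower_bound[OF g(1,2)] by blast
  \<comment> \<open>The first entry makes the claim trivial for \<open>L < 2 * L0\<close>; the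
    second is the value of the paraboloid at the centre, \<open>4 / (\<kappa> * r\<^sup>2)\<close>
    with \<open>r = L / 2\<close>.\<close>
  define C where "C = max (4 * L0\<^sup>2) (16 / \<kappa>)"
  have C: "C > 0" "4 * L0\<^sup>2 \<le> C" "16 / \<kappa> \<le> C" using L0 g by (auto simp: C_def less_max_iff_disj)
  have "1 - u x \<le> C / L\<^sup>2" if L: "0 < L" and sqx: "sq x L \<subseteq> \<Omega>" for x L
  proof (cases "L < 2 * L0")
    case True
    have "L\<^sup>2 \<le> (2 * L0)\<^sup>2" using True L by (intro power_mono) auto
    also have "\<dots> \<le> C" using C(2) by (simp add: power_mult_distrib)
    finally have "1 \<le> C / L\<^sup>2" using L by (simp add: field_simps)
    moreover have "0 < u x" using sqx center_in_sq[of L x] L u_pos by auto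
    ultimately show ?thesis by simp
  next
    case False
    define r where "r = L / 2"
    have r: "r > 0" using L by (simp add: r_def)
    have ug: "\<gamma> \<le> u y" "u y \<le> 1" "y \<in> \<Omega>" if "y \<in> sq x r" for y
    proof -
      have "sq y L0 \<subseteq> sq x L" using that False by (intro sq_subset) (auto simp: r_def)
      then show "\<gamma> \<le> u y" using L0 sqx by blast
      have "y \<in> sq x L" using that L unfolding sq_def r_def by auto
      then show "y \<in> \<Omega>" using sqx by blast
      then show "u y \<le> 1" using u_le_1 closure_subset by blast
    qed
    \<comment> \<open>The Laplacian of \<open>b\<close> is \<open>4 / r\<^sup>2\<close>, and the
      constant term is exactly what makes this at most \<open>\<kappa> * b\<close>.\<close>
    define b where "b = (\<lambda>y::real^2. ((y$1 - x$1)\<^sup>2 + (y$2 - x$2)\<^sup>2) / r\<^sup>2 + 4 / (\<kappa> * r\<^sup>2))"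
    have key: "1 - u y \<le> b y" if y: "y \<in> sq x r" for y
    proof (rule ccontr)
      assume nle: "\<not> 1 - u y \<le> b y"
      have "\<exists>z\<in>sq x r. \<forall>y\<in>sq x r. 1 - u y - b y \<le> 1 - u z - b z"
      proof (rule continuous_attains_sup[OF compact_sq])
        show "sq x r \<noteq> {}" using y by auto
        have "continuous_on (sq x r) u"
          using ug(3) closure_subset by (intro continuous_on_subset[OF u_continuous]) blast
        then show "continuous_on (sq x r) (\<lambda>y. 1 - u y - b y)"
          unfolding b_def by (intro continuous_intros) (use r g in auto)
      qed
      then obtain z where z: "z \<in> sq x r" "\<And>y. y \<in> sq x r \<Longrightarrow> 1 - u y - b y \<le> 1 - u z - b z" by blast
      have pos: "1 - u z > b z" using z(2)[OF y] nle by simp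
      have zO: "z \<in> \<Omega>" using ug z by blast
      have strict: "\<bar>z$i - x$i\<bar> < r" for i
      proof (rule ccontr)
        assume "\<not> \<bar>z$i - x$i\<bar> < r"
        then have "\<bar>r\<bar> \<le> \<bar>z$i - x$i\<bar>" using r by simp
        then have "(z$i - x$i)\<^sup>2 \<ge> r\<^sup>2" by (simp only: abs_le_square_iff)
        moreover have "(z$i - x$i)\<^sup>2 \<le> (z$1 - x$1)\<^sup>2 + (z$2 - x$2)\<^sup>2" using exhaust_2[of i] by auto
        ultimately have "1 \<le> ((z$1 - x$1)\<^sup>2 + (z$2 - x$2)\<^sup>2) / r\<^sup>2" using r by simp
        moreover have "0 < 4 / (\<kappa> * r\<^sup>2)" using r g by simp
        ultimately have "b z > 1" unfolding b_def by linarith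
        then show False using pos u_pos[OF zO] by simp
      qed
      have ev: "\<forall>\<^sub>F y in nhds z. 1 - u y - b y \<le> 1 - u z - b z"
        using eventually_sq[OF strict strict] by eventually_elim (rule z(2))
      have le: "- partial i (partial i u) z - 2 / r\<^sup>2 \<le> 0" for i
      proof -
        have bi: "b (z + t *\<^sub>R axis i 1) = 1 / r\<^sup>2 * ((z$i - x$i) + t)\<^sup>2 + (b z - (z$i - x$i)\<^sup>2 / r\<^sup>2)" for t
        proof -
          consider "i = 1" | "i = 2" using exhaust_2[of i] by blast
          then show ?thesis
            by cases (simp_all add: axis_pt b_def add_divide_distrib algebra_simps)
        qed
        have "twice_deriv (\<lambda>t. 1 - u (z + t *\<^sub>R axis i 1) - b (z + t *\<^sub>R axis i 1)) 0
          ((0 - partial i u z) - (1 / r\<^sup>2 * (2 * (z$i - x$i)) + 0))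
          ((0 - partial i (partial i u) z) - (1 / r\<^sup>2 * 2 + 0))"
          unfolding bi
          by (intro twice_deriv_diff twice_deriv_add twice_deriv_const twice_deriv_cmult
            twice_deriv_shift_square u_twice_deriv[OF zO])
        from axis_local_max(2)[OF ev this] show ?thesis by simp
      qed
      have "- W1 (u z) \<le> 4 / r\<^sup>2" using le[of 1] le[of 2] laplacian_sum[OF zO] by simp
      moreover have "\<kappa> * (1 - u z) \<le> - W1 (u z)" using g(4)[of "u z" 1] ug[OF z(1)] by simp
      moreover have "4 / r\<^sup>2 \<le> \<kappa> * b z"
      proof -
        have "4 / (\<kappa> * r\<^sup>2) \<le> b z" by (simp add: b_def)
        then have "\<kappa> * (4 / (\<kappa> * r\<^sup>2)) \<le> \<kappa> * b z" using g by (intro mult_left_mono) auto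
        then show ?thesis using g by simp
      qed
      moreover have "\<kappa> * b z < \<kappa> * (1 - u z)" using pos g by simp
      ultimately show False by linarith
    qed
    have "1 - u x \<le> 4 / (\<kappa> * r\<^sup>2)" using key[of x] center_in_sq[of r x] r by (simp add: b_def)
    also have "\<dots> = 16 / \<kappa> / L\<^sup>2" using L g by (simp add: r_def power2_eq_square field_simps)
    also have "\<dots> \<le> C / L\<^sup>2" using C(3) by (intro divide_right_mono) auto
    finally show ?thesis .
  qed
  then show ?thesis using that C by blast
qed

end

section \<open>Barriers in balls\<close>

context double_well_potential
begin

text \<open>Subtracting the tangent of \<open>W\<close> at \<open>a\<close> makes \<open>arclen\<close> infinite at \<open>a\<close>, so that in the comparison with large
  balls no contact can occur at the level \<open>u = a\<close>.\<close>

definition inner_potential :: "real \<Rightarrow> real \<Rightarrow> real"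
  where "inner_potential a s = W s - W a - W1 a * (s - a)"

text \<open>The slope \<open>- k\<close> turns \<open>W1 - F'\<close> into the positive constant
  \<open>k\<close>. The 3 keeps the potential above \<open>k\<close> on \<open>{0..2}\<close>, so
  that \<open>arclen\<close> is finite and smooth across the level 1, where \<open>W\<close>
  vanishes.\<close>

definition outer_potential :: "real \<Rightarrow> real \<Rightarrow> real"
  where "outer_potential k s = W s + k * (3 - s)"

lemma inner_potential_continuous:
  assumes "S \<subseteq> {0..}"
  shows "continuous_on S (inner_potential a)"
  unfolding inner_potential_def
  by (intro continuous_intros continuous_on_subset[OF W_continuous assms])

lemma inner_potential_deriv:
  "0 < s \<Longrightarrow> (inner_potential a has_real_derivative W1 s - W1 a) (at s)"
  unfolding inner_potential_def by (auto intro!: derivative_eq_intros W_deriv)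

text \<open>This potential is \<open>W\<close> minus its tangent at \<open>a\<close>. On
  \<open>{0..a}\<close> the tangent is at most \<open>W a - W1 a\<close>, which tends to 0 as
  \<open>a\<close> tends to 1 and so drops below \<open>W \<gamma>\<close>: this gives positivity
  below \<gamma>. Above \<gamma> positivity is strict convexity. The upper bound is Taylor's formula
  with \<open>W2\<close> bounded above.\<close>

lemma inner_potential_bounds:
  obtains a1 M where "0 < a1" "a1 < 1" "0 < M"
    "\<And>a s. a1 < a \<Longrightarrow> a < 1 \<Longrightarrow> 0 \<le> s \<Longrightarrow> s < a \<Longrightarrow> 0 < inner_potential a s"
    "\<And>a s. a1 < a \<Longrightarrow> a < 1 \<Longrightarrow> 0 \<le> s \<Longrightarrow> s \<le> a \<Longrightarrow> inner_potential a s \<le> M * (a - s)\<^sup>2"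
proof -
  obtain \<gamma> \<kappa> where g: "0 < \<gamma>" "\<gamma> < 1" "0 < \<kappa>"
    "\<And>r s. \<gamma> \<le> r \<Longrightarrow> r \<le> s \<Longrightarrow> \<kappa> * (s - r) \<le> W1 s - W1 r"
    using W1_growth by blast
  obtain M where M: "0 < M" "\<And>r s. 0 \<le> r \<Longrightarrow> r \<le> s \<Longrightarrow> s \<le> 1 \<Longrightarrow> W1 s - W1 r \<le> M * (s - r)"
    using W1_lipschitz by blast
  have "isCont (\<lambda>a. W a - W1 a) 1"
    by (intro continuous_intros DERIV_isCont[OF W_deriv] DERIV_isCont[OF W1_deriv]) auto
  then have "((\<lambda>a. W a - W1 a) \<longlongrightarrow> 0) (at 1)" by (simp add: isCont_def)
  then have "((\<lambda>a. W a - W1 a) \<longlongrightarrow> 0) (at_left 1)" by (rule tendsto_within_subset) simp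
  then have "\<forall>\<^sub>F a in at_left 1. W a - W1 a < W \<gamma>"
    by (rule order_tendstoD) (use W_pos g in simp)
  then obtain b where b: "b < 1" "\<And>a. b < a \<Longrightarrow> a < 1 \<Longrightarrow> W a - W1 a < W \<gamma>"
    by (auto simp: eventually_at_left_field)
  define a1 where "a1 = max \<gamma> b"
  have a1: "0 < a1" "a1 < 1" "\<gamma> \<le> a1" "b \<le> a1" using g b by (auto simp: a1_def)
  have mvt: "\<exists>z. s < z \<and> z < a \<and> inner_potential a s = (a - s) * (W1 a - W1 z)" if s: "0 \<le> s" "s < a" for a s
  proof -
    obtain z where z: "s < z" "z < a" "W a - W s = (a - s) * W1 z" using W_MVT[OF s] .
    then have "inner_potential a s = (a - s) * (W1 a - W1 z)"
      unfolding inner_potential_def by (simp add: algebra_simps)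
    then show ?thesis using z by blast
  qed
  have pos: "0 < inner_potential a s" if a: "a1 < a" "a < 1" and s: "0 \<le> s" "s < a" for a s
  proof (cases "s < \<gamma>")
    case True
    have "W \<gamma> \<le> W s" using W_antimono[of s \<gamma>] True s g by auto
    moreover have "W a - W1 a < W \<gamma>" using b a a1 by auto
    moreover have "- W1 a * (a - s) \<le> - W1 a * 1"
      using W1_nonpos[of a] a a1 s by (intro mult_left_mono) auto
    ultimately show ?thesis unfolding inner_potential_def by (simp add: algebra_simps)
  next
    case False
    obtain z where z: "s < z" "z < a" "inner_potential a s = (a - s) * (W1 a - W1 z)"
      using mvt[OF s] by blast
    have "\<kappa> * (a - z) \<le> W1 a - W1 z" using z False by (intro g(4)) auto
    moreover have "0 < \<kappa> * (a - z)" using z g by simp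
    ultimately show ?thesis using z by simp
  qed
  have up: "inner_potential a s \<le> M * (a - s)\<^sup>2" if a: "a1 < a" "a < 1" and s: "0 \<le> s" "s \<le> a" for a s
  proof (cases "s = a")
    case True
    then show ?thesis by (simp add: inner_potential_def)
  next
    case False
    then obtain z where z: "s < z" "z < a" "inner_potential a s = (a - s) * (W1 a - W1 z)"
      using mvt[of s a] s by auto
    have "W1 a - W1 z \<le> M * (a - z)" using z s a by (intro M(2)) auto
    also have "\<dots> \<le> M * (a - s)" using z M by (intro mult_left_mono) auto
    finally have "(a - s) * (W1 a - W1 z) \<le> (a - s) * (M * (a - s))"
      using s by (intro mult_left_mono) auto
    then show ?thesis using z by (simp add: power2_eq_square mult_ac)
  qed
  show ?thesis using that[OF a1(1,2) M(1) pos up] .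
qed

text \<open>The integrand is at least \<open>c / (a - s)\<close>, so \<open>arclen F\<close> grows
  at least like \<open>- c * ln (a - s)\<close>.\<close>

lemma arclen_unbounded:
  assumes "0 < a" "0 < M" "continuous_on {0..<a} F"
    and pos: "\<And>s. 0 \<le> s \<Longrightarrow> s < a \<Longrightarrow> 0 < F s"
    and up: "\<And>s. 0 \<le> s \<Longrightarrow> s < a \<Longrightarrow> F s \<le> M * (a - s)\<^sup>2"
    and "b0 < a"
  obtains b where "0 < b" "b0 < b" "b < a" "B < arclen F b"
proof -
  define c where "c = 1 / sqrt (2 * M)"
  have c: "0 < c" using assms by (simp add: c_def)
  \<comment> \<open>With \<open>a - b\<close> below this value,
    \<open>c * (ln a - ln (a - b))\<close> is at least \<open>\<bar>B\<bar> + 1\<close>.\<close>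
  have "0 < a * exp (- (\<bar>B\<bar> + 1) / c)" using assms(1) by (intro mult_pos_pos) auto
  moreover obtain e0 where "0 < e0" "e0 < a / 2" "e0 < (a - b0) / 2"
    using field_lbound_gt_zero[of "a / 2" "(a - b0) / 2"] assms(1,6) by auto
  ultimately obtain e where e: "0 < e" "e < a / 2" "e < (a - b0) / 2"
    "e < a * exp (- (\<bar>B\<bar> + 1) / c)"
    using field_lbound_gt_zero[of e0 "a * exp (- (\<bar>B\<bar> + 1) / c)"] by force
  define b where "b = a - e"
  have b: "0 < b" "b0 < b" "b < a" "a - b \<le> a * exp (- (\<bar>B\<bar> + 1) / c)"
    using e assms(1,6) by (auto simp: b_def)
  define h where "h = (\<lambda>s. arclen F s + c * ln (a - s))"
  have cF: "continuous_on {0..b} F" using b by (intro continuous_on_subset[OF assms(3)]) auto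
  have pF: "0 < F t" if "0 \<le> t" "t \<le> b" for t using pos that b by auto
  have "h 0 \<le> h b"
  proof (rule DERIV_nonneg_imp_increasing_open[of 0 b h])
    have "continuous_on {0..b} (arclen F)" by (rule arclen_continuous[OF cF pF])
    then show "continuous_on {0..b} h"
      unfolding h_def using b by (intro continuous_intros) auto
    fix s assume s: "0 < s" "s < b"
    show "\<exists>y. (h has_real_derivative y) (at s) \<and> 0 \<le> y"
    proof (intro exI conjI)
      show "(h has_real_derivative 1 / sqrt (2 * F s) + c * (- 1 / (a - s))) (at s)"
        unfolding h_def using s b
        by (auto intro!: derivative_eq_intros arclen_has_derivative[OF cF pF])
      have "sqrt (2 * F s) \<le> sqrt (2 * M * (a - s)\<^sup>2)"
        using up[of s] s b by (intro real_sqrt_le_mono) auto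
      also have "\<dots> = sqrt (2 * M) * (a - s)" using s b by (simp add: real_sqrt_mult)
      finally have "1 / (sqrt (2 * M) * (a - s)) \<le> 1 / sqrt (2 * F s)"
        using pF[of s] s b assms(2) by (intro divide_left_mono) auto
      then show "0 \<le> 1 / sqrt (2 * F s) + c * (- 1 / (a - s))" by (simp add: c_def)
    qed
  qed (use b in simp)
  then have low: "c * (ln a - ln (a - b)) \<le> arclen F b" by (simp add: h_def algebra_simps)
  have "ln (a - b) \<le> ln (a * exp (- (\<bar>B\<bar> + 1) / c))"
    using b assms(1) by (subst ln_le_cancel_iff) auto
  moreover have "ln (a * exp (- (\<bar>B\<bar> + 1) / c)) = ln a - (\<bar>B\<bar> + 1) / c"
    using assms(1) by (simp add: ln_mult_pos diff_divide_distrib add_divide_distrib)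
  ultimately have "(\<bar>B\<bar> + 1) / c \<le> ln a - ln (a - b)" by linarith
  then have "c * ((\<bar>B\<bar> + 1) / c) \<le> c * (ln a - ln (a - b))" using c by (intro mult_left_mono) auto
  then have "\<bar>B\<bar> + 1 \<le> c * (ln a - ln (a - b))" using c by simp
  then have "B < arclen F b" using low by linarith
  then show ?thesis using that b by blast
qed

lemma outer_potential_continuous:
  assumes "S \<subseteq> {0..}"
  shows "continuous_on S (outer_potential k)"
  unfolding outer_potential_def
  by (intro continuous_intros continuous_on_subset[OF W_continuous assms])

lemma outer_potential_deriv:
  "0 < s \<Longrightarrow> (outer_potential k has_real_derivative W1 s - k) (at s)"
  unfolding outer_potential_def by (auto intro!: derivative_eq_intros W_deriv)

lemma outer_potential_lower:
  assumes "0 < k" "0 \<le> s" "s \<le> 2"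
  shows "k \<le> outer_potential k s"
proof -
  have "k * 1 \<le> k * (3 - s)" using assms by (intro mult_left_mono) auto
  then show ?thesis using W_nonneg[of s] assms unfolding outer_potential_def by linarith
qed

lemma outer_potential_upper:
  assumes "0 < k" "0 \<le> s" "s \<le> 1"
  shows "outer_potential k s \<le> W 0 + 3 * k"
proof -
  have "k * (3 - s) \<le> k * 3" using assms by (intro mult_left_mono) auto
  then show ?thesis using W_antimono[of 0 s] assms unfolding outer_potential_def by linarith
qed

end

context overdetermined
begin

lemma arclen_u_twice_deriv:
  assumes "continuous_on {0..b} F" "\<And>t. 0 \<le> t \<Longrightarrow> t \<le> b \<Longrightarrow> 0 < F t"
    and "x \<in> \<Omega>" "u x < b" "(F has_real_derivative F') (at (u x))"
  defines "q \<equiv> sqrt (2 * F (u x))"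
  shows "twice_deriv (\<lambda>t. arclen F (u (x + t *\<^sub>R axis i 1))) 0 (partial i u x / q)
    (partial i (partial i u) x / q - F' * (partial i u x)\<^sup>2 / q ^ 3)"
proof -
  have "twice_deriv (arclen F) (u (x + 0 *\<^sub>R axis i 1)) (1 / q) (- F' / q ^ 3)"
    using arclen_twice_deriv[OF assms(1,2) u_pos[OF assms(3)] assms(4,5)] by (simp add: q_def)
  from twice_deriv_compose[OF u_twice_deriv[OF assms(3)] this]
  show ?thesis by (rule twice_deriv_cong) (auto simp: field_simps)
qed

lemma unit_components:
  fixes z y :: "real^2"
  assumes "z \<noteq> y"
  shows "((z - y) $ 1 / norm (z - y))\<^sup>2 + ((z - y) $ 2 / norm (z - y))\<^sup>2 = 1"
proof -
  have "(norm (z - y))\<^sup>2 = ((z - y) $ 1)\<^sup>2 + ((z - y) $ 2)\<^sup>2" unfolding norm_real2 by simp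
  moreover have "(norm (z - y))\<^sup>2 \<noteq> 0" using assms by simp
  ultimately show ?thesis
    unfolding power_divide add_divide_distrib[symmetric] by (metis divide_self)
qed

text \<open>At the contact point the gradient of \<open>arclen F (u w)\<close> is \<sigma> times the
  unit radial vector. Hence the terms with F' add up to F', the Laplacian of
  \<open>arclen F (u w)\<close> is \<open>(W1 (u z) - F') / q\<close>, and it is compared with the
  Laplacian 1/r of the distance. When \<open>\<sigma> * (W1 (u z) - F')\<close> is a positive
  constant, contact far from \<open>y\<close> is impossible.\<close>

lemma radial_contact:
  assumes F: "continuous_on {0..b} F" "\<And>t. 0 \<le> t \<Longrightarrow> t \<le> b \<Longrightarrow> 0 < F t"
    and z: "z \<in> \<Omega>" "u z < b" "(F has_real_derivative F') (at (u z))" "z \<noteq> y"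
    and \<sigma>: "\<sigma> = 1 \<or> \<sigma> = -1"
    and ev: "\<forall>\<^sub>F w in nhds z. \<sigma> * arclen F (u w) - norm (w - y) \<le> \<sigma> * arclen F (u z) - norm (z - y)"
  shows "\<sigma> * (W1 (u z) - F') * norm (z - y) \<le> sqrt (2 * F (u z))"
proof -
  define r where "r = norm (z - y)"
  have r: "0 < r" using z(4) by (simp add: r_def)
  define q where "q = sqrt (2 * F (u z))"
  have q: "0 < q" using F(2)[of "u z"] u_pos[OF z(1)] z(2) by (simp add: q_def)
  have \<sigma>2: "\<sigma>\<^sup>2 = 1" using \<sigma> by auto
  define n where "n = (\<lambda>i. (z - y) $ i / r)"
  have n1: "(n 1)\<^sup>2 + (n 2)\<^sup>2 = 1" unfolding n_def r_def by (rule unit_components[OF z(4)])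
  have d: "\<sigma> * (partial i (partial i u) z - F' * (n i)\<^sup>2) / q - (1 - (n i)\<^sup>2) / r \<le> 0" for i
  proof -
    have "twice_deriv (\<lambda>t. \<sigma> * arclen F (u (z + t *\<^sub>R axis i 1)) - norm (z + t *\<^sub>R axis i 1 - y)) 0
        (\<sigma> * (partial i u z / q) - (z - y)$i / norm (z - y))
        (\<sigma> * (partial i (partial i u) z / q - F' * (partial i u z)\<^sup>2 / q ^ 3) -
          (1 / norm (z - y) - ((z - y)$i)\<^sup>2 / norm (z - y) ^ 3))"
      unfolding q_def
      by (intro twice_deriv_diff twice_deriv_cmult twice_deriv_norm_axis[OF z(4)]
        arclen_u_twice_deriv[OF F z(1-3)])
    note mx = axis_local_max[OF ev this]
    have "n i = \<sigma> * (partial i u z / q)" using mx(1) by (simp add: n_def r_def)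
    then have "(n i)\<^sup>2 = (partial i u z)\<^sup>2 / q\<^sup>2" by (simp add: power_mult_distrib \<sigma>2 power_divide)
    then have "(partial i u z)\<^sup>2 / q ^ 3 = (n i)\<^sup>2 / q"
      using q by (simp add: power2_eq_square power3_eq_cube)
    moreover have "1 / r - ((z - y)$i)\<^sup>2 / r ^ 3 = (1 - (n i)\<^sup>2) / r"
      using r by (simp add: n_def power2_eq_square power3_eq_cube field_simps)
    ultimately show ?thesis using mx(2) unfolding r_def[symmetric]
      by (simp add: times_divide_eq_right[symmetric] diff_divide_distrib del: times_divide_eq_right)
  qed
  have "\<sigma> * (partial 1 (partial 1 u) z + partial 2 (partial 2 u) z - F' * ((n 1)\<^sup>2 + (n 2)\<^sup>2)) / q
      - (2 - ((n 1)\<^sup>2 + (n 2)\<^sup>2)) / r \<le> 0"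
    using d[of 1] d[of 2] by (simp add: add_divide_distrib diff_divide_distrib ring_distribs)
  then have "\<sigma> * (W1 (u z) - F') / q \<le> 1 / r"
    unfolding n1 laplacian_sum[OF z(1)] by simp
  then show ?thesis using q r unfolding q_def[symmetric] r_def[symmetric] by (simp add: field_simps)
qed

lemma continuous_arclen_u:
  assumes "continuous_on {0..b} F" "\<And>t. 0 \<le> t \<Longrightarrow> t \<le> b \<Longrightarrow> 0 < F t"
    and "S \<subseteq> closure \<Omega>" "\<And>x. x \<in> S \<Longrightarrow> u x \<le> b"
  shows "continuous_on S (\<lambda>x. arclen F (u x))"
  by (rule continuous_on_compose2[OF arclen_continuous[OF assms(1,2)]
      continuous_on_subset[OF u_continuous assms(3)]]) (use assms u_nonneg in auto)

lemma eventually_u_less: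
  assumes "x \<in> \<Omega>" "u x < b"
  shows "\<forall>\<^sub>F y in nhds x. u y < b"
proof -
  have "isCont u x" using u_has_derivative[OF assms(1)] by (rule has_derivative_continuous)
  then have "(u \<longlongrightarrow> u x) (nhds x)" by (simp add: isCont_def tendsto_at_iff_tendsto_nhds)
  then show ?thesis using assms(2) by (rule order_tendstoD)
qed

text \<open>If the bound fails, \<open>arclen F (u z) + norm (z - y)\<close> has a minimum below
  \<open>R\<close> on the part of the ball where \<open>u \<le> b\<close>. The choice of
  \<open>b\<close> excludes \<open>u z = b\<close>, and nonnegativity of \<open>arclen\<close>
  excludes the sphere, so the contact is interior. Then \<open>radial_contact\<close> bounds the
  contact radius by \<open>sqrt (2 * M) / (- W1 a)\<close>, contradicting
  \<open>far\<close>.\<close>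

lemma inner_barrier:
  obtains a1 where "0 < a1" "a1 < 1"
    "\<And>a s. a1 < a \<Longrightarrow> a < 1 \<Longrightarrow> 0 \<le> s \<Longrightarrow> s < a \<Longrightarrow> 0 < inner_potential a s"
    "\<And>a. a1 < a \<Longrightarrow> a < 1 \<Longrightarrow> \<exists>R0. \<forall>R\<ge>R0. \<forall>y. ball y R \<subseteq> \<Omega> \<longrightarrow>
      (\<forall>x\<in>ball y R. u x < a \<longrightarrow> R - dist x y \<le> arclen (inner_potential a) (u x))"
proof -
  obtain a1 M where a1: "0 < a1" "a1 < 1" "0 < M"
    and pos: "\<And>a s. a1 < a \<Longrightarrow> a < 1 \<Longrightarrow> 0 \<le> s \<Longrightarrow> s < a \<Longrightarrow> 0 < inner_potential a s"
    and up: "\<And>a s. a1 < a \<Longrightarrow> a < 1 \<Longrightarrow> 0 \<le> s \<Longrightarrow> s \<le> a \<Longrightarrow> inner_potential a s \<le> M * (a - s)\<^sup>2"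
    using inner_potential_bounds by blast
  have main: "\<exists>R0. \<forall>R\<ge>R0. \<forall>y. ball y R \<subseteq> \<Omega> \<longrightarrow>
      (\<forall>x\<in>ball y R. u x < a \<longrightarrow> R - dist x y \<le> arclen (inner_potential a) (u x))"
    if a: "a1 < a" "a < 1" for a
  proof -
    have a0: "0 < a" using a a1 by simp
    obtain L where L: "0 < L" "\<And>x. sq x L \<subseteq> \<Omega> \<Longrightarrow> a \<le> u x"
      using u_lower_bound[OF a0 a(2)] by blast
    have Wa: "0 < - W1 a" using W1_neg[of a] a a0 by simp
    define F where "F = inner_potential a"
    define R0 where "R0 = 2 * L + sqrt (2 * M) / (- W1 a) + 1"
    have False if R: "R0 \<le> R" and By: "ball y R \<subseteq> \<Omega>" and x: "x \<in> ball y R" and ux: "u x < a"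
      and less: "arclen F (u x) < R - dist x y" for R x y
    proof -
      \<comment> \<open>\<open>arclen F\<close> is used only up to a level \<open>b < a\<close>,
        where it is finite but already exceeds \<open>R\<close>.\<close>
      obtain b where b: "0 < b" "u x < b" "b < a" "R < arclen F b"
        using arclen_unbounded[OF a0 a1(3), of F "u x" R] a pos up ux
          inner_potential_continuous[of "{0..<a}" a] unfolding F_def by force
      have cF: "continuous_on {0..b} F" unfolding F_def by (rule inner_potential_continuous) auto
      have pF: "0 < F t" if "0 \<le> t" "t \<le> b" for t unfolding F_def using pos[OF a] that b by auto
      have Rpos: "R > 0" using x by (metis ball_empty empty_iff not_less)
      have cb: "cball y R \<subseteq> closure \<Omega>"
        using closure_mono[OF By] Rpos by simp
      define S where "S = {z \<in> cball y R. u z \<le> b}"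
      have Scl: "S \<subseteq> closure \<Omega>" using cb by (auto simp: S_def)
      have "closed S"
        unfolding S_def
        by (intro continuous_on_closed_Collect_le continuous_on_subset[OF u_continuous cb]
            continuous_on_const closed_cball)
      then have cS: "compact S"
        using compact_Int_closed[OF compact_cball[of y R], of S] by (simp add: S_def Int_def)
      have xS: "x \<in> S" using x b by (auto simp: S_def)
      define D where "D = (\<lambda>z. arclen F (u z) + norm (z - y))"
      have "continuous_on S D"
        unfolding D_def
        by (intro continuous_intros continuous_arclen_u[OF cF pF Scl]) (auto simp: S_def)
      then obtain z where z: "z \<in> S" "\<And>w. w \<in> S \<Longrightarrow> D z \<le> D w"
        using continuous_attains_inf[OF cS] xS by blast
      have DzR: "D z < R" using z(2)[OF xS] less by (simp add: D_def dist_norm)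
      have uz: "0 \<le> u z" "u z \<le> b" using z(1) Scl u_nonneg by (auto simp: S_def)
      have "arclen F (u z) < R" using DzR norm_ge_zero[of "z - y"] unfolding D_def by linarith
      then have uzb: "u z < b" using b uz by (cases "u z = b") auto
      have "0 \<le> arclen F (u z)" using arclen_nonneg[OF cF pF uz] .
      then have "norm (z - y) < R" using DzR unfolding D_def by linarith
      then have zb: "z \<in> ball y R" by (simp add: dist_norm norm_minus_commute)
      then have zO: "z \<in> \<Omega>" using By by blast
      have ev: "\<forall>\<^sub>F w in nhds z. - D w \<le> - D z"
      proof -
        have "\<forall>\<^sub>F w in nhds z. w \<in> ball y R" using zb by (intro eventually_nhds_in_open) auto
        then show ?thesis using eventually_u_less[OF zO uzb]
          by eventually_elim (auto simp: S_def intro!: z(2))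
      qed
      define r where "r = norm (z - y)"
      \<comment> \<open>Points at depth at least \<open>2 * L\<close> are centres of squares in
        \<Omega>, where \<open>u\<close> is at least \<open>a\<close>; so contact happens near the
        sphere, at a large distance from \<open>y\<close>.\<close>
      have far: "R - 2 * L \<le> r"
      proof (rule ccontr)
        assume n: "\<not> R - 2 * L \<le> r"
        have "sq z L \<subseteq> \<Omega>"
        proof
          fix w assume w: "w \<in> sq z L"
          have "norm (w - z) \<le> \<bar>(w - z) $ 1\<bar> + \<bar>(w - z) $ 2\<bar>"
            unfolding norm_real2 by (rule sqrt_sum_squares_le_sum_abs)
          also have "\<dots> \<le> 2 * L" using w by (simp add: sq_def)
          finally have "norm (w - y) < R"
            using n norm_triangle_ineq[of "w - z" "z - y"] unfolding r_def by simp
          then show "w \<in> \<Omega>" using By by (auto simp: dist_norm norm_minus_commute)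
        qed
        then show False using L(2) uzb b by force
      qed
      have "sqrt (2 * M) / (- W1 a) < r" using far R unfolding R0_def by linarith
      moreover have "0 \<le> sqrt (2 * M) / (- W1 a)" using Wa a1 by (intro divide_nonneg_nonneg) auto
      ultimately have r: "0 < r" "sqrt (2 * M) < r * (- W1 a)"
        using pos_divide_less_eq[OF Wa, of "sqrt (2 * M)" r] by linarith+
      then have zy: "z \<noteq> y" by (auto simp: r_def)
      have "F (u z) \<le> M * (a - u z)\<^sup>2" unfolding F_def using up[OF a] uz b by auto
      also have "\<dots> \<le> M * 1"
        using uz b a a1 by (intro mult_left_mono) (auto simp: power_le_one)
      finally have qM: "sqrt (2 * F (u z)) \<le> sqrt (2 * M)" by simp
      have "(F has_real_derivative W1 (u z) - W1 a) (at (u z))"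
        unfolding F_def by (rule inner_potential_deriv[OF u_pos[OF zO]])
      from radial_contact[OF cF pF zO uzb this zy, of "-1"] ev
      have "- 1 * (W1 (u z) - (W1 (u z) - W1 a)) * r \<le> sqrt (2 * F (u z))"
        by (simp add: D_def r_def)
      then have "r * (- W1 a) \<le> sqrt (2 * F (u z))" by (simp add: mult.commute)
      then show False using r(2) qM by linarith
    qed
    then show ?thesis unfolding F_def by (intro exI[of _ R0] allI impI ballI) (meson not_less)
  qed
  show ?thesis using that[OF a1(1,2) pos main] .
qed

text \<open>Dual to \<open>inner_barrier\<close>, with a maximum of
  \<open>arclen F (u z) - norm (z - y)\<close>. Contact on the boundary is excluded since
  \<open>arclen\<close> vanishes there while the distance to \<open>y\<close> is at least
  \<open>R\<close>. At interior contact the radius is at least \<open>R\<close>, but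
  \<open>radial_contact\<close> allows at most \<open>sqrt (2 * M) / k\<close>.\<close>

lemma outer_barrier:
  assumes k: "0 < k"
  shows "\<exists>R0. \<forall>R\<ge>R0. \<forall>y. ball y R \<inter> \<Omega> = {} \<longrightarrow>
    (\<forall>x\<in>closure \<Omega>. arclen (outer_potential k) (u x) \<le> dist x y - R)"
proof -
  define F where "F = outer_potential k"
  define M where "M = W 0 + 3 * k"
  have M: "0 < M" using W_pos[of 0] k by (simp add: M_def)
  have cF: "continuous_on {0..2} F" unfolding F_def by (rule outer_potential_continuous) auto
  have pF: "0 < F t" if "0 \<le> t" "t \<le> 2" for t
    unfolding F_def using outer_potential_lower[OF k that] k by simp
  define R0 where "R0 = sqrt (2 * M) / k + 1"
  have False if R: "R0 \<le> R" and By: "ball y R \<inter> \<Omega> = {}" and x: "x \<in> closure \<Omega>"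
    and less: "dist x y - R < arclen F (u x)" for R x y
  proof -
    have "0 < sqrt (2 * M) / k" using M k by simp
    then have Rpos: "R > 0" using R by (simp add: R0_def)
    have By': "ball y R \<inter> closure \<Omega> = {}"
      using open_Int_closure_eq_empty[OF open_ball] By by blast
    have u01: "0 \<le> u z" "u z \<le> 1" if "z \<in> closure \<Omega>" for z
      using that u_nonneg u_le_1 by auto
    have le1: "arclen F (u z) \<le> arclen F 1" if "z \<in> closure \<Omega>" for z
      by (rule arclen_mono[OF cF pF]) (use u01[OF that] in auto)
    \<comment> \<open>As \<open>arclen F (u z) \<le> arclen F 1\<close>, points outside this bounded
      set cannot violate the bound; this provides compactness in the unbounded domain.\<close>
    define S where "S = cball y (R + arclen F 1) \<inter> closure \<Omega>"
    have cS: "compact S" unfolding S_def by (intro compact_Int_closed) auto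
    have xS: "x \<in> S" using less le1[OF x] x by (auto simp: S_def dist_commute)
    define D where "D = (\<lambda>z. arclen F (u z) - norm (z - y))"
    have "continuous_on S D"
      unfolding D_def
      by (intro continuous_intros continuous_arclen_u[OF cF pF]) (use u01 in \<open>force simp: S_def\<close>)+
    then obtain z where z: "z \<in> S" "\<And>w. w \<in> S \<Longrightarrow> D w \<le> D z"
      using continuous_attains_sup[OF cS] xS by blast
    have DzR: "- R < D z" using z(2)[OF xS] less by (simp add: D_def dist_norm)
    have zc: "z \<in> closure \<Omega>" using z(1) by (simp add: S_def)
    have zR: "R \<le> norm (z - y)"
      using By' zc by (auto simp: disjoint_iff dist_norm norm_minus_commute not_less)
    have zO: "z \<in> \<Omega>"
    proof (rule ccontr)
      assume "z \<notin> \<Omega>"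
      then have "u z = 0" using zc u_frontier by (auto elim: closure_cases)
      then show False using DzR zR by (simp add: D_def)
    qed
    have zb: "z \<in> ball y (R + arclen F 1)"
      using DzR le1[OF zc] by (simp add: D_def dist_norm norm_minus_commute)
    have ev: "\<forall>\<^sub>F w in nhds z. D w \<le> D z"
      using eventually_nhds_in_open[OF open_ball zb] eventually_nhds_in_open[OF open_\<Omega> zO]
    proof eventually_elim
      case (elim w)
      then have "w \<in> S" using closure_subset[of \<Omega>] by (auto simp: S_def)
      then show ?case by (rule z(2))
    qed
    define r where "r = norm (z - y)"
    have r: "0 < r" "sqrt (2 * M) < r * k"
    proof -
      show "0 < r" using zR Rpos unfolding r_def by linarith
      have "sqrt (2 * M) / k < r" using zR R by (simp add: r_def R0_def)
      then show "sqrt (2 * M) < r * k" using k by (simp add: pos_divide_less_eq)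
    qed
    then have zy: "z \<noteq> y" by (auto simp: r_def)
    have uz2: "u z < 2" using u01[OF zc] by simp
    have qM: "sqrt (2 * F (u z)) \<le> sqrt (2 * M)"
      unfolding F_def M_def using outer_potential_upper[OF k u01[OF zc]] by simp
    have "(F has_real_derivative W1 (u z) - k) (at (u z))"
      unfolding F_def by (rule outer_potential_deriv[OF u_pos[OF zO]])
    from radial_contact[OF cF pF zO uz2 this zy, of 1] ev
    have "1 * (W1 (u z) - (W1 (u z) - k)) * r \<le> sqrt (2 * F (u z))"
      by (simp add: D_def r_def)
    then have "r * k \<le> sqrt (2 * F (u z))" by (simp add: mult.commute)
    then show False using r(2) qM by linarith
  qed
  then show ?thesis unfolding F_def by (intro exI[of _ R0] allI impI ballI) (meson not_less)
qed

section \<open>Large balls touching the boundary\<close>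

lemma big_ball_inside: "\<exists>y. ball y R \<subseteq> \<Omega>"
proof -
  obtain M where M: "\<And>s. s \<in> {-\<bar>R\<bar>..\<bar>R\<bar>} \<Longrightarrow> \<phi> s \<le> M"
  proof -
    have "\<exists>x\<in>{-\<bar>R\<bar>..\<bar>R\<bar>}. \<forall>y\<in>{-\<bar>R\<bar>..\<bar>R\<bar>}. \<phi> y \<le> \<phi> x"
      by (rule continuous_attains_sup) (auto intro: \<phi>_continuous)
    then show ?thesis using that by blast
  qed
  have "ball (pt 0 (M + \<bar>R\<bar>)) R \<subseteq> \<Omega>"
  proof
    fix x assume "x \<in> ball (pt 0 (M + \<bar>R\<bar>)) R"
    then have n: "norm (x - pt 0 (M + \<bar>R\<bar>)) < R" by (simp add: dist_norm norm_minus_commute)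
    have "\<bar>x$1\<bar> < R" using component_le_norm_cart[of "x - pt 0 (M + \<bar>R\<bar>)" 1] n by simp
    then have "\<phi> (x$1) \<le> M" by (intro M) auto
    moreover have "\<bar>x$2 - (M + \<bar>R\<bar>)\<bar> < R"
      using component_le_norm_cart[of "x - pt 0 (M + \<bar>R\<bar>)" 2] n by simp
    ultimately show "x \<in> \<Omega>" by (auto simp: in_\<Omega>)
  qed
  then show ?thesis by blast
qed

lemma big_ball_outside: "\<exists>y. ball y R \<inter> closure \<Omega> = {}"
proof -
  obtain M where M: "\<And>s. s \<in> {-\<bar>R\<bar>..\<bar>R\<bar>} \<Longrightarrow> M \<le> \<phi> s"
  proof -
    have "\<exists>x\<in>{-\<bar>R\<bar>..\<bar>R\<bar>}. \<forall>y\<in>{-\<bar>R\<bar>..\<bar>R\<bar>}. \<phi> x \<le> \<phi> y"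
      by (rule continuous_attains_inf) (auto intro: \<phi>_continuous)
    then show ?thesis using that by blast
  qed
  have "x \<notin> closure \<Omega>" if "x \<in> ball (pt 0 (M - \<bar>R\<bar>)) R" for x
  proof -
    have n: "norm (x - pt 0 (M - \<bar>R\<bar>)) < R" using that by (simp add: dist_norm norm_minus_commute)
    have "\<bar>x$1\<bar> < R" using component_le_norm_cart[of "x - pt 0 (M - \<bar>R\<bar>)" 1] n by simp
    then have "M \<le> \<phi> (x$1)" by (intro M) auto
    moreover have "\<bar>x$2 - (M - \<bar>R\<bar>)\<bar> < R"
      using component_le_norm_cart[of "x - pt 0 (M - \<bar>R\<bar>)" 2] n by simp
    ultimately show ?thesis by (auto simp: in_closure)
  qed
  then show ?thesis by blast
qed

lemma ball_subset_\<Omega>: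
  assumes "y \<in> \<Omega>" "ball y r \<inter> frontier \<Omega> = {}"
  shows "ball y r \<subseteq> \<Omega>"
proof (cases "0 < r")
  case True
  then have "y \<in> ball y r" by simp
  then show ?thesis
    using connected_Int_frontier[of "ball y r" \<Omega>] assms connected_ball by blast
next
  case False
  then have "ball y r = {}" by (intro ball_empty) simp
  then show ?thesis by (simp only: empty_subsetI)
qed

lemma nearest_frontier_point:
  obtains x where "x \<in> frontier \<Omega>" "ball y (dist y x) \<inter> frontier \<Omega> = {}"
proof -
  have "pt 0 (\<phi> 0) \<in> frontier \<Omega>" by (simp add: in_frontier)
  then obtain x where "x \<in> frontier \<Omega>" "\<And>z. z \<in> frontier \<Omega> \<Longrightarrow> dist y x \<le> dist y z"
    using distance_attains_inf[OF frontier_closed, of \<Omega> y] by blast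
  then show ?thesis using that by (meson disjoint_iff mem_ball not_less)
qed

text \<open>A ball inside \<Omega> is enlarged about its fixed centre up to the nearest boundary
  point. The radius \<open>\<bar>R\<bar> + 1\<close> keeps it nondegenerate for every
  \<open>R\<close>.\<close>

lemma touching_ball_inside:
  obtains x y where "x \<in> frontier \<Omega>" "R \<le> dist y x" "ball y (dist y x) \<subseteq> \<Omega>" "y \<noteq> x"
proof -
  obtain y where y: "ball y (\<bar>R\<bar> + 1) \<subseteq> \<Omega>" using big_ball_inside by blast
  obtain x where x: "x \<in> frontier \<Omega>" "ball y (dist y x) \<inter> frontier \<Omega> = {}"
    by (rule nearest_frontier_point)
  have yO: "y \<in> \<Omega>" using y by (auto simp: subset_iff)
  have "x \<notin> \<Omega>" using x in_frontier in_\<Omega> by auto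
  then have "\<bar>R\<bar> + 1 \<le> dist y x" using y by (meson mem_ball not_less subsetD)
  moreover have "ball y (dist y x) \<subseteq> \<Omega>" by (rule ball_subset_\<Omega>[OF yO x(2)])
  moreover have "R \<le> dist y x" "y \<noteq> x" using calculation(1) yO \<open>x \<notin> \<Omega>\<close> by auto
  ultimately show ?thesis using that[of x y] x by blast
qed

lemma touching_ball_outside:
  obtains x y where "x \<in> frontier \<Omega>" "R \<le> dist y x" "ball y (dist y x) \<inter> \<Omega> = {}"
proof -
  obtain y where y: "ball y (\<bar>R\<bar> + 1) \<inter> closure \<Omega> = {}" using big_ball_outside by blast
  obtain x where x: "x \<in> frontier \<Omega>" "ball y (dist y x) \<inter> frontier \<Omega> = {}"
    by (rule nearest_frontier_point)
  have "y \<in> ball y (\<bar>R\<bar> + 1)" unfolding centre_in_ball by linarith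
  then have yO: "y \<notin> \<Omega>" using y closure_subset[of \<Omega>] by blast
  have xc: "x \<in> closure \<Omega>" using x in_frontier in_closure by auto
  then have R: "\<bar>R\<bar> + 1 \<le> dist y x" using y by (meson disjoint_iff mem_ball not_less)
  moreover have "ball y (dist y x) \<inter> \<Omega> = {}"
  proof (rule ccontr)
    assume n: "ball y (dist y x) \<inter> \<Omega> \<noteq> {}"
    have "y \<in> ball y (dist y x)" using R unfolding centre_in_ball by linarith
    then show False
      using connected_Int_frontier[of "ball y (dist y x)" \<Omega>] x(2) yO n connected_ball by blast
  qed
  moreover have "R \<le> dist y x" using R by linarith
  ultimately show ?thesis using that[of x y] x by blast
qed

end

section \<open>The slope on the boundary\<close>

context overdetermined
begin

text \<open>By the mean value theorem the difference quotient is a value of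
  \<open>Du \<bullet> v\<close> at an intermediate point, and \<open>Du\<close> is continuous up to
  the boundary.\<close>

lemma u_right_derivative:
  assumes x: "x \<in> frontier \<Omega>" and d: "0 < \<delta>" "\<And>s. 0 < s \<Longrightarrow> s < \<delta> \<Longrightarrow> x + s *\<^sub>R v \<in> \<Omega>"
  shows "((\<lambda>t. u (x + t *\<^sub>R v)) has_real_derivative Du x \<bullet> v) (at 0 within {0..<\<delta>})"
proof -
  have xc: "x \<in> closure \<Omega>" using x in_frontier in_closure by auto
  have cl: "x + s *\<^sub>R v \<in> closure \<Omega>" if "0 \<le> s" "s < \<delta>" for s
    using d(2)[of s] xc closure_subset that by (cases "s = 0") auto
  have "continuous_on {0..<\<delta>} (\<lambda>s. Du (x + s *\<^sub>R v) \<bullet> v)"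
    by (intro continuous_intros continuous_on_compose2[OF Du(1)]) (use cl in auto)
  then have "((\<lambda>s. Du (x + s *\<^sub>R v) \<bullet> v) \<longlongrightarrow> Du (x + 0 *\<^sub>R v) \<bullet> v) (at 0 within {0..<\<delta>})"
    unfolding continuous_on_def by (rule bspec) (use d in simp)
  then have lim: "((\<lambda>s. Du (x + s *\<^sub>R v) \<bullet> v) \<longlongrightarrow> Du x \<bullet> v) (at 0 within {0..<\<delta>})"
    by simp
  show ?thesis unfolding has_field_derivative_iff
  proof (rule tendstoI)
    fix r :: real assume r: "0 < r"
    obtain e where e: "0 < e" "\<And>s. 0 < s \<Longrightarrow> s < \<delta> \<Longrightarrow> s < e \<Longrightarrow> \<bar>Du (x + s *\<^sub>R v) \<bullet> v - Du x \<bullet> v\<bar> < r"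
      using tendstoD[OF lim r] unfolding eventually_at by (auto simp: dist_real_def)
    have "dist ((u (x + t *\<^sub>R v) - u (x + 0 *\<^sub>R v)) / (t - 0)) (Du x \<bullet> v) < r"
      if t: "0 < t" "t < \<delta>" "t < e" for t
    proof -
      have inO: "x + s *\<^sub>R v \<in> \<Omega>" if "0 < s" "s < t" for s using d(2)[of s] that t by simp
      have clt: "x + t *\<^sub>R v \<in> closure \<Omega>" using cl[of t] t by simp
      obtain s where s: "0 < s" "s < t" "u (x + t *\<^sub>R v) - u x = t * (Du (x + s *\<^sub>R v) \<bullet> v)"
        by (rule u_segment_MVT[OF t(1) inO xc clt])
      have "\<bar>Du (x + s *\<^sub>R v) \<bullet> v - Du x \<bullet> v\<bar> < r" using e(2)[of s] s t by simp
      then show ?thesis using s(3) t by (simp add: dist_real_def)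
    qed
    then show "\<forall>\<^sub>F t in at 0 within {0..<\<delta>}.
        dist ((u (x + t *\<^sub>R v) - u (x + 0 *\<^sub>R v)) / (t - 0)) (Du x \<bullet> v) < r"
      unfolding eventually_at using e(1) by (intro exI[of _ e]) (auto simp: dist_real_def)
  qed
qed

text \<open>A chain rule that is one-sided at both levels: \<open>arclen F\<close> is differentiated
  at 0 within \<open>{0..b}\<close>, and \<open>u\<close> takes its values there.\<close>

lemma arclen_u_right_derivative:
  assumes F: "continuous_on {0..b} F" "\<And>t. 0 \<le> t \<Longrightarrow> t \<le> b \<Longrightarrow> 0 < F t"
    and x: "x \<in> frontier \<Omega>" and d: "0 < \<delta>" "\<And>s. 0 < s \<Longrightarrow> s < \<delta> \<Longrightarrow> x + s *\<^sub>R v \<in> \<Omega>"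
    and b: "0 < b"
  shows "((\<lambda>t. arclen F (u (x + t *\<^sub>R v)) / t) \<longlongrightarrow> (Du x \<bullet> v) / sqrt (2 * F 0)) (at_right 0)"
proof -
  have u0: "u x = 0" using x by (rule u_frontier)
  have D: "((\<lambda>t. u (x + t *\<^sub>R v)) has_real_derivative Du x \<bullet> v) (at 0 within {0..<\<delta>})"
    by (rule u_right_derivative[OF x d])
  have xc: "x \<in> closure \<Omega>" using x in_frontier in_closure by auto
  have cl: "x + s *\<^sub>R v \<in> closure \<Omega>" if "0 \<le> s" "s < \<delta>" for s
    using d(2)[of s] xc closure_subset that by (cases "s = 0") auto
  have "continuous_on {0..<\<delta>} (\<lambda>t. u (x + t *\<^sub>R v))"
    by (intro continuous_intros continuous_on_compose2[OF u_continuous]) (use cl in auto)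
  then have "((\<lambda>t. u (x + t *\<^sub>R v)) \<longlongrightarrow> u (x + 0 *\<^sub>R v)) (at 0 within {0..<\<delta>})"
    unfolding continuous_on_def by (rule bspec) (use d in simp)
  then have "\<forall>\<^sub>F t in at 0 within {0..<\<delta>}. u (x + t *\<^sub>R v) < b"
    by (rule order_tendstoD) (use u0 b in simp)
  then obtain e where e0: "0 < e" "\<And>t. 0 < t \<Longrightarrow> t < \<delta> \<Longrightarrow> t < e \<Longrightarrow> u (x + t *\<^sub>R v) < b"
    unfolding eventually_at by (auto simp: dist_real_def)
  have e: "0 < e" "\<And>t. 0 \<le> t \<Longrightarrow> t < \<delta> \<Longrightarrow> t < e \<Longrightarrow> u (x + t *\<^sub>R v) \<le> b"
  proof -
    show "u (x + t *\<^sub>R v) \<le> b" if "0 \<le> t" "t < \<delta>" "t < e" for t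
      using e0(2)[of t] that u0 b by (cases "t = 0") auto
  qed (rule e0(1))
  define r where "r = min \<delta> e"
  have r: "0 < r" "r \<le> \<delta>" "r \<le> e" using d(1) e(1) by (auto simp: r_def)
  have D': "((\<lambda>t. u (x + t *\<^sub>R v)) has_real_derivative Du x \<bullet> v) (at 0 within {0..<r})"
    by (rule DERIV_subset[OF D]) (use r in auto)
  have img: "(\<lambda>t. u (x + t *\<^sub>R v)) ` {0..<r} \<subseteq> {0..b}"
    using e(2) u_nonneg[OF cl] r by auto
  have "(arclen F has_real_derivative 1 / sqrt (2 * F (u (x + 0 *\<^sub>R v))))
      (at (u (x + 0 *\<^sub>R v)) within {0..b})"
    by (rule arclen_has_derivative_within[OF F]) (use u0 b in auto)
  from DERIV_image_chain[OF DERIV_subset[OF this img] D']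
  have "((\<lambda>t. arclen F (u (x + t *\<^sub>R v))) has_real_derivative
      1 / sqrt (2 * F (u (x + 0 *\<^sub>R v))) * (Du x \<bullet> v)) (at 0 within {0..<r})"
    by (simp add: o_def)
  then have "((\<lambda>t. arclen F (u (x + t *\<^sub>R v)) / t) \<longlongrightarrow> (Du x \<bullet> v) / sqrt (2 * F 0))
      (at 0 within {0..<r})"
    unfolding has_field_derivative_iff using u0 by simp
  moreover have "at 0 within {0..<r} = at_right (0::real)"
    by (rule at_within_nhd[of _ "{-1<..<r}"]) (use r in auto)
  ultimately show ?thesis by simp
qed

lemma inward_normal:
  assumes "x \<in> frontier \<Omega>"
  obtains \<delta> where "0 < \<delta>" "\<And>s. 0 < s \<Longrightarrow> s < \<delta> \<Longrightarrow> x + s *\<^sub>R (- outer_normal \<phi> x) \<in> \<Omega>"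
proof -
  define n where "n = - outer_normal \<phi> x"
  define d where "d = \<phi>' (x$1)"
  have n2: "n$2 > 0" using outer_normal_points_down[of \<phi> x] by (simp add: n_def)
  have "n$1 + d * n$2 = 0"
    using outer_normal_orthogonal_tangent[of \<phi> x] unfolding pt_def[symmetric]
    by (simp add: inner_real2 n_def d_def mult.commute)
  then have n1: "n$1 = - d * n$2" by simp
  define g where "g = (\<lambda>t. x$2 + t * n$2 - \<phi> (x$1 + t * n$1))"
  have "((\<lambda>t. \<phi> (x$1 + t * n$1)) has_real_derivative d * n$1) (at 0)"
    by (rule DERIV_chain2[of \<phi>]) (auto intro!: derivative_eq_intros simp: d_def \<phi>_deriv)
  then have "(g has_real_derivative n$2 - d * n$1) (at 0)"
    unfolding g_def by (auto intro!: derivative_eq_intros)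
  \<comment> \<open>By \<open>n1\<close> this number is
    \<open>(1 + d\<^sup>2) * n$2\<close>.\<close>
  moreover have "0 < n$2 - d * n$1" using n2 by (simp add: n1 mult.assoc[symmetric] add_pos_nonneg)
  ultimately obtain \<delta> where d: "0 < \<delta>" "\<And>h. 0 < h \<Longrightarrow> h < \<delta> \<Longrightarrow> g 0 < g (0 + h)"
    using DERIV_pos_inc_right by blast
  have "g 0 = 0" using assms by (simp add: g_def in_frontier)
  then have "x + s *\<^sub>R n \<in> \<Omega>" if "0 < s" "s < \<delta>" for s
    using d(2)[OF that] by (simp add: in_\<Omega> g_def)
  then show ?thesis using that d(1) unfolding n_def by blast
qed

lemma slope_nonpos: "slope \<le> 0"
proof -
  define x where "x = pt 0 (\<phi> 0)"
  have x: "x \<in> frontier \<Omega>" by (simp add: x_def in_frontier)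
  obtain \<delta> where d: "0 < \<delta>" "\<And>s. 0 < s \<Longrightarrow> s < \<delta> \<Longrightarrow> x + s *\<^sub>R (- outer_normal \<phi> x) \<in> \<Omega>"
    using inward_normal[OF x] by blast
  \<comment> \<open>With the constant potential 1/2, \<open>arclen\<close> is the identity on
    nonnegative arguments, so this is the inner normal derivative of \<open>u\<close>
    itself.\<close>
  have lim: "((\<lambda>t. arclen (\<lambda>_. 1 / 2) (u (x + t *\<^sub>R (- outer_normal \<phi> x))) / t) \<longlongrightarrow>
      (Du x \<bullet> (- outer_normal \<phi> x)) / sqrt (2 * (1 / 2))) (at_right 0)"
    by (rule arclen_u_right_derivative[of 1, OF _ _ x d]) auto
  have "0 \<le> (Du x \<bullet> (- outer_normal \<phi> x)) / sqrt (2 * (1 / 2))"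
  proof (rule tendsto_lowerbound[OF lim])
    show "\<forall>\<^sub>F t in at_right 0. 0 \<le> arclen (\<lambda>_. 1 / 2) (u (x + t *\<^sub>R (- outer_normal \<phi> x))) / t"
      using eventually_at_right_real[OF d(1)]
    proof eventually_elim
      case (elim t)
      then have "x + t *\<^sub>R (- outer_normal \<phi> x) \<in> \<Omega>" using d by auto
      then show ?case
        using elim u_pos by (intro divide_nonneg_pos arclen_nonneg[of "u (x + t *\<^sub>R (- outer_normal \<phi> x))"])
          (auto simp: less_imp_le)
    qed
  qed simp
  then show ?thesis using normal_component[OF x] by simp
qed

text \<open>Along the radius of a large inner ball that ends at its contact point,
  \<open>arclen F (u z)\<close> is at least the distance to that point. Hence its derivative there
  is at least 1, which means \<open>2 * F 0 \<le> slope\<^sup>2\<close>. Then \<open>a\<close> tends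
  to 1, where \<open>F 0\<close> tends to \<open>W 0\<close>.\<close>

lemma slope_lower: "2 * W 0 \<le> slope\<^sup>2"
proof -
  obtain a1 where a1: "0 < a1" "a1 < 1"
    and pos: "\<And>a s. a1 < a \<Longrightarrow> a < 1 \<Longrightarrow> 0 \<le> s \<Longrightarrow> s < a \<Longrightarrow> 0 < inner_potential a s"
    and bar: "\<And>a. a1 < a \<Longrightarrow> a < 1 \<Longrightarrow> \<exists>R0. \<forall>R\<ge>R0. \<forall>y. ball y R \<subseteq> \<Omega> \<longrightarrow>
      (\<forall>x\<in>ball y R. u x < a \<longrightarrow> R - dist x y \<le> arclen (inner_potential a) (u x))"
    using inner_barrier by blast
  have le: "2 * inner_potential a 0 \<le> slope\<^sup>2" if a: "a1 < a" "a < 1" for a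
  proof -
    obtain R0 where R0: "\<And>R y x. R0 \<le> R \<Longrightarrow> ball y R \<subseteq> \<Omega> \<Longrightarrow> x \<in> ball y R \<Longrightarrow> u x < a \<Longrightarrow>
        R - dist x y \<le> arclen (inner_potential a) (u x)"
      using bar[OF a] by blast
    obtain x y where xy: "x \<in> frontier \<Omega>" "R0 \<le> dist y x" "ball y (dist y x) \<subseteq> \<Omega>" "y \<noteq> x"
      by (rule touching_ball_inside)
    define r where "r = dist y x"
    define n where "n = (1 / r) *\<^sub>R (y - x)"
    have r: "0 < r" using xy by (simp add: r_def)
    have n: "norm n = 1" using r by (simp add: n_def r_def dist_norm)
    have dist: "dist (x + t *\<^sub>R n) y = r - t" if "0 < t" "t < r" for t
    proof -
      have "x + t *\<^sub>R n - y = (t / r - 1) *\<^sub>R (y - x)" using r by (simp add: n_def algebra_simps)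
      then have "dist (x + t *\<^sub>R n) y = \<bar>t / r - 1\<bar> * r"
        by (simp add: dist_norm r_def)
      also have "\<dots> = r - t" using that by (simp add: abs_if field_simps)
      finally show ?thesis .
    qed
    have inb: "x + t *\<^sub>R n \<in> ball y r" if "0 < t" "t < r" for t
      using dist[OF that] that by (simp add: dist_commute)
    then have inO: "x + t *\<^sub>R n \<in> \<Omega>" if "0 < t" "t < r" for t
      using xy(3) that r_def by blast
    define b where "b = a / 2"
    have b: "0 < b" "b < a" using a a1 by (auto simp: b_def)
    define F where "F = inner_potential a"
    have cF: "continuous_on {0..b} F" unfolding F_def by (rule inner_potential_continuous) auto
    have pF: "0 < F t" if "0 \<le> t" "t \<le> b" for t unfolding F_def using pos[OF a] that b by auto
    have lim: "((\<lambda>t. arclen F (u (x + t *\<^sub>R n)) / t) \<longlongrightarrow> (Du x \<bullet> n) / sqrt (2 * F 0)) (at_right 0)"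
      by (rule arclen_u_right_derivative[OF cF pF xy(1) r inO b(1)])
    have ulim: "((\<lambda>t. u (x + t *\<^sub>R n)) \<longlongrightarrow> 0) (at_right 0)"
    proof -
      have "((\<lambda>t. u (x + t *\<^sub>R n)) has_real_derivative Du x \<bullet> n) (at 0 within {0..<r})"
        by (rule u_right_derivative[OF xy(1) r inO])
      then have "((\<lambda>t. u (x + t *\<^sub>R n)) \<longlongrightarrow> u (x + 0 *\<^sub>R n)) (at 0 within {0..<r})"
        using DERIV_continuous continuous_within by blast
      moreover have "at 0 within {0..<r} = at_right (0::real)"
        by (rule at_within_nhd[of _ "{-1<..<r}"]) (use r in auto)
      ultimately show ?thesis using u_frontier[OF xy(1)] by simp
    qed
    have "1 \<le> (Du x \<bullet> n) / sqrt (2 * F 0)"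
    proof (rule tendsto_lowerbound[OF lim])
      have "\<forall>\<^sub>F t in at_right 0. u (x + t *\<^sub>R n) < a"
        using order_tendstoD(2)[OF ulim, of a] a a1 by simp
      then show "\<forall>\<^sub>F t in at_right 0. 1 \<le> arclen F (u (x + t *\<^sub>R n)) / t"
        using eventually_at_right_real[OF r]
      proof eventually_elim
        case (elim t)
        then have t: "0 < t" "t < r" by auto
        have "r - dist (x + t *\<^sub>R n) y \<le> arclen F (u (x + t *\<^sub>R n))"
          unfolding F_def using R0[of r y "x + t *\<^sub>R n"] xy inb[OF t] elim(1) by (simp add: r_def)
        then show ?case using dist[OF t] t by simp
      qed
    qed simp
    moreover have F0: "0 < F 0" using pF b by simp
    ultimately have "sqrt (2 * F 0) \<le> Du x \<bullet> n" by (simp add: pos_le_divide_eq)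
    also have "\<dots> \<le> norm (Du x) * norm n" by (rule norm_cauchy_schwarz)
    also have "\<dots> = \<bar>slope\<bar>" using n norm_Du_frontier[OF xy(1)] by simp
    finally have "(sqrt (2 * F 0))\<^sup>2 \<le> \<bar>slope\<bar>\<^sup>2" using F0 by (intro power_mono) auto
    then show ?thesis using F0 by (simp add: F_def)
  qed
  have "isCont (\<lambda>a. 2 * inner_potential a 0) 1"
    unfolding inner_potential_def
    by (intro continuous_intros DERIV_isCont[OF W_deriv] DERIV_isCont[OF W1_deriv]) auto
  then have "((\<lambda>a. 2 * inner_potential a 0) \<longlongrightarrow> 2 * W 0) (at 1)"
    by (simp add: isCont_def inner_potential_def)
  then have lim: "((\<lambda>a. 2 * inner_potential a 0) \<longlongrightarrow> 2 * W 0) (at_left 1)"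
    by (rule tendsto_within_subset) simp
  show ?thesis
  proof (rule tendsto_upperbound[OF lim])
    show "\<forall>\<^sub>F a in at_left 1. 2 * inner_potential a 0 \<le> slope\<^sup>2"
      using eventually_at_left_real[OF a1(2)] by eventually_elim (use le in auto)
  qed simp
qed

text \<open>At the contact point of a large outer ball, \<open>arclen F (u z)\<close> is at most the
  distance to that point, so its inner normal derivative is at most 1. As
  \<open>2 * F 0 = 2 * W 0 + 6 * k\<close>, letting \<open>k\<close> tend to 0 gives the
  claim.\<close>

lemma slope_upper: "slope\<^sup>2 \<le> 2 * W 0"
proof -
  have le: "slope\<^sup>2 \<le> 2 * W 0 + 6 * k" if k: "0 < k" for k
  proof -
    obtain R0 where R0: "\<And>R y x. R0 \<le> R \<Longrightarrow> ball y R \<inter> \<Omega> = {} \<Longrightarrow> x \<in> closure \<Omega> \<Longrightarrow>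
        arclen (outer_potential k) (u x) \<le> dist x y - R"
      using outer_barrier[OF k] by blast
    obtain x y where xy: "x \<in> frontier \<Omega>" "R0 \<le> dist y x" "ball y (dist y x) \<inter> \<Omega> = {}"
      by (rule touching_ball_outside)
    define n where "n = - outer_normal \<phi> x"
    have n: "norm n = 1" by (simp add: n_def outer_normal_unit)
    obtain \<delta> where d: "0 < \<delta>" "\<And>s. 0 < s \<Longrightarrow> s < \<delta> \<Longrightarrow> x + s *\<^sub>R n \<in> \<Omega>"
      using inward_normal[OF xy(1)] unfolding n_def by blast
    define F where "F = outer_potential k"
    have cF: "continuous_on {0..2} F" unfolding F_def by (rule outer_potential_continuous) auto
    have pF: "0 < F t" if "0 \<le> t" "t \<le> 2" for t
      unfolding F_def using outer_potential_lower[OF k that] k by simp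
    have lim: "((\<lambda>t. arclen F (u (x + t *\<^sub>R n)) / t) \<longlongrightarrow> (Du x \<bullet> n) / sqrt (2 * F 0)) (at_right 0)"
      by (rule arclen_u_right_derivative[OF cF pF xy(1) d]) auto
    have "(Du x \<bullet> n) / sqrt (2 * F 0) \<le> 1"
    proof (rule tendsto_upperbound[OF lim])
      show "\<forall>\<^sub>F t in at_right 0. arclen F (u (x + t *\<^sub>R n)) / t \<le> 1"
        using eventually_at_right_real[OF d(1)]
      proof eventually_elim
        case (elim t)
        then have t: "0 < t" "t < \<delta>" by auto
        have "x + t *\<^sub>R n \<in> closure \<Omega>" using d(2)[OF t] closure_subset by blast
        then have "arclen F (u (x + t *\<^sub>R n)) \<le> dist (x + t *\<^sub>R n) y - dist y x"
          unfolding F_def using R0[OF xy(2,3)] by blast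
        also have "dist (x + t *\<^sub>R n) y \<le> dist (x + t *\<^sub>R n) x + dist x y" by (rule dist_triangle)
        also have "dist (x + t *\<^sub>R n) x = t" using n t by (simp add: dist_norm)
        finally show ?case using t by (simp add: dist_commute)
      qed
    qed simp
    moreover have F0: "0 < F 0" using pF by simp
    ultimately have "Du x \<bullet> n \<le> sqrt (2 * F 0)" by simp
    moreover have "Du x \<bullet> n = - slope" using normal_component[OF xy(1)] by (simp add: n_def)
    ultimately have "(- slope)\<^sup>2 \<le> (sqrt (2 * F 0))\<^sup>2" using slope_nonpos by (intro power_mono) auto
    then show ?thesis using F0 by (simp add: F_def outer_potential_def)
  qed
  show ?thesis
  proof (rule field_le_epsilon)
    fix e :: real assume "0 < e"
    then show "slope\<^sup>2 \<le> 2 * W 0 + e" using le[of "e / 6"] by simp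
  qed
qed

lemma slope_eq: "slope\<^sup>2 = 2 * W 0"
  using slope_lower slope_upper by simp

end

section \<open>The gradient estimate\<close>

context overdetermined
begin

text \<open>The maximum of \<open>w x - w y - dist x y\<close>, with \<open>w = arclen F (u \<dots>)\<close>, is not attained: at an
  interior maximum both gradients of \<open>w\<close> are the unit vector from \<open>y\<close> to \<open>x\<close>, so that
  \<open>\<Delta>w = k / sqrt (2 * F (u \<dots>))\<close> at both points, and this is strictly increasing in \<open>u\<close>.\<close>

lemma two_point_estimate:
  assumes k: "0 < k" and x1: "x1 \<in> closure \<Omega>" and y1: "y1 \<in> closure \<Omega>"
  defines "w \<equiv> \<lambda>x. arclen (outer_potential k) (u x)"
  shows "w x1 - w y1 \<le> dist x1 y1"
proof (rule ccontr)
  assume "\<not> w x1 - w y1 \<le> dist x1 y1"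
  define Z0 where "Z0 = w x1 - w y1 - dist x1 y1"
  have Z0: "0 < Z0" using \<open>\<not> _\<close> by (simp add: Z0_def)
  define F where "F = outer_potential k"
  have w: "w x = arclen F (u x)" for x by (simp add: w_def F_def)
  define M where "M = W 0 + 3 * k"
  have M: "0 < M" using W_pos[of 0] k by (simp add: M_def)
  obtain C where C: "0 < C" "\<And>s. 0 \<le> s \<Longrightarrow> s \<le> 1 \<Longrightarrow> - W1 s \<le> C"
    using W_bounds by blast
  have cF: "continuous_on {0..2} F" unfolding F_def by (rule outer_potential_continuous) auto
  have Fk: "k \<le> F t" if "0 \<le> t" "t \<le> 2" for t
    unfolding F_def by (rule outer_potential_lower[OF k that])
  have pF: "0 < F t" if "0 \<le> t" "t \<le> 2" for t using Fk[OF that] k by simp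
  have FM: "F t \<le> M" if "0 \<le> t" "t \<le> 1" for t
    unfolding F_def M_def by (rule outer_potential_upper[OF k that])
  have u01: "0 \<le> u z" "u z \<le> 1" if "z \<in> closure \<Omega>" for z using that u_nonneg u_le_1 by auto
  define g1 where "g1 = arclen F 1"
  have g1: "0 \<le> g1" unfolding g1_def by (rule arclen_nonneg[OF cF pF]) auto
  have w01: "0 \<le> w z" "w z \<le> g1" if "z \<in> closure \<Omega>" for z
    unfolding w g1_def using u01[OF that]
    by (auto intro!: arclen_nonneg[OF cF pF] arclen_mono[OF cF pF])
  have wcont: "continuous_on (closure \<Omega>) w"
    unfolding w using u01 by (intro continuous_arclen_u[OF cF pF]) force+
  have sq2M: "0 < sqrt (2 * M)" and sq2k: "0 < sqrt (2 * k)" using M k by auto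
  define C1 where "C1 = (C + k) / sqrt (2 * k)"
  have C1: "0 < C1" using C k by (simp add: C1_def)
  \<comment> \<open>The gap by which \<open>k / q\<close> exceeds \<open>k / q'\<close> at the
    maximum: \<open>k\<close> times a lower bound for the derivative of
    \<open>1 / sqrt (2 * F)\<close>, times a lower bound for \<open>u x - u y\<close>.\<close>
  define \<epsilon> where "\<epsilon> = k * (k / sqrt (2 * M) ^ 3) * (sqrt (2 * k) * (Z0 / 2))"
  have \<epsilon>: "0 < \<epsilon>" unfolding \<epsilon>_def using k M Z0 by (intro mult_pos_pos divide_pos_pos zero_less_power) auto
  \<comment> \<open>The penalty weight is \<open>s\<^sup>2\<close>, so that
    \<open>s * norm x \<le> sqrt g1\<close> at the maximum and the error terms in \<open>s\<close>
    stay below \<epsilon>. The last condition keeps at least half of \<open>Z0\<close> at the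
    starting pair.\<close>
  obtain s where s: "0 < s" "4 * s\<^sup>2 + C1 * (4 * (s * sqrt g1)) < \<epsilon>" "s\<^sup>2 * (norm x1)\<^sup>2 < Z0 / 2"
  proof -
    have "((\<lambda>s. 4 * s\<^sup>2 + C1 * (4 * (s * sqrt g1))) \<longlongrightarrow> 4 * 0\<^sup>2 + C1 * (4 * (0 * sqrt g1))) (at_right 0)"
      by (intro tendsto_intros)
    then have "\<forall>\<^sub>F s in at_right 0. 4 * s\<^sup>2 + C1 * (4 * (s * sqrt g1)) < \<epsilon>"
      by (rule order_tendstoD) (use \<epsilon> in simp)
    moreover have "((\<lambda>s. s\<^sup>2 * (norm x1)\<^sup>2) \<longlongrightarrow> 0\<^sup>2 * (norm x1)\<^sup>2) (at_right 0)"
      by (intro tendsto_intros)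
    then have "\<forall>\<^sub>F s in at_right 0. s\<^sup>2 * (norm x1)\<^sup>2 < Z0 / 2"
      by (rule order_tendstoD) (use Z0 in simp)
    ultimately have "\<forall>\<^sub>F s in at_right 0. 0 < s \<and> 4 * s\<^sup>2 + C1 * (4 * (s * sqrt g1)) < \<epsilon> \<and>
        s\<^sup>2 * (norm x1)\<^sup>2 < Z0 / 2"
      using eventually_at_right_real[of 0 1] by (auto elim: eventually_elim2 simp: eventually_conj_iff)
    then show ?thesis using that eventually_happens'[of "at_right (0::real)"] by force
  qed
  define \<eta> where "\<eta> = s\<^sup>2"
  have \<eta>: "0 < \<eta>" using s by (simp add: \<eta>_def)
  \<comment> \<open>At radius \<rho> the penalty reaches \<open>g1\<close>, the maximum of
    \<open>w\<close>, which keeps the maximising \<open>x\<close> strictly inside \<open>X\<close>;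
    and \<open>y\<close> is within \<open>g1\<close> of \<open>x\<close>, hence strictly inside
    \<open>Y\<close>.\<close>
  define \<rho> where "\<rho> = norm x1 + sqrt g1 / s"
  have \<rho>: "norm x1 \<le> \<rho>" "0 \<le> \<rho>" "g1 \<le> \<eta> * \<rho>\<^sup>2"
  proof -
    have "(sqrt g1 / s)\<^sup>2 \<le> \<rho>\<^sup>2" unfolding \<rho>_def using s g1 by (intro power_mono) auto
    then have "\<eta> * (sqrt g1 / s)\<^sup>2 \<le> \<eta> * \<rho>\<^sup>2" using \<eta> by (intro mult_left_mono) auto
    then show "g1 \<le> \<eta> * \<rho>\<^sup>2" using s g1 by (simp add: \<eta>_def power_divide)
  qed (use s g1 in \<open>auto simp: \<rho>_def\<close>)
  define Z where "Z = (\<lambda>x y. w x - w y - norm (x - y) - \<eta> * (norm x)\<^sup>2)"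
  define X where "X = closure \<Omega> \<inter> cball 0 \<rho>"
  define Y where "Y = closure \<Omega> \<inter> cball 0 (\<rho> + g1 + 1)"
  have d1: "dist x1 y1 < g1" using Z0 w01[OF x1] w01[OF y1] by (simp add: Z0_def)
  have x1X: "x1 \<in> X" using x1 \<rho> by (simp add: X_def)
  have y1Y: "y1 \<in> Y"
  proof -
    have "norm y1 \<le> norm x1 + dist x1 y1" using norm_triangle_sub[of y1 x1] by (simp add: dist_norm norm_minus_commute)
    then show ?thesis using y1 d1 \<rho> by (simp add: Y_def)
  qed
  have "compact (X \<times> Y)"
    unfolding X_def Y_def by (intro compact_Times closed_Int_compact closed_closure compact_cball)
  moreover have "continuous_on (X \<times> Y) (\<lambda>p. Z (fst p) (snd p))"
    unfolding Z_def
    by (intro continuous_intros continuous_on_compose2[OF wcont]) (auto simp: X_def Y_def)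
  ultimately obtain p where p: "p \<in> X \<times> Y" "\<And>p'. p' \<in> X \<times> Y \<Longrightarrow> Z (fst p') (snd p') \<le> Z (fst p) (snd p)"
    using continuous_attains_sup[of "X \<times> Y" "\<lambda>p. Z (fst p) (snd p)"] x1X y1Y by blast
  define x where "x = fst p"
  define y where "y = snd p"
  have xX: "x \<in> X" and yY: "y \<in> Y" using p(1) by (auto simp: x_def y_def)
  have mx: "Z x' y' \<le> Z x y" if "x' \<in> X" "y' \<in> Y" for x' y'
    using p(2)[of "(x', y')"] that by (simp add: x_def y_def)
  have xc: "x \<in> closure \<Omega>" and yc: "y \<in> closure \<Omega>" using xX yY by (auto simp: X_def Y_def)
  have Zxy: "Z0 / 2 < Z x y"
  proof -
    have "Z0 / 2 < Z x1 y1" using s(3) by (simp add: Z_def Z0_def \<eta>_def dist_norm)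
    then show ?thesis using mx[OF x1X y1Y] by simp
  qed
  have \<eta>x: "0 \<le> \<eta> * (norm x)\<^sup>2" using \<eta> by simp
  have wxy: "Z0 / 2 < w x - w y" using Zxy \<eta>x norm_ge_zero[of "x - y"] unfolding Z_def by linarith
  have dxy: "norm (x - y) < g1"
    using Zxy Z0 \<eta>x w01[OF xc] w01[OF yc] unfolding Z_def by linarith
  have \<eta>xg: "\<eta> * (norm x)\<^sup>2 < g1"
    using Zxy Z0 norm_ge_zero[of "x - y"] w01[OF xc] w01[OF yc] unfolding Z_def by linarith
  have xr: "norm x < \<rho>"
  proof (rule ccontr)
    assume "\<not> norm x < \<rho>"
    then have "\<rho>\<^sup>2 \<le> (norm x)\<^sup>2" using \<rho> by (intro power_mono) auto
    then have "\<eta> * \<rho>\<^sup>2 \<le> \<eta> * (norm x)\<^sup>2" using \<eta> by (intro mult_left_mono) auto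
    then show False using \<rho>(3) \<eta>xg by linarith
  qed
  have yr: "norm y < \<rho> + g1 + 1"
    using norm_triangle_sub[of y x] dxy xr by (simp add: norm_minus_commute)
  have xO: "x \<in> \<Omega>"
  proof (rule ccontr)
    assume "x \<notin> \<Omega>"
    then have "w x = 0" using xc u_frontier by (auto elim: closure_cases simp: w)
    then show False using wxy Z0 w01[OF yc] by simp
  qed
  have xy: "x \<noteq> y" using wxy Z0 by auto
  \<comment> \<open>The boundary condition enters here. If \<open>y\<close> were on the boundary, it
    would be the boundary point nearest to \<open>x\<close>, and \<open>w\<close> would rise from
    \<open>y\<close> towards \<open>x\<close> at rate at least 1. So \<open>slope\<^sup>2\<close>
    would be at least \<open>2 * F 0\<close>, which is \<open>2 * W 0 + 6 * k\<close>.\<close>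
  have yO: "y \<in> \<Omega>"
  proof (rule ccontr)
    assume "y \<notin> \<Omega>"
    then have yf: "y \<in> frontier \<Omega>" using yc by (auto elim: closure_cases)
    then have wy: "w y = 0" using u_frontier by (simp add: w)
    define r where "r = norm (x - y)"
    have r: "0 < r" using xy by (simp add: r_def)
    have nofr: "ball x r \<inter> frontier \<Omega> = {}"
    proof (rule ccontr)
      assume "ball x r \<inter> frontier \<Omega> \<noteq> {}"
      then obtain y' where y': "dist x y' < r" "y' \<in> frontier \<Omega>" by auto
      have y'c: "y' \<in> closure \<Omega>" using y'(2) by (simp add: frontier_def)
      have "norm y' < \<rho> + g1 + 1"
        using norm_triangle_sub[of y' x] y'(1) dxy xr unfolding r_def dist_norm
        by (simp add: norm_minus_commute)
      then have "y' \<in> Y" using y'c by (simp add: Y_def)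
      then have "Z x y' \<le> Z x y" using mx xX by blast
      moreover have "w y' = 0" using u_frontier[OF y'(2)] by (simp add: w)
      ultimately show False using y'(1) wy by (simp add: Z_def r_def dist_norm)
    qed
    have bO: "ball x r \<subseteq> \<Omega>" by (rule ball_subset_\<Omega>[OF xO nofr])
    define e where "e = (1 / r) *\<^sub>R (x - y)"
    have e: "norm e = 1" using r by (simp add: e_def r_def)
    have nm: "norm (x - (y + t *\<^sub>R e)) = r - t" if "0 < t" "t < r" for t
    proof -
      have "x - (y + t *\<^sub>R e) = (1 - t / r) *\<^sub>R (x - y)" by (simp add: e_def algebra_simps)
      then have "norm (x - (y + t *\<^sub>R e)) = \<bar>1 - t / r\<bar> * r" by (simp add: r_def)
      also have "\<dots> = r - t" using that by (simp add: abs_if field_simps)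
      finally show ?thesis .
    qed
    have yt: "y + t *\<^sub>R e \<in> \<Omega>" if "0 < t" "t < r" for t
      using bO nm[OF that] that by (auto simp: dist_norm)
    have lim: "((\<lambda>t. arclen F (u (y + t *\<^sub>R e)) / t) \<longlongrightarrow> (Du y \<bullet> e) / sqrt (2 * F 0)) (at_right 0)"
      by (rule arclen_u_right_derivative[OF cF pF yf r yt]) auto
    have "1 \<le> (Du y \<bullet> e) / sqrt (2 * F 0)"
    proof (rule tendsto_lowerbound[OF lim])
      have "\<forall>\<^sub>F t in at_right 0. t \<in> {0<..<1::real}" by (rule eventually_at_right_real) simp
      then show "\<forall>\<^sub>F t in at_right 0. 1 \<le> arclen F (u (y + t *\<^sub>R e)) / t"
        using eventually_at_right_real[OF r]
      proof eventually_elim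
        case (elim t)
        then have t: "0 < t" "t < r" "t < 1" by auto
        have "norm (y + t *\<^sub>R e) \<le> norm x + norm (x - (y + t *\<^sub>R e))"
          using norm_triangle_sub[of "y + t *\<^sub>R e" x] by (simp add: norm_minus_commute)
        then have "norm (y + t *\<^sub>R e) \<le> \<rho> + g1 + 1" using nm[OF t(1,2)] t xr dxy by (simp add: r_def)
        then have "y + t *\<^sub>R e \<in> Y" using yt[OF t(1,2)] closure_subset[of \<Omega>] by (auto simp: Y_def)
        then have "Z x (y + t *\<^sub>R e) \<le> Z x y" using mx xX by blast
        then have "t \<le> w (y + t *\<^sub>R e)" using nm[OF t(1,2)] wy by (simp add: Z_def r_def)
        then show ?case using t by (simp add: w)
      qed
    qed simp
    moreover have F0: "0 < F 0" using pF by simp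
    ultimately have "sqrt (2 * F 0) \<le> Du y \<bullet> e" by (simp add: pos_le_divide_eq)
    also have "\<dots> \<le> norm (Du y) * norm e" by (rule norm_cauchy_schwarz)
    also have "\<dots> = \<bar>slope\<bar>" using e norm_Du_frontier[OF yf] by simp
    finally have "(sqrt (2 * F 0))\<^sup>2 \<le> \<bar>slope\<bar>\<^sup>2" using F0 by (intro power_mono) auto
    then show False using F0 slope_eq k by (simp add: F_def outer_potential_def)
  qed
  have evX: "\<forall>\<^sub>F x' in nhds x. x' \<in> \<Omega> \<and> x' \<in> X"
  proof -
    have "x \<in> ball 0 \<rho>" using xr by simp
    from eventually_nhds_in_open[OF open_ball this] eventually_nhds_in_open[OF open_\<Omega> xO]
    show ?thesis by eventually_elim (use closure_subset[of \<Omega>] in \<open>auto simp: X_def\<close>)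
  qed
  have evY: "\<forall>\<^sub>F y' in nhds y. y' \<in> \<Omega> \<and> y' \<in> Y"
  proof -
    have "y \<in> ball 0 (\<rho> + g1 + 1)" using yr by simp
    from eventually_nhds_in_open[OF open_ball this] eventually_nhds_in_open[OF open_\<Omega> yO]
    show ?thesis by eventually_elim (use closure_subset[of \<Omega>] in \<open>auto simp: Y_def\<close>)
  qed
  define q where "q = sqrt (2 * F (u x))"
  define q' where "q' = sqrt (2 * F (u y))"
  have q: "sqrt (2 * k) \<le> q" unfolding q_def using Fk u01[OF xc] by auto
  have q0: "0 < q" "0 < q'" using pF u01[OF xc] u01[OF yc] by (auto simp: q_def q'_def)
  have ux2: "u x < 2" "u y < 2" using u01[OF xc] u01[OF yc] by auto
  have F': "(F has_real_derivative W1 (u z) - k) (at (u z))" if "z \<in> \<Omega>" for z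
    unfolding F_def by (rule outer_potential_deriv[OF u_pos[OF that]])
  define r where "r = norm (x - y)"
  have r: "0 < r" using xy by (simp add: r_def)
  define n where "n = (\<lambda>i. (x - y) $ i / r)"
  have n1: "(n 1)\<^sup>2 + (n 2)\<^sup>2 = 1" unfolding n_def r_def by (rule unit_components[OF xy])
  have tdx: "twice_deriv (\<lambda>t. w (x + t *\<^sub>R axis i 1)) 0 (partial i u x / q)
      (partial i (partial i u) x / q - (W1 (u x) - k) * (partial i u x)\<^sup>2 / q ^ 3)" for i
    unfolding w q_def by (rule arclen_u_twice_deriv[OF cF pF xO ux2(1) F'[OF xO]])
  have tdy: "twice_deriv (\<lambda>t. w (y + t *\<^sub>R axis i 1)) 0 (partial i u y / q')
      (partial i (partial i u) y / q' - (W1 (u y) - k) * (partial i u y)\<^sup>2 / q' ^ 3)" for i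
    unfolding w q'_def by (rule arclen_u_twice_deriv[OF cF pF yO ux2(2) F'[OF yO]])
  have gx: "partial i u x = q * (n i + 2 * \<eta> * x$i)" for i
  proof -
    have ev: "\<forall>\<^sub>F x' in nhds x. Z x' y \<le> Z x y" using evX by eventually_elim (use mx yY in auto)
    have "twice_deriv (\<lambda>t. Z (x + t *\<^sub>R axis i 1) y) 0
        (partial i u x / q - 0 - (x - y)$i / norm (x - y) - \<eta> * (2 * x$i))
        (partial i (partial i u) x / q - (W1 (u x) - k) * (partial i u x)\<^sup>2 / q ^ 3 - 0 -
          (1 / norm (x - y) - ((x - y)$i)\<^sup>2 / norm (x - y) ^ 3) - \<eta> * 2)"
      unfolding Z_def
      by (intro twice_deriv_diff twice_deriv_cmult tdx twice_deriv_const
          twice_deriv_norm_axis[OF xy] twice_deriv_norm_square_axis)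
    from axis_local_max(1)[OF ev this] have "partial i u x / q = n i + 2 * \<eta> * x$i"
      by (simp add: n_def r_def)
    then show ?thesis using q0 by (simp add: divide_eq_eq mult.commute)
  qed
  have gy: "partial i u y = q' * n i" for i
  proof -
    have ev: "\<forall>\<^sub>F y' in nhds y. Z x y' \<le> Z x y" using evY by eventually_elim (use mx xX in auto)
    have Zeq: "Z x (y + t *\<^sub>R axis i 1) = w x - w (y + t *\<^sub>R axis i 1) - norm (y + t *\<^sub>R axis i 1 - x)
        - \<eta> * (norm x)\<^sup>2" for t by (simp add: Z_def norm_minus_commute)
    have "twice_deriv (\<lambda>t. Z x (y + t *\<^sub>R axis i 1)) 0
        (0 - partial i u y / q' - (y - x)$i / norm (y - x) - 0)
        (0 - (partial i (partial i u) y / q' - (W1 (u y) - k) * (partial i u y)\<^sup>2 / q' ^ 3) -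
          (1 / norm (y - x) - ((y - x)$i)\<^sup>2 / norm (y - x) ^ 3) - 0)"
      unfolding Zeq
      by (intro twice_deriv_diff tdy twice_deriv_const twice_deriv_norm_axis xy[symmetric])
    from axis_local_max(1)[OF ev this] have "partial i u y / q' = n i"
      by (simp add: n_def r_def norm_minus_commute[of y x] diff_divide_distrib)
    then show ?thesis using q0 by (simp add: divide_eq_eq mult.commute)
  qed
  \<comment> \<open>Moving both points by the same vector leaves their distance fixed, so no
    curvature term appears in this second-order condition.\<close>
  have dd: "partial i (partial i u) x / q - (W1 (u x) - k) * (n i + 2 * \<eta> * x$i)\<^sup>2 / q
      - (partial i (partial i u) y / q' - (W1 (u y) - k) * (n i)\<^sup>2 / q') \<le> 2 * \<eta>" for i
  proof -
    have ev: "\<forall>\<^sub>F t in nhds 0. Z (x + t *\<^sub>R axis i 1) (y + t *\<^sub>R axis i 1) \<le>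
        Z (x + 0 *\<^sub>R axis i 1) (y + 0 *\<^sub>R axis i 1)"
      using eventually_axis[OF evX, of i] eventually_axis[OF evY, of i]
      by eventually_elim (use mx in auto)
    have Zeq: "Z (x + t *\<^sub>R axis i 1) (y + t *\<^sub>R axis i 1) = w (x + t *\<^sub>R axis i 1) - w (y + t *\<^sub>R axis i 1)
        - r - \<eta> * (norm (x + t *\<^sub>R axis i 1))\<^sup>2" for t by (simp add: Z_def r_def)
    have "twice_deriv (\<lambda>t. Z (x + t *\<^sub>R axis i 1) (y + t *\<^sub>R axis i 1)) 0
        (partial i u x / q - partial i u y / q' - 0 - \<eta> * (2 * x$i))
        (partial i (partial i u) x / q - (W1 (u x) - k) * (partial i u x)\<^sup>2 / q ^ 3
        - (partial i (partial i u) y / q' - (W1 (u y) - k) * (partial i u y)\<^sup>2 / q' ^ 3) - 0 - \<eta> * 2)"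
      unfolding Zeq
      by (intro twice_deriv_diff twice_deriv_cmult tdx tdy twice_deriv_const
          twice_deriv_norm_square_axis)
    note m = twice_deriv_local_max(2)[OF this ev]
    have "(partial i u x)\<^sup>2 / q ^ 3 = (n i + 2 * \<eta> * x$i)\<^sup>2 / q"
      using q0(1) unfolding gx by (simp add: power_mult_distrib power2_eq_square power3_eq_cube)
    moreover have "(partial i u y)\<^sup>2 / q' ^ 3 = (n i)\<^sup>2 / q'"
      using q0(2) unfolding gy by (simp add: power_mult_distrib power2_eq_square power3_eq_cube)
    ultimately show ?thesis using m
      by (simp add: times_divide_eq_right[symmetric] del: times_divide_eq_right)
  qed
  \<comment> \<open>\<open>N\<close> is the squared norm of the gradient of \<open>w\<close> at
    \<open>x\<close>; the penalty makes it differ from 1. Its factor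
    \<open>- (W1 (u x) - k) / q\<close> is nonnegative, so an upper bound for \<open>1 - N\<close>
    is what counts.\<close>
  define N where "N = (n 1 + 2 * \<eta> * x$1)\<^sup>2 + (n 2 + 2 * \<eta> * x$2)\<^sup>2"
  have N: "1 - N \<le> 4 * (s * sqrt g1)"
  proof -
    define nv where "nv = (1 / r) *\<^sub>R (x - y)"
    have "norm nv = 1" using r by (simp add: nv_def r_def)
    then have "\<bar>nv \<bullet> x\<bar> \<le> norm x" using Cauchy_Schwarz_ineq2[of nv x] by simp
    moreover have "nv \<bullet> x = n 1 * x$1 + n 2 * x$2" by (simp add: inner_real2 nv_def n_def)
    ultimately have "- norm x \<le> n 1 * x$1 + n 2 * x$2" by linarith
    then have "\<eta> * (- norm x) \<le> \<eta> * (n 1 * x$1 + n 2 * x$2)" using \<eta> by (intro mult_left_mono) auto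
    moreover have "N = (n 1)\<^sup>2 + (n 2)\<^sup>2 + 4 * (\<eta> * (n 1 * x$1 + n 2 * x$2)) + 4 * \<eta>\<^sup>2 * ((x$1)\<^sup>2 + (x$2)\<^sup>2)"
      unfolding N_def by (simp add: power2_eq_square algebra_simps)
    moreover have "0 \<le> 4 * \<eta>\<^sup>2 * ((x$1)\<^sup>2 + (x$2)\<^sup>2)" by simp
    ultimately have "1 - N \<le> 4 * (\<eta> * norm x)" using n1 by linarith
    also have "\<eta> * norm x \<le> s * sqrt g1"
    proof -
      have "(s * norm x)\<^sup>2 \<le> g1" using \<eta>xg by (simp add: \<eta>_def power_mult_distrib)
      then have "s * norm x \<le> sqrt g1" by (rule real_le_rsqrt)
      then have "s * (s * norm x) \<le> s * sqrt g1" using s by (intro mult_left_mono) auto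
      then show ?thesis by (simp add: \<eta>_def power2_eq_square)
    qed
    finally show ?thesis by simp
  qed
  have sum: "k / q - k / q' \<le> 4 * \<eta> + - (W1 (u x) - k) / q * (1 - N)"
  proof -
    have "(partial 1 (partial 1 u) x + partial 2 (partial 2 u) x) / q - (W1 (u x) - k) / q * N
        - ((partial 1 (partial 1 u) y + partial 2 (partial 2 u) y) / q' - (W1 (u y) - k) / q' * ((n 1)\<^sup>2 + (n 2)\<^sup>2))
        \<le> 4 * \<eta>"
      using dd[of 1] dd[of 2] unfolding N_def
      by (simp add: add_divide_distrib diff_divide_distrib ring_distribs)
    then have "W1 (u x) / q - (W1 (u x) - k) / q * N - k / q' \<le> 4 * \<eta>"
      unfolding n1 laplacian_sum[OF xO] laplacian_sum[OF yO] by (simp add: diff_divide_distrib)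
    then show ?thesis by (simp add: algebra_simps diff_divide_distrib add_divide_distrib)
  qed
  have "- (W1 (u x) - k) / q * (1 - N) \<le> C1 * (4 * (s * sqrt g1))"
  proof -
    have a: "0 \<le> - (W1 (u x) - k)" "- (W1 (u x) - k) \<le> C + k"
      using W1_nonpos[of "u x"] C(2)[of "u x"] u01[OF xc] k by auto
    have b: "- (W1 (u x) - k) / q \<le> C1"
      unfolding C1_def using a q sq2k C k by (intro frac_le) auto
    have c: "0 \<le> - (W1 (u x) - k) / q" using a q0 by (intro divide_nonneg_pos) auto
    have d: "0 \<le> 4 * (s * sqrt g1)" using s g1 by simp
    show ?thesis using mult_left_mono[OF N c] mult_right_mono[OF b d] by linarith
  qed
  then have upper: "k / q - k / q' < \<epsilon>" using sum s(2) by (simp add: \<eta>_def)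
  have uxy: "u y < u x"
  proof (rule ccontr)
    assume "\<not> u y < u x"
    then have "w x \<le> w y" unfolding w using u01[OF xc] u01[OF yc] by (intro arclen_mono[OF cF pF]) auto
    then show False using wxy Z0 by simp
  qed
  have udiff: "sqrt (2 * k) * (Z0 / 2) \<le> u x - u y"
  proof -
    have b: "0 \<le> u y" "u x \<le> 2" using u01[OF xc] u01[OF yc] by auto
    obtain z where z: "u y < z" "z < u x" "w x - w y = (u x - u y) / sqrt (2 * F z)"
      unfolding w by (rule arclen_mvt[OF cF pF b(1) uxy b(2)])
    have "sqrt (2 * k) \<le> sqrt (2 * F z)" using Fk[of z] z u01[OF xc] u01[OF yc] by simp
    then have "(u x - u y) / sqrt (2 * F z) \<le> (u x - u y) / sqrt (2 * k)"
      using uxy sq2k by (intro divide_left_mono mult_pos_pos) auto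
    then have "Z0 / 2 \<le> (u x - u y) / sqrt (2 * k)" using z(3) wxy by linarith
    then show ?thesis using sq2k by (simp add: field_simps)
  qed
  \<comment> \<open>The derivative of \<open>1 / sqrt (2 * F)\<close> is
    \<open>(k - W1) / sqrt (2 * F) ^ 3\<close>, with \<open>W1 \<le> 0\<close> and
    \<open>F \<le> M\<close> on the values in question.\<close>
  have "k / sqrt (2 * M) ^ 3 * (u x - u y) \<le> 1 / q - 1 / q'"
  proof -
    define h where "h = (\<lambda>s. 1 / sqrt (2 * F s) - k / sqrt (2 * M) ^ 3 * s)"
    have "h (u y) \<le> h (u x)"
    proof (rule DERIV_nonneg_imp_nondecreasing[of "u y" "u x" h])
      fix z assume z: "u y \<le> z" "z \<le> u x"
      have z0: "0 < z" "z \<le> 1" using z u_pos[OF yO] u01[OF xc] by auto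
      define Q where "Q = sqrt (2 * F z)"
      have Fz: "0 < F z" "F z \<le> M" using pF FM z0 by auto
      have Q: "0 < Q" "Q \<le> sqrt (2 * M)" using Fz by (auto simp: Q_def)
      have "(F has_real_derivative W1 z - k) (at z)"
        unfolding F_def by (rule outer_potential_deriv[OF z0(1)])
      from DERIV_diff[OF inverse_sqrt_has_derivative[OF this Fz(1)]
          DERIV_cmult[OF DERIV_ident, of "k / sqrt (2 * M) ^ 3"]]
      have "(h has_real_derivative - (W1 z - k) / Q ^ 3 - k / sqrt (2 * M) ^ 3) (at z)"
        unfolding h_def Q_def by simp
      moreover have "k / sqrt (2 * M) ^ 3 \<le> - (W1 z - k) / Q ^ 3"
        using W1_nonpos[of z] z0 k Q by (intro frac_le power_mono zero_less_power) auto
      ultimately show "\<exists>d. (h has_real_derivative d) (at z) \<and> 0 \<le> d" by fastforce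
    qed (use uxy in simp)
    then show ?thesis unfolding h_def q_def q'_def right_diff_distrib by linarith
  qed
  then have "k * (k / sqrt (2 * M) ^ 3 * (u x - u y)) \<le> k * (1 / q - 1 / q')"
    using k by (intro mult_left_mono) auto
  moreover have "\<epsilon> \<le> k * (k / sqrt (2 * M) ^ 3 * (u x - u y))"
    unfolding \<epsilon>_def mult.assoc using udiff k sq2M by (intro mult_left_mono) auto
  moreover have "k * (1 / q - 1 / q') = k / q - k / q'" by (simp add: right_diff_distrib)
  ultimately show False using upper by linarith
qed

section \<open>Modica's inequality and the strict bound on the solution\<close>

lemma Du_bound:
  assumes x: "x \<in> \<Omega>"
  shows "(norm (Du x))\<^sup>2 \<le> 2 * W (u x)"
proof -
  have xc: "x \<in> closure \<Omega>" using x closure_subset by blast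
  have u01: "0 < u x" "u x \<le> 1" using u_pos[OF x] u_le_1[OF xc] by auto
  have le: "(norm (Du x))\<^sup>2 \<le> 2 * W (u x) + 6 * k" if k: "0 < k" for k
  proof (cases "Du x = 0")
    case True
    then show ?thesis using W_nonneg[of "u x"] u01 k by simp
  next
    case False
    define F where "F = outer_potential k"
    have cF: "continuous_on {0..2} F" unfolding F_def by (rule outer_potential_continuous) auto
    have pF: "0 < F t" if "0 \<le> t" "t \<le> 2" for t
      unfolding F_def using outer_potential_lower[OF k that] k by simp
    define v where "v = (1 / norm (Du x)) *\<^sub>R Du x"
    have v: "norm v = 1" "Du x \<bullet> v = norm (Du x)"
      using False by (auto simp: v_def power2_norm_eq_inner[symmetric] power2_eq_square)
    define q where "q = sqrt (2 * F (u x))"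
    have q: "0 < q" "q\<^sup>2 = 2 * F (u x)" unfolding q_def using pF[of "u x"] u01 by auto
    \<comment> \<open>By the two-point estimate \<open>h\<close> has a minimum over small
      \<open>t \<ge> 0\<close> at 0, and its derivative there is
      \<open>1 - norm (Du x) / q\<close>.\<close>
    define h where "h = (\<lambda>t. t - arclen F (u (x + t *\<^sub>R v)))"
    have "((\<lambda>t. u (x + t *\<^sub>R v)) has_real_derivative Du (x + 0 *\<^sub>R v) \<bullet> v) (at 0)"
      by (rule u_chain) (use x line_has_vector_derivative in auto)
    moreover have "(arclen F has_real_derivative 1 / q) (at (u (x + 0 *\<^sub>R v)))"
      unfolding q_def using arclen_has_derivative[OF cF pF, of "u x"] u01 by simp
    ultimately have D: "(h has_real_derivative 1 - 1 / q * norm (Du x)) (at 0)"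
      unfolding h_def using v by (auto intro!: derivative_eq_intros DERIV_chain2[of "arclen F"])
    have "\<not> 1 - 1 / q * norm (Du x) < 0"
    proof
      assume "1 - 1 / q * norm (Du x) < 0"
      from DERIV_neg_dec_right[OF D this] obtain d where
        d: "0 < d" "\<And>t. 0 < t \<Longrightarrow> t < d \<Longrightarrow> h (0 + t) < h 0" by blast
      have "continuous_on UNIV (\<lambda>t. x + t *\<^sub>R v)" by (intro continuous_intros)
      from open_vimage[OF open_\<Omega> this]
      have "\<forall>\<^sub>F t in nhds 0. t \<in> (\<lambda>t. x + t *\<^sub>R v) -` \<Omega>"
        by (rule eventually_nhds_in_open) (use x in simp)
      then obtain e where e: "0 < e" "\<And>t. \<bar>t\<bar> < e \<Longrightarrow> x + t *\<^sub>R v \<in> \<Omega>"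
        unfolding eventually_nhds_metric by (auto simp: dist_real_def)
      define t where "t = min d e / 2"
      have t: "0 < t" "t < d" "t < e" using d e by (auto simp: t_def)
      have "x + t *\<^sub>R v \<in> closure \<Omega>" using e(2)[of t] t closure_subset by auto
      from two_point_estimate[OF k this xc]
      have "h 0 \<le> h t" using v t by (simp add: h_def F_def dist_norm)
      then show False using d(2)[of t] t by simp
    qed
    then have "norm (Du x) \<le> q" using q by (simp add: field_simps)
    then have "(norm (Du x))\<^sup>2 \<le> q\<^sup>2" by (intro power_mono) auto
    also have "\<dots> \<le> 2 * W (u x) + 6 * k"
    proof -
      have "k * (3 - u x) \<le> k * 3" using k u01 by (intro mult_left_mono) auto
      then show ?thesis unfolding q(2) F_def outer_potential_def by simp
    qed
    finally show ?thesis .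
  qed
  show ?thesis
  proof (rule field_le_epsilon)
    fix e :: real assume "0 < e"
    then show "(norm (Du x))\<^sup>2 \<le> 2 * W (u x) + e" using le[of "e / 6"] by simp
  qed
qed

text \<open>In place of a strong maximum principle, a Gronwall argument on the vertical ray from the
  boundary: Modica's inequality and the quadratic vanishing of \<open>W\<close> at 1 bound the
  derivative of \<open>u\<close> by \<open>K * (1 - u)\<close>, so
  \<open>(1 - u) * exp (K * t)\<close> does not decrease from its initial value 1.\<close>

lemma u_less_1:
  assumes x: "x \<in> closure \<Omega>"
  shows "u x < 1"
proof (cases "x \<in> \<Omega>")
  case False
  then show ?thesis using x u_frontier by (auto elim: closure_cases)
next
  case True
  obtain C where C: "0 < C" "\<And>s. 0 \<le> s \<Longrightarrow> s \<le> 1 \<Longrightarrow> W s \<le> C * (1 - s)\<^sup>2"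
    using W_bounds by blast
  define K where "K = sqrt (2 * C)"
  define T where "T = x$2 - \<phi> (x$1)"
  have T: "0 < T" using True by (simp add: T_def in_\<Omega>)
  define \<gamma> where "\<gamma> = (\<lambda>t. pt (x$1) (\<phi> (x$1) + t))"
  have \<gamma>: "\<gamma> T = x" by (simp add: \<gamma>_def T_def)
  have \<gamma>O: "\<gamma> t \<in> \<Omega>" if "0 < t" for t using that by (simp add: \<gamma>_def in_\<Omega>)
  have \<gamma>c: "\<gamma> t \<in> closure \<Omega>" if "0 \<le> t" for t using that by (simp add: \<gamma>_def in_closure)
  have \<gamma>d: "(\<gamma> has_vector_derivative pt 0 1) (at t)" for t
    unfolding \<gamma>_def by (rule pt_has_vector_derivative) (auto intro!: derivative_eq_intros)
  define h where "h = (\<lambda>t. (1 - u (\<gamma> t)) * exp (K * t))"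
  have "h 0 \<le> h T"
  proof (rule DERIV_nonneg_imp_increasing_open[of 0 T h])
    fix t assume t: "0 < t" "t < T"
    define D where "D = Du (\<gamma> t) \<bullet> pt 0 1"
    have ud: "((\<lambda>t. u (\<gamma> t)) has_real_derivative D) (at t)"
      unfolding D_def by (rule u_chain[OF \<gamma>O[OF t(1)] \<gamma>d])
    have "(h has_real_derivative (K * (1 - u (\<gamma> t)) - D) * exp (K * t)) (at t)"
      unfolding h_def by (auto intro!: derivative_eq_intros ud simp: algebra_simps)
    moreover have "D \<le> K * (1 - u (\<gamma> t))"
    proof -
      have u01: "0 \<le> u (\<gamma> t)" "u (\<gamma> t) \<le> 1" using u_nonneg u_le_1 \<gamma>c t by auto
      have "D \<le> norm (Du (\<gamma> t)) * norm (pt 0 1)" unfolding D_def by (rule norm_cauchy_schwarz)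
      also have "norm (pt 0 1) = 1" by (simp add: norm_real2)
      finally have "D \<le> norm (Du (\<gamma> t))" by simp
      also have "\<dots> \<le> sqrt (2 * W (u (\<gamma> t)))" by (rule real_le_rsqrt[OF Du_bound[OF \<gamma>O[OF t(1)]]])
      also have "\<dots> \<le> sqrt (2 * C * (1 - u (\<gamma> t))\<^sup>2)" using C(2)[OF u01] by simp
      also have "\<dots> = K * (1 - u (\<gamma> t))" using u01 by (simp add: K_def real_sqrt_mult)
      finally show ?thesis .
    qed
    ultimately show "\<exists>y. (h has_real_derivative y) (at t) \<and> 0 \<le> y" by fastforce
  next
    show "continuous_on {0..T} h"
      unfolding h_def \<gamma>_def
      by (intro continuous_intros continuous_on_compose2[OF u_continuous]) (auto simp: in_closure)
  qed (use T in simp)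
  moreover have "h 0 = 1" using u_frontier[of "\<gamma> 0"] by (simp add: h_def \<gamma>_def in_frontier)
  ultimately have "0 < h T" by simp
  then show ?thesis by (simp add: h_def \<gamma> zero_less_mult_iff)
qed

end

section \<open>The stress tensor\<close>

text \<open>Schwarz's theorem: the second difference over a small square of side \<open>h\<close> is
  \<open>h * h\<close> times either mixed derivative at some point of the square, and both are
  continuous at \<open>x\<close>.\<close>

lemma mixed_partials:
  assumes S: "open S" "x \<in> S" and C2: "Ck_on 2 S f"
  shows "partial 1 (partial 2 f) x = partial 2 (partial 1 f) x"
proof (rule ccontr)
  assume ne: "partial 1 (partial 2 f) x \<noteq> partial 2 (partial 1 f) x"
  have d: "f differentiable (at y)" "partial i f differentiable (at y)" if "y \<in> S" for y i
    using C2 that by (auto simp: numeral_2_eq_2)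
  have c: "continuous_on S (partial i (partial j f))" for i j
    using C2 by (auto simp: numeral_2_eq_2)
  define e where "e = \<bar>partial 1 (partial 2 f) x - partial 2 (partial 1 f) x\<bar> / 2"
  have e: "e > 0" using ne by (simp add: e_def)
  have near: "\<exists>d>0. \<forall>y. dist y x < d \<longrightarrow> y \<in> S \<and> \<bar>partial i (partial j f) y - partial i (partial j f) x\<bar> < e" for i j
  proof -
    have "isCont (partial i (partial j f)) x" using c S by (simp add: continuous_on_eq_continuous_at)
    then have "\<forall>\<^sub>F y in nhds x. dist (partial i (partial j f) y) (partial i (partial j f) x) < e"
      using e by (simp add: isCont_def tendsto_at_iff_tendsto_nhds tendstoD)
    with eventually_nhds_in_open[OF S]
    have "\<forall>\<^sub>F y in nhds x. y \<in> S \<and> \<bar>partial i (partial j f) y - partial i (partial j f) x\<bar> < e"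
      by eventually_elim (auto simp: dist_real_def)
    then show ?thesis unfolding eventually_nhds_metric by blast
  qed
  obtain d1 where d1: "d1 > 0" "\<And>y. dist y x < d1 \<Longrightarrow> y \<in> S \<and> \<bar>partial 1 (partial 2 f) y - partial 1 (partial 2 f) x\<bar> < e"
    using near[of 1 2] by blast
  obtain d2 where d2: "d2 > 0" "\<And>y. dist y x < d2 \<Longrightarrow> y \<in> S \<and> \<bar>partial 2 (partial 1 f) y - partial 2 (partial 1 f) x\<bar> < e"
    using near[of 2 1] by blast
  define h where "h = min d1 d2 / 3"
  have h: "0 < h" "2 * h < d1" "2 * h < d2" using d1 d2 by (auto simp: h_def)
  have close: "dist (pt (x$1 + a) (x$2 + b)) x \<le> 2 * h" if "0 \<le> a" "a \<le> h" "0 \<le> b" "b \<le> h" for a b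
  proof -
    have "dist (pt (x$1 + a) (x$2 + b)) x \<le> \<bar>a\<bar> + \<bar>b\<bar>"
      using sqrt_sum_squares_le_sum_abs[of a b] by (simp add: dist_norm norm_real2)
    then show ?thesis using that by simp
  qed
  have inS: "pt (x$1 + a) (x$2 + b) \<in> S" if "0 \<le> a" "a \<le> h" "0 \<le> b" "b \<le> h" for a b
    using d1(2)[of "pt (x$1 + a) (x$2 + b)"] close[OF that] h by auto
  define p where "p = (\<lambda>a b. pt (x$1 + a) (x$2 + b))"
  have pS: "p a b \<in> S" if "0 \<le> a" "a \<le> h" "0 \<le> b" "b \<le> h" for a b
    using inS[OF that] by (simp add: p_def)
  have D1: "((\<lambda>a. g (p a b)) has_real_derivative partial 1 g (p a b)) (at a)"
    if "g differentiable (at (p a b))" for g a b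
  proof -
    have "((\<lambda>a. p a b) has_vector_derivative pt 1 0) (at a)"
      unfolding p_def by (rule pt_has_vector_derivative) (auto intro!: derivative_eq_intros)
    from grad_chain[OF that this] show ?thesis by (simp add: inner_real2 grad_nth)
  qed
  have D2: "((\<lambda>b. g (p a b)) has_real_derivative partial 2 g (p a b)) (at b)"
    if "g differentiable (at (p a b))" for g a b
  proof -
    have "((\<lambda>b. p a b) has_vector_derivative pt 0 1) (at b)"
      unfolding p_def by (rule pt_has_vector_derivative) (auto intro!: derivative_eq_intros)
    from grad_chain[OF that this] show ?thesis by (simp add: inner_real2 grad_nth)
  qed
  define \<Delta> where "\<Delta> = f (p h h) - f (p h 0) - f (p 0 h) + f (p 0 0)"
  have "\<exists>a. 0 < a \<and> a < h \<and> (f (p h h) - f (p h 0)) - (f (p 0 h) - f (p 0 0)) =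
      (h - 0) * (partial 1 f (p a h) - partial 1 f (p a 0))"
    by (rule MVT2[OF h(1), of "\<lambda>a. f (p a h) - f (p a 0)"])
      (intro DERIV_diff D1 d pS; use h in simp)
  then obtain a where a: "0 < a" "a < h" "\<Delta> = h * (partial 1 f (p a h) - partial 1 f (p a 0))"
    by (auto simp: \<Delta>_def)
  have "\<exists>b. 0 < b \<and> b < h \<and> partial 1 f (p a h) - partial 1 f (p a 0) = (h - 0) * partial 2 (partial 1 f) (p a b)"
    by (rule MVT2[OF h(1)]) (intro D2 d pS; use a in simp)
  then obtain b where b: "0 < b" "b < h" "\<Delta> = h * (h * partial 2 (partial 1 f) (p a b))"
    using a(3) by auto
  have "\<exists>b. 0 < b \<and> b < h \<and> (f (p h h) - f (p 0 h)) - (f (p h 0) - f (p 0 0)) =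
      (h - 0) * (partial 2 f (p h b) - partial 2 f (p 0 b))"
    by (rule MVT2[OF h(1), of "\<lambda>b. f (p h b) - f (p 0 b)"])
      (intro DERIV_diff D2 d pS; use h in simp)
  then obtain b' where b': "0 < b'" "b' < h" "\<Delta> = h * (partial 2 f (p h b') - partial 2 f (p 0 b'))"
    by (auto simp: \<Delta>_def)
  have "\<exists>a. 0 < a \<and> a < h \<and> partial 2 f (p h b') - partial 2 f (p 0 b') = (h - 0) * partial 1 (partial 2 f) (p a b')"
    by (rule MVT2[OF h(1)]) (intro D1 d pS; use b' in simp)
  then obtain a' where a': "0 < a'" "a' < h" "\<Delta> = h * (h * partial 1 (partial 2 f) (p a' b'))"
    using b'(3) by auto
  have eq: "partial 2 (partial 1 f) (p a b) = partial 1 (partial 2 f) (p a' b')"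
    using a'(3) b(3) h(1) by simp
  have "\<bar>partial 2 (partial 1 f) (p a b) - partial 2 (partial 1 f) x\<bar> < e"
    using d2(2)[of "p a b"] close[of a b] a b h by (auto simp: p_def)
  moreover have "\<bar>partial 1 (partial 2 f) (p a' b') - partial 1 (partial 2 f) x\<bar> < e"
    using d1(2)[of "p a' b'"] close[of a' b'] a' b' h by (auto simp: p_def)
  moreover have "\<bar>partial 1 (partial 2 f) x - partial 2 (partial 1 f) x\<bar> \<le>
      \<bar>partial 2 (partial 1 f) (p a b) - partial 2 (partial 1 f) x\<bar> +
      \<bar>partial 1 (partial 2 f) (p a' b') - partial 1 (partial 2 f) x\<bar>"
    unfolding eq by simp
  ultimately show False unfolding e_def by simp
qed

context overdetermined
begin

abbreviation Hess :: "2 \<Rightarrow> 2 \<Rightarrow> real^2 \<Rightarrow> real" where "Hess i j \<equiv> partial i (partial j u)"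

text \<open>The entries of the stress tensor \<open>(\<bar>\<nabla>u\<bar>\<^sup>2 / 2 + W(u)) I - \<nabla>u \<otimes> \<nabla>u\<close>.\<close>

definition T11 :: "real^2 \<Rightarrow> real"
  where "T11 x = ((Du x $ 2)\<^sup>2 - (Du x $ 1)\<^sup>2) / 2 + W (u x)"
definition T22 :: "real^2 \<Rightarrow> real"
  where "T22 x = ((Du x $ 1)\<^sup>2 - (Du x $ 2)\<^sup>2) / 2 + W (u x)"
definition T12 :: "real^2 \<Rightarrow> real"
  where "T12 x = - (Du x $ 1 * Du x $ 2)"

text \<open>\<open>dT11 j\<close>, \<open>dT22 j\<close> and \<open>dT12 j\<close> are the
  \<open>j\<close>-th partial derivatives of the entries. Written out, they are visibly continuous
  in \<Omega>, as differentiation under the integral demands.\<close>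

definition dT11 :: "2 \<Rightarrow> real^2 \<Rightarrow> real"
  where "dT11 j x = Du x $ 2 * Hess j 2 x - Du x $ 1 * Hess j 1 x + W1 (u x) * Du x $ j"
definition dT22 :: "2 \<Rightarrow> real^2 \<Rightarrow> real"
  where "dT22 j x = Du x $ 1 * Hess j 1 x - Du x $ 2 * Hess j 2 x + W1 (u x) * Du x $ j"
definition dT12 :: "2 \<Rightarrow> real^2 \<Rightarrow> real"
  where "dT12 j x = - (Hess j 1 x * Du x $ 2 + Du x $ 1 * Hess j 2 x)"

lemma W_u_continuous: "continuous_on (closure \<Omega>) (\<lambda>x. W (u x))"
  by (rule continuous_on_compose2[OF W_continuous u_continuous]) (use u_nonneg in auto)

lemma T_continuous: "continuous_on (closure \<Omega>) T11" "continuous_on (closure \<Omega>) T22"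
  "continuous_on (closure \<Omega>) T12"
  unfolding T11_def[abs_def] T22_def[abs_def] T12_def[abs_def]
  by (intro continuous_intros W_u_continuous Du(1); simp)+

lemma Hess_continuous: "continuous_on \<Omega> (Hess i j)"
  using C2 by (auto simp: numeral_2_eq_2)

lemma Du_continuous_\<Omega>: "continuous_on \<Omega> Du"
  by (rule continuous_on_subset[OF Du(1) closure_subset])

lemma W1_u_continuous: "continuous_on \<Omega> (\<lambda>x. W1 (u x))"
  by (rule continuous_on_compose2[OF W1_continuous continuous_on_subset[OF u_continuous closure_subset]])
    (use u_pos in \<open>auto intro: less_imp_le\<close>)

lemma dT_continuous: "continuous_on \<Omega> (dT11 j)" "continuous_on \<Omega> (dT22 j)"
  "continuous_on \<Omega> (dT12 j)"
  unfolding dT11_def[abs_def] dT22_def[abs_def] dT12_def[abs_def]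
  by (intro continuous_intros W1_u_continuous Hess_continuous Du_continuous_\<Omega>)+

lemma Du_chain:
  assumes "\<gamma> t \<in> \<Omega>" "(\<gamma> has_vector_derivative v) (at t)"
  shows "((\<lambda>t. Du (\<gamma> t) $ i) has_real_derivative Hess 1 i (\<gamma> t) * v$1 + Hess 2 i (\<gamma> t) * v$2) (at t)"
proof -
  have "partial i u differentiable (at (\<gamma> t))"
    using C2 assms(1) by (auto simp: numeral_2_eq_2)
  from grad_chain[OF this assms(2)]
  have D: "((\<lambda>t. partial i u (\<gamma> t)) has_real_derivative Hess 1 i (\<gamma> t) * v$1 + Hess 2 i (\<gamma> t) * v$2) (at t)"
    by (simp add: inner_real2 grad_nth)
  have "isCont \<gamma> t"
    using has_derivative_continuous[OF assms(2)[unfolded has_vector_derivative_def]] .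
  then have "(\<gamma> \<longlongrightarrow> \<gamma> t) (nhds t)" by (simp add: isCont_def tendsto_at_iff_tendsto_nhds)
  from topological_tendstoD[OF this open_\<Omega> assms(1)]
  have ev: "\<forall>\<^sub>F s in nhds t. Du (\<gamma> s) $ i = partial i u (\<gamma> s)"
    by eventually_elim (rule Du_nth)
  show ?thesis using DERIV_cong_ev[OF refl ev refl] D by simp
qed

lemma T_chain:
  assumes "\<gamma> t \<in> \<Omega>" "(\<gamma> has_vector_derivative v) (at t)"
  shows "((\<lambda>t. T11 (\<gamma> t)) has_real_derivative dT11 1 (\<gamma> t) * v$1 + dT11 2 (\<gamma> t) * v$2) (at t)"
    "((\<lambda>t. T22 (\<gamma> t)) has_real_derivative dT22 1 (\<gamma> t) * v$1 + dT22 2 (\<gamma> t) * v$2) (at t)"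
    "((\<lambda>t. T12 (\<gamma> t)) has_real_derivative dT12 1 (\<gamma> t) * v$1 + dT12 2 (\<gamma> t) * v$2) (at t)"
proof -
  have W: "((\<lambda>t. W (u (\<gamma> t))) has_real_derivative W1 (u (\<gamma> t)) * (Du (\<gamma> t) \<bullet> v)) (at t)"
    by (rule DERIV_chain2[OF W_deriv[OF u_pos[OF assms(1)]] u_chain[OF assms]])
  note D = Du_chain[OF assms]
  show "((\<lambda>t. T11 (\<gamma> t)) has_real_derivative dT11 1 (\<gamma> t) * v$1 + dT11 2 (\<gamma> t) * v$2) (at t)"
    unfolding T11_def dT11_def
    by (rule derivative_eq_intros D W refl | simp)+ (simp add: inner_real2 field_simps)
  show "((\<lambda>t. T22 (\<gamma> t)) has_real_derivative dT22 1 (\<gamma> t) * v$1 + dT22 2 (\<gamma> t) * v$2) (at t)"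
    unfolding T22_def dT22_def
    by (rule derivative_eq_intros D W refl | simp)+ (simp add: inner_real2 field_simps)
  show "((\<lambda>t. T12 (\<gamma> t)) has_real_derivative dT12 1 (\<gamma> t) * v$1 + dT12 2 (\<gamma> t) * v$2) (at t)"
    unfolding T12_def dT12_def
    by (rule derivative_eq_intros D W refl | simp)+ (simp add: inner_real2 field_simps)
qed

text \<open>By symmetry of the Hessian, each sum is a component of the gradient times W'(u) minus
  the Laplacian of \<open>u\<close>.\<close>

lemma divergence_free:
  assumes "x \<in> \<Omega>"
  shows "dT11 1 x + dT12 2 x = 0" "dT12 1 x + dT22 2 x = 0"
proof -
  have m: "Hess 1 2 x = Hess 2 1 x" by (rule mixed_partials[OF open_\<Omega> assms C2])
  have l: "Hess 1 1 x = W1 (u x) - Hess 2 2 x" using laplacian_sum[OF assms] by simp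
  show "dT11 1 x + dT12 2 x = 0" "dT12 1 x + dT22 2 x = 0"
    unfolding dT11_def dT12_def dT22_def m l by (simp_all add: algebra_simps)
qed

text \<open>For the function \<open>\<Psi>\<close> described at the beginning, \<open>hflux m\<close>, \<open>vflux m\<close> and \<open>lflux m\<close> are the derivatives of
  \<open>\<nabla>\<Psi> \<bullet> (1, m)\<close> in the directions \<open>(1, 0)\<close>, \<open>(0, 1)\<close> and \<open>(1, m)\<close>.\<close>

definition vflux :: "real \<Rightarrow> real^2 \<Rightarrow> real"
  where "vflux m x = m * T11 x - T12 x"
definition hflux :: "real \<Rightarrow> real^2 \<Rightarrow> real"
  where "hflux m x = T22 x - m * T12 x"
definition lflux :: "real \<Rightarrow> real^2 \<Rightarrow> real"
  where "lflux m x = T22 x - 2 * m * T12 x + m\<^sup>2 * T11 x"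

lemma lflux_eq: "lflux m x = hflux m x + m * vflux m x"
  by (simp add: lflux_def hflux_def vflux_def power2_eq_square algebra_simps)

lemma vflux_hflux_continuous: "continuous_on (closure \<Omega>) (vflux m)" "continuous_on (closure \<Omega>) (hflux m)"
  unfolding vflux_def[abs_def] hflux_def[abs_def] by (intro continuous_intros T_continuous)+

text \<open>Since \<open>\<bar>\<nabla>u\<bar>\<^sup>2 = slope\<^sup>2 = 2 * W 0\<close> on the boundary, the normal component of the tensor vanishes there.\<close>

lemma boundary_flux:
  "hflux m (pt s (\<phi> s)) + \<phi>' s * vflux m (pt s (\<phi> s)) = 0"
proof -
  define x where "x = pt s (\<phi> s)"
  have x: "x \<in> frontier \<Omega>" by (simp add: x_def in_frontier)
  define a where "a = Du x $ 1"
  define b where "b = Du x $ 2"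
  have a: "a = - b * \<phi>' s"
    using tangential_component[of s] by (simp add: inner_real2 a_def b_def x_def)
  have "a\<^sup>2 + b\<^sup>2 = slope\<^sup>2"
    using norm_Du_frontier[OF x] norm_real2[of "Du x"] by (simp add: a_def b_def real_sqrt_eq_iff)
      (metis abs_of_nonneg power2_abs real_sqrt_ge_zero real_sqrt_pow2 sum_power2_ge_zero)
  then have W0: "W (u x) = (a\<^sup>2 + b\<^sup>2) / 2" using slope_eq u_frontier[OF x] by simp
  show ?thesis
    unfolding x_def[symmetric] hflux_def vflux_def T11_def T12_def T22_def W0 a_def[symmetric] b_def[symmetric]
    unfolding a by (simp add: power2_eq_square field_simps)
qed

text \<open>Second derivatives of \<open>u\<close> need not extend to the boundary, so the integral
  starts at height \<epsilon> above it. Rescaled to \<open>\<theta> \<in> {0..1}\<close> it can be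
  differentiated under the integral sign. Because the tensor is divergence free, the new integrand
  is the \<theta>-derivative of \<open>K\<close>, and only end point terms remain.\<close>

lemma shifted_flux_derivative:
  assumes e: "0 < \<epsilon>" and s0: "\<phi> s0 + \<epsilon> < m * s0 + c"
  defines "p \<equiv> pt s0 (\<phi> s0 + \<epsilon>)"
  shows "((\<lambda>s. integral {\<phi> s + \<epsilon>..m * s + c} (\<lambda>t. vflux m (pt s t))) has_real_derivative
    lflux m (pt s0 (m * s0 + c)) - (hflux m p + \<phi>' s0 * vflux m p)) (at s0)"
proof -
  define h where "h = (\<lambda>s. m * s + c - \<phi> s - \<epsilon>)"
  define h' where "h' = (\<lambda>s. m - \<phi>' s)"
  have hd: "(h has_real_derivative h' s) (at s)" for s
    unfolding h_def h'_def by (auto intro!: derivative_eq_intros \<phi>_deriv)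
  have hc: "continuous_on A h" for A unfolding h_def by (intro continuous_intros \<phi>_continuous)
  have h'c: "continuous_on A h'" for A unfolding h'_def by (intro continuous_intros \<phi>'_continuous)
  have "open {s. 0 < h s}" by (intro open_Collect_less continuous_intros hc)
  moreover have "0 < h s0" using s0 by (simp add: h_def)
  ultimately obtain r where r: "0 < r" "ball s0 r \<subseteq> {s. 0 < h s}"
    using open_contains_ball by blast
  have hpos: "0 < h s" if "s \<in> ball s0 r" for s using r(2) that by auto
  define P where "P = (\<lambda>s \<theta>. pt s (\<phi> s + \<epsilon> + \<theta> * h s))"
  have PO: "P s \<theta> \<in> \<Omega>" if "s \<in> ball s0 r" "0 \<le> \<theta>" for s \<theta>
    using hpos[OF that(1)] that(2) e by (simp add: P_def in_\<Omega> add_pos_nonneg)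
  have subst: "integral {\<phi> s + \<epsilon>..m * s + c} (\<lambda>t. vflux m (pt s t)) = integral {0..1} (\<lambda>\<theta>. h s * vflux m (P s \<theta>))"
    if s: "s \<in> ball s0 r" for s
  proof -
    let ?g = "\<lambda>\<theta>. \<phi> s + \<epsilon> + \<theta> * h s"
    have g1: "?g 1 = m * s + c" by (simp add: h_def)
    have "((\<lambda>\<theta>. h s *\<^sub>R vflux m (pt s (?g \<theta>))) has_integral (integral {?g 0..?g 1} (\<lambda>t. vflux m (pt s t)))) {0..1}"
    proof (rule has_integral_substitution)
      show "?g 0 \<le> ?g 1" using hpos[OF s] by simp
      show "?g ` {0..1} \<subseteq> {\<phi> s + \<epsilon>..?g 1}"
        using hpos[OF s] by (auto simp: mult_left_le_one_le)
      show "continuous_on {\<phi> s + \<epsilon>..?g 1} (\<lambda>t. vflux m (pt s t))"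
        by (intro continuous_intros continuous_on_compose2[OF vflux_hflux_continuous(1)])
          (use e in \<open>auto simp: in_closure\<close>)
    qed (auto intro!: derivative_eq_intros)
    from integral_unique[OF this] show ?thesis unfolding g1 P_def by simp
  qed
  define fx where "fx = (\<lambda>s \<theta>. h' s * vflux m (P s \<theta>) + h s *
      ((m * dT11 1 (P s \<theta>) - dT12 1 (P s \<theta>)) + (m * dT11 2 (P s \<theta>) - dT12 2 (P s \<theta>)) * (\<phi>' s + \<theta> * h' s)))"
  have Pc: "continuous_on (ball s0 r \<times> cbox 0 1) (\<lambda>z. P (fst z) (snd z))"
    unfolding P_def by (intro continuous_intros continuous_on_compose2[OF \<phi>_continuous[of UNIV]]
        continuous_on_compose2[OF hc[of UNIV]]) auto
  have Pin: "(\<lambda>z. P (fst z) (snd z)) ` (ball s0 r \<times> cbox 0 1) \<subseteq> \<Omega>"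
    using PO by auto
  have Lei: "((\<lambda>s. integral (cbox 0 1) (\<lambda>\<theta>. h s * vflux m (P s \<theta>))) has_real_derivative
      integral (cbox 0 1) (fx s0)) (at s0 within ball s0 r)"
  proof (rule leibniz_rule_field_derivative)
    fix s \<theta> :: real assume s: "s \<in> ball s0 r" and t: "\<theta> \<in> cbox 0 1"
    have "((\<lambda>s. P s \<theta>) has_vector_derivative pt 1 (\<phi>' s + \<theta> * h' s)) (at s)"
      unfolding P_def by (rule pt_has_vector_derivative) (auto intro!: derivative_eq_intros \<phi>_deriv hd)
    note T = T_chain[OF PO[OF s] this]
    have "((\<lambda>s. h s * vflux m (P s \<theta>)) has_real_derivative fx s \<theta>) (at s)"
      unfolding vflux_def fx_def using t
      by (auto intro!: derivative_eq_intros T hd simp: algebra_simps)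
    then show "((\<lambda>s. h s * vflux m (P s \<theta>)) has_real_derivative fx s \<theta>) (at s within ball s0 r)"
      by (rule has_field_derivative_at_within)
  next
    fix s assume s: "s \<in> ball s0 r"
    have "continuous_on (cbox 0 1) (\<lambda>\<theta>. h s * vflux m (P s \<theta>))"
      unfolding P_def
      by (intro continuous_intros continuous_on_compose2[OF vflux_hflux_continuous(1)])
        (use PO[OF s] closure_subset[of \<Omega>] in \<open>auto simp: P_def\<close>)
    then show "(\<lambda>\<theta>. h s * vflux m (P s \<theta>)) integrable_on cbox 0 1" by (rule integrable_continuous)
  next
    have S': "continuous_on \<Omega> (vflux m)" by (rule continuous_on_subset[OF vflux_hflux_continuous(1) closure_subset])
    note comp = continuous_on_compose2[OF _ Pc Pin]
    have "continuous_on (ball s0 r \<times> cbox 0 1) (\<lambda>z. fx (fst z) (snd z))"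
      unfolding fx_def
      by (intro continuous_intros comp[OF S'] comp[OF dT_continuous(1)] comp[OF dT_continuous(3)]
          continuous_on_compose2[OF h'c[of UNIV]] continuous_on_compose2[OF hc[of UNIV]]
          continuous_on_compose2[OF \<phi>'_continuous[of UNIV]]) auto
    then show "continuous_on (ball s0 r \<times> cbox 0 1) (\<lambda>(s, \<theta>). fx s \<theta>)"
      by (simp add: split_def)
  qed (use r in auto)
  have s0r: "s0 \<in> ball s0 r" using r by simp
  have "((\<lambda>s. integral {0..1} (\<lambda>\<theta>. h s * vflux m (P s \<theta>))) has_real_derivative integral {0..1} (fx s0)) (at s0)"
    using Lei at_within_open[OF s0r open_ball] by (simp add: cbox_interval)
  then have D: "((\<lambda>s. integral {\<phi> s + \<epsilon>..m * s + c} (\<lambda>t. vflux m (pt s t))) has_real_derivative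
      integral {0..1} (fx s0)) (at s0)"
    by (rule has_field_derivative_transform_within_open[OF _ open_ball s0r]) (simp add: subst)
  \<comment> \<open>The flux through the curve interpolating between the lifted boundary at
    \<open>\<theta> = 0\<close> and the line at \<open>\<theta> = 1\<close>; the coefficient of
    \<open>vflux\<close> is the slope of that curve.\<close>
  define K where "K = (\<lambda>\<theta>. hflux m (P s0 \<theta>) + (\<phi>' s0 + \<theta> * h' s0) * vflux m (P s0 \<theta>))"
  have "(fx s0 has_integral (K 1 - K 0)) {0..1}"
  proof (rule fundamental_theorem_of_calculus)
    fix \<theta> :: real assume t: "\<theta> \<in> {0..1}"
    then have PO': "P s0 \<theta> \<in> \<Omega>" using PO[OF s0r] by simp
    have "((\<lambda>\<theta>. P s0 \<theta>) has_vector_derivative pt 0 (h s0)) (at \<theta>)"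
      unfolding P_def by (rule pt_has_vector_derivative) (auto intro!: derivative_eq_intros)
    note T = T_chain[OF PO' this]
    have "(K has_real_derivative (dT22 2 (P s0 \<theta>) - m * dT12 2 (P s0 \<theta>)) * h s0 + (h' s0 * vflux m (P s0 \<theta>) +
        (\<phi>' s0 + \<theta> * h' s0) * ((m * dT11 2 (P s0 \<theta>) - dT12 2 (P s0 \<theta>)) * h s0))) (at \<theta>)"
      unfolding K_def hflux_def vflux_def by (auto intro!: derivative_eq_intros T simp: algebra_simps)
    moreover have "dT22 2 (P s0 \<theta>) - m * dT12 2 (P s0 \<theta>) = m * dT11 1 (P s0 \<theta>) - dT12 1 (P s0 \<theta>)"
    proof -
      have "dT22 2 (P s0 \<theta>) = - dT12 1 (P s0 \<theta>)" "dT12 2 (P s0 \<theta>) = - dT11 1 (P s0 \<theta>)"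
        using divergence_free[OF PO'] by linarith+
      then show ?thesis by simp
    qed
    ultimately have "(K has_real_derivative fx s0 \<theta>) (at \<theta>)"
      by (simp add: fx_def algebra_simps)
    then show "(K has_vector_derivative fx s0 \<theta>) (at \<theta> within {0..1})"
      by (simp add: has_real_derivative_iff_has_vector_derivative has_vector_derivative_at_within)
  qed simp
  then have "integral {0..1} (fx s0) = K 1 - K 0" by (rule integral_unique)
  moreover have "K 1 = lflux m (pt s0 (m * s0 + c))"
    by (simp add: K_def lflux_eq P_def h_def h'_def)
  moreover have "K 0 = hflux m p + \<phi>' s0 * vflux m p"
    by (simp add: K_def P_def p_def)
  ultimately show ?thesis using D by simp
qed

end

section \<open>Concavity of the boundary\<close>

lemma last_zero:
  fixes h :: "real \<Rightarrow> real"
  assumes "a < t" "continuous_on {a..t} h" "h a \<le> 0" "0 < h t"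
  obtains a' where "a \<le> a'" "a' < t" "h a' = 0" "\<And>s. a' < s \<Longrightarrow> s \<le> t \<Longrightarrow> 0 < h s"
proof -
  define A where "A = {s \<in> {a..t}. h s \<le> 0}"
  have "closed A"
    unfolding A_def by (intro continuous_on_closed_Collect_le assms continuous_on_const closed_atLeastAtMost)
  moreover have "{a..t} \<inter> A = A" by (auto simp: A_def)
  ultimately have "compact A" using compact_Int_closed[OF compact_Icc[of a t], of A] by simp
  moreover have "a \<in> A" using assms by (simp add: A_def)
  ultimately obtain a' where a': "a' \<in> A" "\<And>s. s \<in> A \<Longrightarrow> s \<le> a'"
    using compact_attains_sup[of A] by blast
  have pos: "0 < h s" if "a' < s" "s \<le> t" for s
    using a'(2)[of s] that a'(1) by (force simp: A_def not_le)
  have at: "a \<le> a'" "a' \<le> t" "h a' \<le> 0" using a'(1) by (auto simp: A_def)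
  then have lt: "a' < t" using assms(4) by (cases "a' = t") auto
  have "h a' = 0"
  proof (rule ccontr)
    assume "h a' \<noteq> 0"
    then have n: "h a' < 0" using at by simp
    have "\<exists>s\<ge>a'. s \<le> t \<and> h s = 0"
      by (rule IVT') (use n assms lt at in \<open>auto intro: continuous_on_subset[OF assms(2)]\<close>)
    then obtain s where "a' \<le> s" "s \<le> t" "h s = 0" by blast
    then show False using pos[of s] n by (cases "s = a'") auto
  qed
  then show ?thesis using that[of a'] at lt pos by blast
qed

lemma first_zero:
  fixes h :: "real \<Rightarrow> real"
  assumes "t < b" "continuous_on {t..b} h" "h b \<le> 0" "0 < h t"
  obtains b' where "t < b'" "b' \<le> b" "h b' = 0" "\<And>s. t \<le> s \<Longrightarrow> s < b' \<Longrightarrow> 0 < h s"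
proof -
  have "continuous_on {-b..-t} (\<lambda>s. h (- s))"
    by (rule continuous_on_compose2[OF assms(2)]) (auto intro: continuous_intros)
  then obtain a' where a': "- b \<le> a'" "a' < - t" "h (- a') = 0" "\<And>s. a' < s \<Longrightarrow> s \<le> - t \<Longrightarrow> 0 < h (- s)"
    using last_zero[of "-b" "-t" "\<lambda>s. h (- s)"] assms by auto
  have "0 < h s" if "t \<le> s" "s < - a'" for s using a'(4)[of "- s"] that by simp
  then show ?thesis using that[of "- a'"] a' by simp
qed

context overdetermined
begin

lemma norm_Du_bound:
  assumes "x \<in> closure \<Omega>"
  shows "(Du x $ 1)\<^sup>2 + (Du x $ 2)\<^sup>2 \<le> 2 * W (u x)"
proof -
  have "(norm (Du x))\<^sup>2 \<le> 2 * W (u x)"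
    using assms
  proof (cases rule: closure_cases)
    case 1
    then show ?thesis by (rule Du_bound)
  next
    case 2
    then show ?thesis using norm_Du_frontier[OF 2] u_frontier[OF 2] slope_eq by simp
  qed
  then show ?thesis by (simp add: norm_real2)
qed

lemma vflux_bound:
  assumes "x \<in> closure \<Omega>"
  shows "\<bar>vflux m x\<bar> \<le> (2 * \<bar>m\<bar> + 1) * W (u x)"
proof -
  define a where "a = Du x $ 1"
  define b where "b = Du x $ 2"
  have ab: "a\<^sup>2 + b\<^sup>2 \<le> 2 * W (u x)" using norm_Du_bound[OF assms] by (simp add: a_def b_def)
  have t11: "\<bar>T11 x\<bar> \<le> 2 * W (u x)"
  proof -
    have "\<bar>(q - p) / 2 + w\<bar> \<le> 2 * w" if "p + q \<le> 2 * w" "0 \<le> p" "0 \<le> q" for p q w :: real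
      using that by (auto simp: abs_le_iff field_simps)
    from this[OF ab] show ?thesis by (simp add: T11_def a_def b_def)
  qed
  have t12: "\<bar>T12 x\<bar> \<le> 1 * W (u x)"
  proof -
    have "2 * \<bar>a * b\<bar> \<le> a\<^sup>2 + b\<^sup>2"
      using zero_le_power2[of "\<bar>a\<bar> - \<bar>b\<bar>"] by (simp add: power2_diff abs_mult)
    then show ?thesis using ab by (simp add: T12_def a_def b_def)
  qed
  have "\<bar>vflux m x\<bar> \<le> \<bar>m\<bar> * \<bar>T11 x\<bar> + \<bar>T12 x\<bar>" unfolding vflux_def abs_mult[symmetric] by (rule abs_triangle_ineq4)
  also have "\<dots> \<le> \<bar>m\<bar> * (2 * W (u x)) + 1 * W (u x)"
    using t11 t12 by (intro add_mono mult_left_mono) auto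
  finally show ?thesis by (simp add: algebra_simps)
qed

text \<open>With \<open>a\<close> and \<open>b\<close> the components of the gradient,
  \<open>lflux m x\<close> is \<open>(1 + m\<^sup>2) * (W (u x) - (a\<^sup>2 + b\<^sup>2) / 2) + (a
  + m * b)\<^sup>2\<close>, and Modica's inequality makes the first term nonnegative.\<close>

lemma lflux_lower:
  assumes "x \<in> closure \<Omega>"
  shows "(Du x $ 1 + m * Du x $ 2)\<^sup>2 \<le> lflux m x"
proof -
  define a where "a = Du x $ 1"
  define b where "b = Du x $ 2"
  have ab: "a\<^sup>2 + b\<^sup>2 \<le> 2 * W (u x)" using norm_Du_bound[OF assms] by (simp add: a_def b_def)
  have "(1 + m\<^sup>2) * (a\<^sup>2 + b\<^sup>2) \<le> (1 + m\<^sup>2) * (2 * W (u x))"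
    using ab by (intro mult_left_mono) auto
  moreover have "lflux m x = (1 + m\<^sup>2) * W (u x) - (1 + m\<^sup>2) * (a\<^sup>2 + b\<^sup>2) / 2 + (a + m * b)\<^sup>2"
    unfolding lflux_def T11_def T22_def T12_def a_def[symmetric] b_def[symmetric]
    by (simp add: power2_eq_square field_simps)
  ultimately show ?thesis unfolding a_def[symmetric] b_def[symmetric] by simp
qed

lemma lflux_upper:
  assumes "x \<in> closure \<Omega>"
  shows "lflux m x \<le> 4 * (1 + m\<^sup>2) * W (u x)"
proof -
  define a where "a = Du x $ 1"
  define b where "b = Du x $ 2"
  have ab: "a\<^sup>2 + b\<^sup>2 \<le> 2 * W (u x)" using norm_Du_bound[OF assms] by (simp add: a_def b_def)
  have "(a + m * b)\<^sup>2 \<le> (1 + m\<^sup>2) * (a\<^sup>2 + b\<^sup>2)"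
    using zero_le_power2[of "m * a - b"] by (simp add: power2_eq_square algebra_simps)
  also have "\<dots> \<le> (1 + m\<^sup>2) * (2 * W (u x))" using ab by (intro mult_left_mono) auto
  finally have 1: "(a + m * b)\<^sup>2 \<le> 2 * ((1 + m\<^sup>2) * W (u x))" by simp
  have 2: "0 \<le> (1 + m\<^sup>2) * (a\<^sup>2 + b\<^sup>2)" by (intro mult_nonneg_nonneg add_nonneg_nonneg) auto
  have 3: "lflux m x = (1 + m\<^sup>2) * W (u x) - (1 + m\<^sup>2) * (a\<^sup>2 + b\<^sup>2) / 2 + (a + m * b)\<^sup>2"
    unfolding lflux_def T11_def T22_def T12_def a_def[symmetric] b_def[symmetric]
    by (simp add: power2_eq_square field_simps)
  have 4: "0 \<le> (1 + m\<^sup>2) * W (u x)"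
    using W_nonneg u_nonneg[OF assms] by (intro mult_nonneg_nonneg) auto
  show ?thesis using 1 2 3 4 unfolding mult.assoc by linarith
qed

text \<open>This is \<open>\<nabla>\<Psi> \<bullet> (1, m)\<close> at the point \<open>(s, y)\<close>.\<close>

definition flux :: "real \<Rightarrow> real \<Rightarrow> real \<Rightarrow> real"
  where "flux m s y = integral {\<phi> s..y} (\<lambda>t. vflux m (pt s t))"

lemma flux_below: "y \<le> \<phi> s \<Longrightarrow> flux m s y = 0"
  unfolding flux_def by (cases "y = \<phi> s") auto

lemma vflux_vertical_integrable:
  assumes "\<phi> s \<le> a"
  shows "(\<lambda>t. vflux m (pt s t)) integrable_on {a..b}"
  by (rule integrable_continuous_real)
    (intro continuous_intros continuous_on_compose2[OF vflux_hflux_continuous(1)], use assms in \<open>auto simp: in_closure\<close>)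

lemma flux_split:
  assumes "\<phi> s \<le> a" "a \<le> b"
  shows "flux m s b = flux m s a + integral {a..b} (\<lambda>t. vflux m (pt s t))"
  unfolding flux_def using Henstock_Kurzweil_Integration.integral_combine[OF assms vflux_vertical_integrable] by simp

lemma vflux_integral_bound:
  assumes "\<phi> s \<le> a" "a \<le> b" "\<And>t. a \<le> t \<Longrightarrow> t \<le> b \<Longrightarrow> \<bar>vflux m (pt s t)\<bar> \<le> B"
  shows "\<bar>integral {a..b} (\<lambda>t. vflux m (pt s t))\<bar> \<le> B * (b - a)"
proof -
  have "norm (integral {a..b} (\<lambda>t. vflux m (pt s t))) \<le> B * (b - a)"
    by (rule integral_bound[OF assms(2)])
      (use assms in \<open>auto intro!: continuous_intros continuous_on_compose2[OF vflux_hflux_continuous(1)] simp: in_closure\<close>)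
  then show ?thesis by simp
qed

lemma vflux_global_bound:
  assumes "\<phi> s \<le> t"
  shows "\<bar>vflux m (pt s t)\<bar> \<le> (2 * \<bar>m\<bar> + 1) * W 0"
proof -
  have x: "pt s t \<in> closure \<Omega>" using assms by (simp add: in_closure)
  have "W (u (pt s t)) \<le> W 0" using u_nonneg[OF x] u_le_1[OF x] by (intro W_antimono) auto
  then have "(2 * \<bar>m\<bar> + 1) * W (u (pt s t)) \<le> (2 * \<bar>m\<bar> + 1) * W 0" by (intro mult_left_mono) auto
  then show ?thesis using vflux_bound[OF x, of m] by linarith
qed

text \<open>The limit of \<open>shifted_flux_derivative\<close> as the lift tends to 0. The flux
  \<open>E\<close> through the lifted boundary is continuous up to the boundary and vanishes there
  by \<open>boundary_flux\<close>. Hence it tends to 0 uniformly near \<open>s0\<close>, and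
  differentiation commutes with the limit.\<close>

lemma flux_derivative:
  assumes s0: "\<phi> s0 < m * s0 + c"
  shows "((\<lambda>s. flux m s (m * s + c)) has_real_derivative lflux m (pt s0 (m * s0 + c))) (at s0)"
proof -
  \<comment> \<open>Half of the available height, so that all lifts up to \<delta> stay below the
    line for \<open>s\<close> near \<open>s0\<close>.\<close>
  define \<delta> where "\<delta> = (m * s0 + c - \<phi> s0) / 2"
  have \<delta>: "0 < \<delta>" using s0 by (simp add: \<delta>_def)
  have "open {s. \<phi> s + \<delta> < m * s + c}" by (intro open_Collect_less continuous_intros \<phi>_continuous)
  moreover have "\<phi> s0 + \<delta> < m * s0 + c" using s0 by (simp add: \<delta>_def field_simps)
  ultimately obtain r where r: "0 < r" "cball s0 r \<subseteq> {s. \<phi> s + \<delta> < m * s + c}"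
    using open_contains_cball by blast
  define E where "E = (\<lambda>s \<epsilon>. hflux m (pt s (\<phi> s + \<epsilon>)) + \<phi>' s * vflux m (pt s (\<phi> s + \<epsilon>)))"
  define f where "f = (\<lambda>n s. integral {\<phi> s + \<delta> / real (Suc n)..m * s + c} (\<lambda>t. vflux m (pt s t)))"
  have eps: "0 < \<delta> / real (Suc n)" "\<delta> / real (Suc n) \<le> \<delta>" for n
    using \<delta> by (auto simp: field_simps)
  have I: "\<phi> s + \<delta> / real (Suc n) < m * s + c" if "s \<in> cball s0 r" for s n
    using subsetD[OF r(2) that] eps(2)[of n] by simp
  have Ec: "continuous_on (cball s0 r \<times> {0..\<delta>}) (\<lambda>z. E (fst z) (snd z))"
    unfolding E_def
    by (intro continuous_intros continuous_on_compose2[OF vflux_hflux_continuous(1)]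
        continuous_on_compose2[OF vflux_hflux_continuous(2)] continuous_on_compose2[OF \<phi>_continuous[of UNIV]]
        continuous_on_compose2[OF \<phi>'_continuous[of UNIV]]) (auto simp: in_closure)
  have "uniformly_continuous_on (cball s0 r \<times> {0..\<delta>}) (\<lambda>z. E (fst z) (snd z))"
    by (intro compact_uniformly_continuous[OF Ec] compact_Times) auto
  have E0: "E s 0 = 0" for s unfolding E_def using boundary_flux[of m s] by simp
  have Esmall: "\<exists>d>0. \<forall>s \<epsilon>. s \<in> cball s0 r \<and> 0 \<le> \<epsilon> \<and> \<epsilon> \<le> \<delta> \<and> \<epsilon> < d \<longrightarrow> \<bar>E s \<epsilon>\<bar> < e" if e: "0 < e" for e
  proof -
    obtain d where d: "0 < d" "\<And>z z'. z \<in> cball s0 r \<times> {0..\<delta>} \<Longrightarrow> z' \<in> cball s0 r \<times> {0..\<delta>} \<Longrightarrow>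
        dist z' z < d \<Longrightarrow> dist (E (fst z') (snd z')) (E (fst z) (snd z)) < e"
      using \<open>uniformly_continuous_on _ _\<close> e unfolding uniformly_continuous_on_def by blast
    have "\<bar>E s \<epsilon>\<bar> < e" if "s \<in> cball s0 r" "0 \<le> \<epsilon>" "\<epsilon> \<le> \<delta>" "\<epsilon> < d" for s \<epsilon>
      using d(2)[of "(s, 0)" "(s, \<epsilon>)"] that \<delta> E0[of s] by (simp add: dist_Pair_Pair dist_real_def)
    then show ?thesis using d(1) by blast
  qed
  have to0: "(\<lambda>n. \<delta> / real (Suc n)) \<longlonglongrightarrow> 0"
    using LIMSEQ_Suc[OF lim_const_over_n[of \<delta>]] by simp
  have flim: "(\<lambda>n. f n s) \<longlonglongrightarrow> flux m s (m * s + c)" if s: "s \<in> cball s0 r" for s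
  proof (rule LIM_zero_cancel, rule Lim_null_comparison)
    show "\<forall>\<^sub>F n in sequentially. norm (f n s - flux m s (m * s + c)) \<le> (2 * \<bar>m\<bar> + 1) * W 0 * (\<delta> / real (Suc n))"
    proof (intro always_eventually allI)
      fix n
      define e where "e = \<delta> / real (Suc n)"
      have e: "0 < e" unfolding e_def by (rule eps)
      have "flux m s (m * s + c) = flux m s (\<phi> s + e) + f n s"
        unfolding f_def e_def[symmetric]
        by (rule flux_split) (use e I[OF s, of n] in \<open>auto simp: e_def\<close>)
      moreover have "flux m s (\<phi> s + e) = flux m s (\<phi> s) + integral {\<phi> s..\<phi> s + e} (\<lambda>t. vflux m (pt s t))"
        by (rule flux_split) (use e in auto)
      moreover have "\<bar>integral {\<phi> s..\<phi> s + e} (\<lambda>t. vflux m (pt s t))\<bar> \<le> (2 * \<bar>m\<bar> + 1) * W 0 * (\<phi> s + e - \<phi> s)"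
        by (rule vflux_integral_bound) (use e vflux_global_bound in auto)
      ultimately show "norm (f n s - flux m s (m * s + c)) \<le> (2 * \<bar>m\<bar> + 1) * W 0 * (\<delta> / real (Suc n))"
        by (simp add: flux_below e_def)
    qed
    show "(\<lambda>n. (2 * \<bar>m\<bar> + 1) * W 0 * (\<delta> / real (Suc n))) \<longlonglongrightarrow> 0"
      using tendsto_mult_left[OF to0, of "(2 * \<bar>m\<bar> + 1) * W 0"] by simp
  qed
  have s0r: "s0 \<in> cball s0 r" using r by simp
  have "\<exists>g. \<forall>x\<in>cball s0 r. (\<lambda>n. f n x) \<longlonglongrightarrow> g x \<and>
      (g has_derivative (\<lambda>h. lflux m (pt x (m * x + c)) * h)) (at x within cball s0 r)"
  proof (rule has_derivative_sequence[where f=f])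
    show "convex (cball s0 r)" "s0 \<in> cball s0 r" by (rule convex_cball, rule s0r)
    show "(\<lambda>n. f n s0) \<longlonglongrightarrow> flux m s0 (m * s0 + c)" by (rule flim[OF s0r])
    show "(f n has_derivative (\<lambda>h. (lflux m (pt x (m * x + c)) - E x (\<delta> / real (Suc n))) * h)) (at x within cball s0 r)"
      if x: "x \<in> cball s0 r" for n x
    proof -
      have "(f n has_real_derivative lflux m (pt x (m * x + c)) - E x (\<delta> / real (Suc n))) (at x)"
        unfolding f_def E_def by (rule shifted_flux_derivative[OF eps(1) I[OF x]])
      then show ?thesis
        unfolding has_field_derivative_def by (rule has_derivative_at_withinI)
    qed
    show "\<forall>\<^sub>F n in sequentially. \<forall>x\<in>cball s0 r. \<forall>h. norm ((lflux m (pt x (m * x + c)) - E x (\<delta> / real (Suc n))) * h -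
        lflux m (pt x (m * x + c)) * h) \<le> e * norm h" if e: "0 < e" for e
    proof -
      obtain d where d: "0 < d" "\<And>s \<epsilon>. s \<in> cball s0 r \<Longrightarrow> 0 \<le> \<epsilon> \<Longrightarrow> \<epsilon> \<le> \<delta> \<Longrightarrow> \<epsilon> < d \<Longrightarrow> \<bar>E s \<epsilon>\<bar> < e"
        using Esmall[OF e] by blast
      have "\<forall>\<^sub>F n in sequentially. \<delta> / real (Suc n) < d" using order_tendstoD(2)[OF to0 d(1)] .
      then show ?thesis
      proof eventually_elim
        case (elim n)
        show ?case
        proof (intro ballI allI)
          fix x h assume "x \<in> cball s0 r"
          then have "\<bar>E x (\<delta> / real (Suc n))\<bar> \<le> e" using d(2)[of x "\<delta> / real (Suc n)"] eps[of n] elim by auto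
          then have "\<bar>E x (\<delta> / real (Suc n))\<bar> * \<bar>h\<bar> \<le> e * \<bar>h\<bar>" by (rule mult_right_mono) simp
          moreover have "(lflux m (pt x (m * x + c)) - E x (\<delta> / real (Suc n))) * h -
              lflux m (pt x (m * x + c)) * h = - (E x (\<delta> / real (Suc n)) * h)" by (simp add: algebra_simps)
          ultimately show "norm ((lflux m (pt x (m * x + c)) - E x (\<delta> / real (Suc n))) * h -
              lflux m (pt x (m * x + c)) * h) \<le> e * norm h" by (simp only: real_norm_def abs_minus_cancel abs_mult)
        qed
      qed
    qed
  qed
  then obtain g where g: "\<And>x. x \<in> cball s0 r \<Longrightarrow> (\<lambda>n. f n x) \<longlonglongrightarrow> g x"
    "\<And>x. x \<in> cball s0 r \<Longrightarrow> (g has_derivative (\<lambda>h. lflux m (pt x (m * x + c)) * h)) (at x within cball s0 r)"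
    by blast
  have gJ: "g x = flux m x (m * x + c)" if "x \<in> cball s0 r" for x
    using LIMSEQ_unique[OF g(1)[OF that] flim[OF that]] .
  have at: "at s0 within cball s0 r = at s0"
    using r by (intro at_within_interior) simp
  have "(g has_derivative (\<lambda>h. lflux m (pt s0 (m * s0 + c)) * h)) (at s0)"
    using g(2)[OF s0r] unfolding at .
  then have "((\<lambda>s. flux m s (m * s + c)) has_derivative (\<lambda>h. lflux m (pt s0 (m * s0 + c)) * h)) (at s0)"
    by (rule has_derivative_transform_within_open[where s="ball s0 r"]) (use r gJ in auto)
  then show ?thesis by (simp add: has_field_derivative_def)
qed

text \<open>Only points where the line does not run above the graph need an argument: there the flux
  is 0, and nearby it is at most a constant times the height of the line above the graph.\<close>

lemma flux_line_continuous: "continuous_on A (\<lambda>s. flux m s (m * s + c))"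
proof -
  have "isCont (\<lambda>s. flux m s (m * s + c)) s" for s
  proof (cases "\<phi> s < m * s + c")
    case True
    then show ?thesis using flux_derivative DERIV_isCont by blast
  next
    case False
    then have J0: "flux m s (m * s + c) = 0" by (simp add: flux_below)
    define B where "B = (2 * \<bar>m\<bar> + 1) * W 0"
    have le: "norm (flux m t (m * t + c)) \<le> B * max 0 (m * t + c - \<phi> t)" for t
    proof (cases "\<phi> t \<le> m * t + c")
      case True
      have "\<bar>flux m t (m * t + c)\<bar> \<le> B * (m * t + c - \<phi> t)"
        unfolding flux_def B_def by (rule vflux_integral_bound) (use True vflux_global_bound in auto)
      then show ?thesis using True by simp
    qed (simp add: flux_below)
    have "isCont (\<lambda>t. B * max 0 (m * t + c - \<phi> t)) s"
      using \<phi>_deriv[of s, THEN DERIV_isCont] by (intro continuous_intros) auto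
    moreover have "B * max 0 (m * s + c - \<phi> s) = 0" using False by simp
    ultimately have "((\<lambda>t. B * max 0 (m * t + c - \<phi> t)) \<longlongrightarrow> 0) (at s)"
      unfolding isCont_def by simp
    then have "((\<lambda>t. flux m t (m * t + c)) \<longlongrightarrow> 0) (at s)"
      by (rule Lim_null_comparison[rotated]) (use le in auto)
    then show ?thesis using J0 by (simp add: isCont_def)
  qed
  then show ?thesis by (simp add: continuous_at_imp_continuous_on)
qed

lemma flux_line_mono:
  assumes "a \<le> b" "\<And>s. a < s \<Longrightarrow> s < b \<Longrightarrow> \<phi> s < m * s + c"
  shows "flux m a (m * a + c) \<le> flux m b (m * b + c)"
proof (rule DERIV_nonneg_imp_increasing_open[OF assms(1), of "\<lambda>s. flux m s (m * s + c)"])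
  fix s assume "a < s" "s < b"
  then have s: "\<phi> s < m * s + c" by (rule assms(2))
  then have "pt s (m * s + c) \<in> closure \<Omega>" by (simp add: in_closure)
  from lflux_lower[OF this, of m] have "0 \<le> lflux m (pt s (m * s + c))"
    by (rule order_trans[OF zero_le_power2])
  then show "\<exists>y. ((\<lambda>s. flux m s (m * s + c)) has_real_derivative y) (at s) \<and> 0 \<le> y"
    using flux_derivative[OF s] by blast
qed (rule flux_line_continuous)

text \<open>If the flux vanishes along a line then so does the derivative of \<open>u\<close> in its direction.\<close>

lemma vanishing_flux_contradiction:
  assumes ab: "a < b" and a: "\<phi> a = m * a + c"
    and O: "\<And>s. a < s \<Longrightarrow> s < b \<Longrightarrow> \<phi> s < m * s + c"
    and J0: "\<And>s. a < s \<Longrightarrow> s < b \<Longrightarrow> flux m s (m * s + c) = 0"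
  shows False
proof -
  have Q0: "Du (pt s (m * s + c)) $ 1 + m * Du (pt s (m * s + c)) $ 2 = 0" if s: "a < s" "s < b" for s
  proof -
    have "((\<lambda>s. 0) has_real_derivative lflux m (pt s (m * s + c))) (at s)"
      by (rule has_field_derivative_transform_within_open[OF flux_derivative[OF O[OF s]], of "{a<..<b}"])
        (use s J0 in auto)
    then have "lflux m (pt s (m * s + c)) = 0" using DERIV_const DERIV_unique by blast
    moreover have "pt s (m * s + c) \<in> closure \<Omega>" using O[OF s] by (simp add: in_closure)
    ultimately have "(Du (pt s (m * s + c)) $ 1 + m * Du (pt s (m * s + c)) $ 2)\<^sup>2 \<le> 0"
      using lflux_lower by metis
    then show ?thesis by simp
  qed
  define x where "x = pt a (m * a + c)"
  define t where "t = (b - a) / 2"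
  have t: "0 < t" "a + t < b" using ab by (auto simp: t_def field_simps)
  have line: "x + s *\<^sub>R pt 1 m = pt (a + s) (m * (a + s) + c)" for s
    by (simp add: x_def pt_arith algebra_simps)
  have xf: "x \<in> frontier \<Omega>" using a by (simp add: x_def in_frontier)
  have xc: "x \<in> closure \<Omega>" using a by (simp add: x_def in_closure)
  have inO: "x + s *\<^sub>R pt 1 m \<in> \<Omega>" if "0 < s" "s \<le> t" for s
    unfolding line using O[of "a + s"] that t by (simp add: in_\<Omega>)
  have tc: "x + t *\<^sub>R pt 1 m \<in> closure \<Omega>" using inO[of t] t closure_subset by auto
  have inO': "x + s *\<^sub>R pt 1 m \<in> \<Omega>" if "0 < s" "s < t" for s using inO that by simp
  obtain s where s: "0 < s" "s < t"
    "u (x + t *\<^sub>R pt 1 m) - u x = t * (Du (x + s *\<^sub>R pt 1 m) \<bullet> pt 1 m)"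
    by (rule u_segment_MVT[OF t(1) inO' xc tc])
  have "Du (x + s *\<^sub>R pt 1 m) \<bullet> pt 1 m = 0"
    unfolding line using Q0[of "a + s"] s t by (simp add: inner_real2 mult.commute)
  \<comment> \<open>\<open>u\<close> would keep its boundary value 0 along a line that runs inside
    \<Omega>.\<close>
  then have "u (x + t *\<^sub>R pt 1 m) = 0" using s(3) u_frontier[OF xf] by simp
  then show False using u_pos[OF inO[of t]] t by simp
qed

lemma chord_below:
  assumes "a \<le> t" "t \<le> b" "m * a + c = \<phi> a" "m * b + c = \<phi> b"
  shows "m * t + c \<le> \<phi> t"
proof (rule ccontr)
  assume n: "\<not> m * t + c \<le> \<phi> t"
  define h where "h = (\<lambda>s. m * s + c - \<phi> s)"
  have hc: "continuous_on A h" for A unfolding h_def by (intro continuous_intros \<phi>_continuous)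
  have h: "h a = 0" "h b = 0" "0 < h t" using assms n by (auto simp: h_def)
  then have ab: "a < t" "t < b" using assms(1,2) by (metis order.order_iff_strict less_irrefl)+
  \<comment> \<open>The chord may enter and leave \<Omega> repeatedly; \<open>a'\<close> and
    \<open>b'\<close> bound the maximal interval around \<open>t\<close> on which it lies inside, so
    the flux vanishes at both.\<close>
  obtain a' where a': "a \<le> a'" "a' < t" "h a' = 0" "\<And>s. a' < s \<Longrightarrow> s \<le> t \<Longrightarrow> 0 < h s"
    using last_zero[OF ab(1) hc] h by auto
  obtain b' where b': "t < b'" "b' \<le> b" "h b' = 0" "\<And>s. t \<le> s \<Longrightarrow> s < b' \<Longrightarrow> 0 < h s"
    using first_zero[OF ab(2) hc] h by auto
  have O: "\<phi> s < m * s + c" if "a' < s" "s < b'" for s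
    using a'(4)[of s] b'(4)[of s] that by (cases "s \<le> t") (auto simp: h_def)
  have Ja: "flux m a' (m * a' + c) = 0" "flux m b' (m * b' + c) = 0"
    using a'(3) b'(3) by (auto intro!: flux_below simp: h_def)
  have "flux m s (m * s + c) = 0" if s: "a' < s" "s < b'" for s
  proof (rule antisym)
    have "flux m s (m * s + c) \<le> flux m b' (m * b' + c)" by (rule flux_line_mono) (use s O in auto)
    then show "flux m s (m * s + c) \<le> 0" using Ja by simp
    have "flux m a' (m * a' + c) \<le> flux m s (m * s + c)" by (rule flux_line_mono) (use s O in auto)
    then show "0 \<le> flux m s (m * s + c)" using Ja by simp
  qed
  then show False
    using vanishing_flux_contradiction[of a' b' m c] a' b' O by (auto simp: h_def)
qed

end

section \<open>Flatness of the boundary\<close>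

context overdetermined
begin

lemma \<phi>_below_tangent: "\<phi> y \<le> \<phi> x + \<phi>' x * (y - x)"
proof -
  have "convex_on UNIV (\<lambda>s. - \<phi> s)"
  proof (rule convex_on_linorderI)
    fix t x y :: real assume t: "0 < t" "t < 1" and xy: "x < y"
    define m where "m = (\<phi> y - \<phi> x) / (y - x)"
    define c where "c = \<phi> x - m * x"
    have "m * (y - x) = \<phi> y - \<phi> x" using xy by (simp add: m_def)
    then have my: "m * y + c = \<phi> y" by (simp add: c_def algebra_simps)
    define z where "z = (1 - t) *\<^sub>R x + t *\<^sub>R y"
    have z: "z = x + t * (y - x)" by (simp add: z_def algebra_simps)
    have "0 \<le> t * (y - x)" "t * (y - x) \<le> 1 * (y - x)"
      using t xy by (auto intro: mult_right_mono)
    then have "x \<le> z" "z \<le> y" unfolding z by auto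
    then have "m * z + c \<le> \<phi> z" by (rule chord_below) (use my in \<open>auto simp: c_def\<close>)
    moreover have "m * z + c = (1 - t) * \<phi> x + t * \<phi> y"
      unfolding my[symmetric] by (simp add: z_def c_def algebra_simps)
    ultimately show "- \<phi> ((1 - t) *\<^sub>R x + t *\<^sub>R y) \<le> (1 - t) * - \<phi> x + t * - \<phi> y"
      by (simp add: z_def)
  qed simp
  moreover have "((\<lambda>s. - \<phi> s) has_real_derivative - \<phi>' x) (at x within UNIV)"
    using \<phi>_deriv by (auto intro!: derivative_eq_intros)
  ultimately have "- \<phi>' x * (y - x) \<le> - \<phi> y - - \<phi> x"
    by (intro convex_on_imp_above_tangent[of UNIV]) auto
  then show ?thesis by simp
qed

lemma \<phi>'_constant: "\<phi>' a = \<phi>' b"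
proof (rule ccontr)
  assume "\<phi>' a \<noteq> \<phi>' b"
  then obtain a b where ab: "a < b" "\<phi>' a \<noteq> \<phi>' b"
    by (metis linorder_less_linear)
  have "0 \<le> (\<phi>' a - \<phi>' b) * (b - a)"
    using \<phi>_below_tangent[of b a] \<phi>_below_tangent[of a b] by (simp add: algebra_simps)
  then have lt: "\<phi>' b < \<phi>' a" using ab by (simp add: zero_le_mult_iff)
  \<comment> \<open>The tangent whose slope is the mean of two different ones: by concavity the
    graph lies below lines of slopes \<open>m + \<delta>\<close> and \<open>m - \<delta>\<close>, so
    the tangent of slope \<open>m\<close> leaves it linearly on both sides.\<close>
  define m where "m = (\<phi>' a + \<phi>' b) / 2"
  define \<delta> where "\<delta> = (\<phi>' a - \<phi>' b) / 2"
  have \<delta>: "0 < \<delta>" "\<phi>' a = m + \<delta>" "\<phi>' b = m - \<delta>" using lt by (auto simp: m_def \<delta>_def field_simps)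
  have "\<exists>z\<ge>a. z \<le> b \<and> \<phi>' z = m"
    by (rule IVT2') (use \<delta> ab in \<open>auto intro: \<phi>'_continuous\<close>)
  then obtain z where z: "\<phi>' z = m" by blast
  define c where "c = \<phi> z - m * z"
  define g where "g = (\<lambda>s. m * s + c - \<phi> s)"
  have gc: "continuous_on A g" for A unfolding g_def by (intro continuous_intros \<phi>_continuous)
  have g0: "0 \<le> g s" for s
    using \<phi>_below_tangent[of s z] by (simp add: g_def c_def z algebra_simps)
  have gz: "g z = 0" by (simp add: g_def c_def)
  define C where "C = \<bar>c - \<phi> a + \<phi>' a * a\<bar> + \<bar>c - \<phi> b + \<phi>' b * b\<bar>"
  have C: "0 \<le> C" by (simp add: C_def)
  have gap: "\<delta> * \<bar>s\<bar> - C \<le> g s" for s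
  proof (cases "0 \<le> s")
    case True
    have "\<phi> s \<le> \<phi> b + (m - \<delta>) * (s - b)" using \<phi>_below_tangent[of s b] \<delta>(3) by simp
    then have "\<delta> * s + (c - \<phi> b + \<phi>' b * b) \<le> g s" unfolding \<delta>(3) g_def by (simp add: algebra_simps)
    then show ?thesis using True unfolding C_def by simp
  next
    case False
    have "\<phi> s \<le> \<phi> a + (m + \<delta>) * (s - a)" using \<phi>_below_tangent[of s a] \<delta>(2) by simp
    then have "\<delta> * - s + (c - \<phi> a + \<phi>' a * a) \<le> g s" unfolding \<delta>(2) g_def by (simp add: algebra_simps)
    then show ?thesis using False unfolding C_def by simp
  qed
  define f where "f = (\<lambda>s. flux m s (m * s + c))"
  \<comment> \<open>Right of the tangency point the flux starts from 0 at the last contact and then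
    increases; left of it the mirrored argument gives the opposite sign.\<close>
  have fpos: "0 \<le> f t" if t: "z < t" for t
  proof (cases "0 < g t")
    case True
    obtain a' where a': "z \<le> a'" "a' < t" "g a' = 0" "\<And>s. a' < s \<Longrightarrow> s \<le> t \<Longrightarrow> 0 < g s"
      using last_zero[OF t gc _ True] gz by auto
    have "f a' \<le> f t" unfolding f_def by (rule flux_line_mono) (use a' in \<open>auto simp: g_def\<close>)
    moreover have "f a' = 0" unfolding f_def by (rule flux_below) (use a' in \<open>auto simp: g_def\<close>)
    ultimately show ?thesis by simp
  next
    case False
    then show ?thesis unfolding f_def by (subst flux_below) (auto simp: g_def)
  qed
  have fneg: "f t \<le> 0" if t: "t < z" for t
  proof (cases "0 < g t")
    case True
    obtain b' where b': "t < b'" "b' \<le> z" "g b' = 0" "\<And>s. t \<le> s \<Longrightarrow> s < b' \<Longrightarrow> 0 < g s"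
      using first_zero[OF t gc _ True] gz by auto
    have "f t \<le> f b'" unfolding f_def by (rule flux_line_mono) (use b' in \<open>auto simp: g_def\<close>)
    moreover have "f b' = 0" unfolding f_def by (rule flux_below) (use b' in \<open>auto simp: g_def\<close>)
    ultimately show ?thesis by simp
  next
    case False
    then show ?thesis unfolding f_def by (subst flux_below) (auto simp: g_def)
  qed
  obtain D where D: "0 < D" "\<And>x L. 0 < L \<Longrightarrow> sq x L \<subseteq> \<Omega> \<Longrightarrow> 1 - u x \<le> D / L\<^sup>2"
    using u_decay by blast
  obtain K where K: "0 < K" "\<And>s. 0 \<le> s \<Longrightarrow> s \<le> 1 \<Longrightarrow> W s \<le> K * (1 - s)"
    using W_bounds by blast
  \<comment> \<open>A square of half-width \<open>k * T\<close> shifts the height above the line by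
    at most \<open>k * T * (1 + \<bar>m\<bar>)\<close> and the gap bound by at most
    \<open>k * T * \<delta>\<close>. The two values in \<open>min\<close> keep the total within
    \<open>T / 2\<close> and \<open>\<delta> * T / 2\<close>.\<close>
  define k where "k = min (1 / 2) (\<delta> / 2) / (1 + \<bar>m\<bar> + \<delta>)"
  have kden: "0 < 1 + \<bar>m\<bar> + \<delta>" using \<delta> by simp
  have k: "0 < k" "k * (1 + \<bar>m\<bar> + \<delta>) \<le> 1 / 2" "k * (1 + \<bar>m\<bar> + \<delta>) \<le> \<delta> / 2"
    using kden \<delta> by (auto simp: k_def)
  define A where "A = K * (D / k\<^sup>2)"
  have A: "0 < A" using K D k by (simp add: A_def)
  text \<open>The point at height \<open>\<eta>\<close> above the tangent line is far from the boundary as soon as it lies on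
    the polygonal path joining the points of the tangent line with abscissae \<open>- T\<close> and \<open>T\<close>.\<close>
  have path: "W (u (pt s (m * s + c + \<eta>))) \<le> A / T\<^sup>2"
    if T: "0 < T" "2 * C < \<delta> * T" and p: "0 \<le> \<eta>" "\<bar>s\<bar> = T \<or> \<eta> = T" for s \<eta> T
  proof -
    have kT: "0 < k * T" using k T by simp
    have k1: "k * T * (1 + \<bar>m\<bar> + \<delta>) \<le> T / 2" "k * T * (1 + \<bar>m\<bar> + \<delta>) \<le> \<delta> * T / 2"
      using mult_right_mono[OF k(2), of T] mult_right_mono[OF k(3), of T] T by (auto simp: mult_ac)
    have kd: "0 \<le> k * T * \<delta>" using kT \<delta> by simp
    have sqO: "sq (pt s (m * s + c + \<eta>)) (k * T) \<subseteq> \<Omega>"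
    proof
      fix y assume y: "y \<in> sq (pt s (m * s + c + \<eta>)) (k * T)"
      define \<sigma> where "\<sigma> = y$1 - s"
      define \<tau> where "\<tau> = y$2 - (m * s + c + \<eta>)"
      have st: "\<bar>\<sigma>\<bar> \<le> k * T" "\<bar>\<tau>\<bar> \<le> k * T" using y by (auto simp: sq_def \<sigma>_def \<tau>_def)
      have "\<bar>m * \<sigma>\<bar> \<le> \<bar>m\<bar> * (k * T)" unfolding abs_mult using st by (intro mult_left_mono) auto
      then have low: "\<eta> - k * T * (1 + \<bar>m\<bar>) \<le> \<eta> + \<tau> - m * \<sigma>" using st by (simp add: algebra_simps abs_le_iff)
      have gy: "y$2 - \<phi> (y$1) = \<eta> + \<tau> - m * \<sigma> + g (s + \<sigma>)"
        by (simp add: g_def \<sigma>_def \<tau>_def algebra_simps)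
      have "0 < y$2 - \<phi> (y$1)"
        using p(2)
      proof
        assume "\<eta> = T"
        have "k * T * (1 + \<bar>m\<bar>) \<le> T / 2" using k1(1) kd by (simp add: algebra_simps)
        then show ?thesis using low gy g0[of "s + \<sigma>"] T(1) \<open>\<eta> = T\<close> by linarith
      next
        assume s: "\<bar>s\<bar> = T"
        have "\<delta> * (T - k * T) \<le> \<delta> * \<bar>s + \<sigma>\<bar>" using s st \<delta> by (intro mult_left_mono) auto
        then have "\<delta> * T - k * T * \<delta> - C \<le> g (s + \<sigma>)" using gap[of "s + \<sigma>"] by (simp add: algebra_simps)
        then have "\<delta> * T - C - k * T * (1 + \<bar>m\<bar> + \<delta>) \<le> y$2 - \<phi> (y$1)"
          using low gy p(1) by (simp add: algebra_simps)
        then show ?thesis using k1(2) T(2) by linarith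
      qed
      then show "y \<in> \<Omega>" by (simp add: in_\<Omega>)
    qed
    define x where "x = pt s (m * s + c + \<eta>)"
    have "x \<in> closure \<Omega>" using sqO center_in_sq[of "k * T" x] kT closure_subset[of \<Omega>] by (auto simp: x_def)
    then have u: "0 \<le> u x" "u x \<le> 1" using u_nonneg u_le_1 by auto
    have "W (u x) \<le> K * (1 - u x)" by (rule K(2)[OF u])
    also have "\<dots> \<le> K * (D / (k * T)\<^sup>2)" using D(2)[OF kT sqO] K by (intro mult_left_mono) (auto simp: x_def)
    also have "\<dots> = A / T\<^sup>2" by (simp add: A_def power_mult_distrib)
    finally show ?thesis by (simp add: x_def)
  qed
  \<comment> \<open>Two vertical sides of length \<open>T\<close>, each with the factor of
    \<open>vflux_bound\<close>, and one traverse of horizontal extent \<open>2 * T\<close> with the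
    factor 4 of \<open>lflux_upper\<close>.\<close>
  define B where "B = 2 * (2 * \<bar>m\<bar> + 1) + 8 * (1 + m\<^sup>2)"
  have B: "0 < B" unfolding B_def by (intro add_pos_nonneg) auto
  \<comment> \<open>The increment of the flux along the tangent is computed by a detour: up at
    \<open>- T\<close>, across at height \<open>T\<close>, and down at \<open>T\<close>. The path
    has length of order \<open>T\<close>, while \<open>W (u x)\<close> on it is of order
    \<open>T\<close> to the power -2.\<close>
  have decay: "f T - f (- T) \<le> B * A / T" if T: "0 < T" "2 * C < \<delta> * T" for T
  proof -
    define w where "w = A / T\<^sup>2"
    have w: "0 < w" using A T by (simp add: w_def)
    have above: "\<phi> s \<le> m * s + c" for s using g0[of s] by (simp add: g_def)
    have vert: "\<bar>flux m s (m * s + c + T) - f s\<bar> \<le> (2 * \<bar>m\<bar> + 1) * w * T" if s: "\<bar>s\<bar> = T" for s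
    proof -
      have "\<bar>integral {m * s + c..m * s + c + T} (\<lambda>t. vflux m (pt s t))\<bar> \<le> (2 * \<bar>m\<bar> + 1) * w * (m * s + c + T - (m * s + c))"
      proof (rule vflux_integral_bound[OF above])
        fix t assume t: "m * s + c \<le> t"
        have "pt s t \<in> closure \<Omega>" using t above[of s] by (simp add: in_closure)
        then have "\<bar>vflux m (pt s t)\<bar> \<le> (2 * \<bar>m\<bar> + 1) * W (u (pt s t))" by (rule vflux_bound)
        also have "W (u (pt s t)) \<le> w"
          using path[OF T, of "t - (m * s + c)" s] t s by (simp add: w_def)
        finally show "\<bar>vflux m (pt s t)\<bar> \<le> (2 * \<bar>m\<bar> + 1) * w" by (simp add: mult_left_mono)
      qed (use T in simp)
      moreover have "flux m s (m * s + c + T) = f s + integral {m * s + c..m * s + c + T} (\<lambda>t. vflux m (pt s t))"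
        unfolding f_def by (rule flux_split[OF above]) (use T in simp)
      ultimately show ?thesis by simp
    qed
    have horiz: "flux m T (m * T + (c + T)) - flux m (- T) (m * - T + (c + T)) \<le> 4 * (1 + m\<^sup>2) * w * (2 * T)"
    proof -
      have "\<exists>s. - T < s \<and> s < T \<and> flux m T (m * T + (c + T)) - flux m (- T) (m * - T + (c + T)) =
          (T - - T) * lflux m (pt s (m * s + (c + T)))"
      proof (rule MVT2)
        fix s
        have "\<phi> s < m * s + (c + T)" using above[of s] T by simp
        then show "((\<lambda>s. flux m s (m * s + (c + T))) has_real_derivative lflux m (pt s (m * s + (c + T)))) (at s)"
          by (rule flux_derivative)
      qed (use T in simp)
      then obtain s where s: "flux m T (m * T + (c + T)) - flux m (- T) (m * - T + (c + T)) =
          2 * T * lflux m (pt s (m * s + (c + T)))" by auto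
      have "pt s (m * s + (c + T)) \<in> closure \<Omega>" using above[of s] T by (simp add: in_closure)
      then have "lflux m (pt s (m * s + (c + T))) \<le> 4 * (1 + m\<^sup>2) * W (u (pt s (m * s + (c + T))))" by (rule lflux_upper)
      also have "\<dots> \<le> 4 * (1 + m\<^sup>2) * w"
        using path[OF T, of T s] T by (intro mult_left_mono) (auto simp: w_def add.assoc)
      finally have "2 * T * lflux m (pt s (m * s + (c + T))) \<le> 2 * T * (4 * (1 + m\<^sup>2) * w)"
        using T by (intro mult_left_mono) auto
      then show ?thesis unfolding s by (simp add: mult_ac)
    qed
    have "f T - flux m T (m * T + (c + T)) \<le> (2 * \<bar>m\<bar> + 1) * w * T"
      using vert[of T] T(1) unfolding add.assoc abs_le_iff by simp
    moreover have "flux m (- T) (m * - T + (c + T)) - f (- T) \<le> (2 * \<bar>m\<bar> + 1) * w * T"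
      using vert[of "- T"] T(1) unfolding add.assoc abs_le_iff by simp
    ultimately have "f T - f (- T) \<le> (2 * \<bar>m\<bar> + 1) * w * T + (2 * \<bar>m\<bar> + 1) * w * T + 4 * (1 + m\<^sup>2) * w * (2 * T)"
      using horiz by linarith
    also have "\<dots> = B * (w * T)" by (simp add: B_def algebra_simps)
    also have "w * T = A / T" using T by (simp add: w_def power2_eq_square)
    finally show ?thesis by simp
  qed
  \<comment> \<open>Beyond \<open>t0\<close> the gap is certainly positive; the last contact before
    it is then the last contact of all.\<close>
  define t0 where "t0 = max (C / \<delta>) z + 1"
  have t0: "z < t0" "C / \<delta> < t0" by (auto simp: t0_def)
  have gbig: "0 < g s" if "t0 \<le> s" for s
  proof -
    have "0 \<le> C / \<delta>" using C \<delta> by simp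
    then have "C / \<delta> < \<bar>s\<bar>" using t0 that by linarith
    then have "C < \<delta> * \<bar>s\<bar>" using \<delta> by (simp add: pos_divide_less_eq mult.commute)
    then show ?thesis using gap[of s] by simp
  qed
  obtain a' where a': "z \<le> a'" "a' < t0" "g a' = 0" "\<And>s. a' < s \<Longrightarrow> s \<le> t0 \<Longrightarrow> 0 < g s"
    using last_zero[OF t0(1) gc _ gbig[OF order_refl]] gz by auto
  have gp: "0 < g s" if "a' < s" for s using a'(4)[OF that] gbig[of s] by linarith
  \<comment> \<open>For large \<open>T\<close>, monotonicity and the sign of \<open>f (- T)\<close>
    give \<open>0 \<le> f t \<le> f T - f (- T)\<close>, and the right-hand side tends to 0.\<close>
  have "f t = 0" if t: "a' < t" for t
  proof (rule antisym)
    have lim: "((\<lambda>T. B * A / T) \<longlongrightarrow> 0) at_top"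
      by (intro tendsto_divide_0[OF tendsto_const] filterlim_at_top_imp_at_infinity filterlim_ident)
    show "f t \<le> 0"
    proof (rule tendsto_lowerbound[OF lim])
      have "\<forall>\<^sub>F T in at_top. T > max (max t (- z)) (max 0 (2 * C / \<delta>))" by (rule eventually_gt_at_top)
      then show "\<forall>\<^sub>F T in at_top. f t \<le> B * A / T"
      proof eventually_elim
        case (elim T)
        then have T: "t < T" "- z < T" "0 < T" "2 * C < \<delta> * T"
          using \<delta> by (auto simp: pos_divide_less_eq mult.commute)
        have "f t \<le> f T" unfolding f_def by (rule flux_line_mono) (use T t gp in \<open>auto simp: g_def\<close>)
        also have "\<dots> \<le> f T - f (- T)" using fneg[of "- T"] T by simp
        also have "\<dots> \<le> B * A / T" by (rule decay[OF T(3,4)])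
        finally show ?case .
      qed
    qed simp
    show "0 \<le> f t" by (rule fpos) (use t a' in simp)
  qed
  then show False
    using vanishing_flux_contradiction[of a' "a' + 1" m c] a'(3) gp by (auto simp: f_def g_def)
qed

lemma \<phi>_affine: "\<phi> s = \<phi> 0 + \<phi>' 0 * s"
proof -
  have "((\<lambda>s. \<phi> s - \<phi>' 0 * s) has_real_derivative 0) (at s)" for s
    using \<phi>_deriv[of s] \<phi>'_constant[of s 0] by (auto intro!: derivative_eq_intros)
  then have "\<phi> s - \<phi>' 0 * s = \<phi> 0 - \<phi>' 0 * 0" by (rule DERIV_isconst_all[rule_format, rotated])
  then show ?thesis by simp
qed

end

section \<open>The profile\<close>

lemma arclen_compare:
  assumes "0 \<le> s" "0 < c" "continuous_on {0..s} F" "continuous_on {0..s} G"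
    and "\<And>t. 0 \<le> t \<Longrightarrow> t \<le> s \<Longrightarrow> 0 < F t" "\<And>t. 0 \<le> t \<Longrightarrow> t \<le> s \<Longrightarrow> 0 < G t"
    and le: "\<And>t. 0 \<le> t \<Longrightarrow> t \<le> s \<Longrightarrow> F t \<le> c\<^sup>2 * G t"
  shows "arclen G s \<le> c * arclen F s"
proof -
  have "integral {0..s} (\<lambda>t. 1 / sqrt (2 * G t)) \<le> integral {0..s} (\<lambda>t. c * (1 / sqrt (2 * F t)))"
  proof (rule integral_le)
    show "(\<lambda>t. 1 / sqrt (2 * G t)) integrable_on {0..s}"
      by (rule integrable_continuous_real[OF arclen_integrand_continuous]) (use assms in auto)
    have "continuous_on {0..s} (\<lambda>t. 1 / sqrt (2 * F t))"
      by (rule arclen_integrand_continuous) (use assms in auto)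
    then show "(\<lambda>t. c * (1 / sqrt (2 * F t))) integrable_on {0..s}"
      by (intro integrable_continuous_real continuous_on_mult_left)
    fix t assume "t \<in> {0..s}"
    then have t: "0 \<le> t" "t \<le> s" by auto
    have p: "0 < F t" "0 < G t" using assms t by auto
    have "sqrt (2 * F t) \<le> sqrt (c\<^sup>2 * (2 * G t))" using le[OF t] by simp
    also have "\<dots> = c * sqrt (2 * G t)" using assms(2) by (simp add: real_sqrt_mult)
    finally show "1 / sqrt (2 * G t) \<le> c * (1 / sqrt (2 * F t))"
      using p by (simp add: field_simps)
  qed
  then show ?thesis unfolding arclen_def by (simp only: integral_mult_right)
qed

context double_well_potential
begin

lemma W_below_1: "0 \<le> t \<Longrightarrow> t \<le> b \<Longrightarrow> b < 1 \<Longrightarrow> 0 < W t"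
  by (rule W_pos) auto

lemma W_continuous_Icc: "continuous_on {0..b} W"
  by (rule continuous_on_subset[OF W_continuous]) auto

text \<open>The first integral \<open>(p t)\<^sup>2 / 2 - W (h t)\<close> is a constant
  \<open>E\<close>. At infinity \<open>W (h t)\<close> tends to 0, so \<open>E \<ge> 0\<close>.
  Hence \<open>p\<close> has no zero, and it is positive since \<open>h\<close> starts from its
  least value. If \<open>E > 0\<close>, \<open>h\<close> would grow at least linearly past 1. So
  \<open>p = sqrt (2 * W (h t))\<close>, and \<open>arclen W (h t)\<close> has derivative 1.\<close>

lemma profile_arclen:
  assumes h: "is_profile W h" and T: "0 \<le> T"
  shows "arclen W (h T) = T"
proof -
  define p where "p = hderiv h"
  have h01: "0 \<le> h t" "h t < 1" if "0 \<le> t" for t using h that by (auto simp: is_profile_def)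
  have h0: "h 0 = 0" using h by (simp add: is_profile_def)
  have hd: "(h has_real_derivative p t) (at t within {0..})" if "0 \<le> t" for t
    using h that unfolding is_profile_def p_def hderiv_def
    by (simp add: has_real_derivative_iff_has_vector_derivative vector_derivative_works[symmetric])
  have pd: "(p has_real_derivative W1 (h t)) (at t within {0..})" if "0 \<le> t" for t
    using h that by (simp add: is_profile_def p_def)
  have hc: "continuous_on {0..} h" by (rule DERIV_continuous_on) (use hd in auto)
  have pc: "continuous_on {0..} p" by (rule DERIV_continuous_on) (use pd in auto)
  have Whd: "((\<lambda>t. W (h t)) has_real_derivative W1 (h t) * p t) (at t within {0..})" if "0 \<le> t" for t
  proof -
    have "h ` {0..} \<subseteq> {0..}" using h01 by auto
    from DERIV_image_chain[OF DERIV_subset[OF W_deriv_within[OF h01(1)[OF that]] this] hd[OF that]]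
    show ?thesis by (simp add: o_def)
  qed
  have "\<exists>E. \<forall>t\<in>{0..}. (p t)\<^sup>2 / 2 - W (h t) = E"
  proof (rule has_field_derivative_zero_constant)
    fix t :: real assume "t \<in> {0..}"
    then have t: "0 \<le> t" by simp
    show "((\<lambda>t. (p t)\<^sup>2 / 2 - W (h t)) has_real_derivative 0) (at t within {0..})"
      using pd[OF t] Whd[OF t] by (auto intro!: derivative_eq_intros)
  qed simp
  then obtain E where "\<And>t. t \<in> {0..} \<Longrightarrow> (p t)\<^sup>2 / 2 - W (h t) = E" by blast
  then have E: "(p t)\<^sup>2 = 2 * (E + W (h t))" if "0 \<le> t" for t using that by fastforce
  have "E \<ge> 0"
  proof -
    have "isCont W 1" by (rule DERIV_isCont[OF W_deriv]) simp
    moreover have "(h \<longlongrightarrow> 1) at_top" using h by (simp add: is_profile_def)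
    ultimately have "((\<lambda>t. W (h t)) \<longlongrightarrow> W 1) at_top" by (rule isCont_tendsto_compose)
    then have lim: "((\<lambda>t. E + W (h t)) \<longlongrightarrow> E + W 1) at_top" by (intro tendsto_intros)
    have "0 \<le> E + W 1"
    proof (rule tendsto_lowerbound[OF lim])
      show "\<forall>\<^sub>F t in at_top. 0 \<le> E + W (h t)"
        using eventually_ge_at_top[of 0]
      proof eventually_elim
        case (elim t)
        have "0 \<le> 2 * (E + W (h t))" using zero_le_power2[of "p t"] unfolding E[OF elim] .
          then show ?case by simp
      qed
    qed simp
    then show ?thesis by simp
  qed
  have pn0: "p t \<noteq> 0" if "0 \<le> t" for t
  proof -
    have "0 < W (h t)" using h01[OF that] by (rule W_pos)
    then have "0 < (p t)\<^sup>2" unfolding E[OF that] using \<open>E \<ge> 0\<close> by simp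
    then show ?thesis by (simp only: zero_less_power2 not_False_eq_True)
  qed
  have hat: "(h has_real_derivative p t) (at t)" if "0 < t" for t
    using hd[of t] that at_within_halfline[OF that] by simp
  have ppos: "0 < p t" if t: "0 \<le> t" for t
  proof (rule ccontr)
    assume "\<not> 0 < p t"
    then have pt: "p t < 0" using pn0[OF t] by simp
    have neg: "p s < 0" if s: "0 \<le> s" for s
    proof (rule ccontr)
      assume "\<not> p s < 0"
      then have "0 < p s" using pn0[OF s] by simp
      then have "\<exists>x\<in>{0..}. p x = 0"
      proof -
        have "connected (p ` {0..})" by (rule connected_continuous_image[OF pc]) (simp add: convex_connected)
        moreover have "p t \<in> p ` {0..}" "p s \<in> p ` {0..}" using t s by (simp_all add: imageI)
        ultimately have "0 \<in> p ` {0..}"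
          using pt \<open>0 < p s\<close> by (meson connectedD_interval less_imp_le)
        then show ?thesis by (metis imageE)
      qed
      then show False using pn0 by auto
    qed
    have "(\<lambda>t. - h t) 0 < (\<lambda>t. - h t) 1"
    proof (rule DERIV_pos_imp_increasing_open[of 0 1 "\<lambda>t. - h t"])
      fix s :: real assume "0 < s" "s < 1"
      then show "\<exists>y. ((\<lambda>t. - h t) has_real_derivative y) (at s) \<and> 0 < y"
        using hat[of s] neg[of s] by (intro exI[of _ "- p s"]) (auto intro!: derivative_eq_intros)
    qed (auto intro!: continuous_intros continuous_on_subset[OF hc])
    then show False using h0 h01[of 1] by simp
  qed
  have E0: "E = 0"
  proof (rule ccontr)
    assume "E \<noteq> 0"
    then have Ep: "0 < E" using \<open>E \<ge> 0\<close> by simp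
    define q where "q = sqrt (2 * E)"
    have q: "0 < q" using Ep by (simp add: q_def)
    have pq: "q \<le> p t" if "0 \<le> t" for t
      unfolding q_def using E[OF that] W_nonneg[of "h t"] h01[OF that] ppos[OF that]
      by (intro real_le_lsqrt) auto
    have "(\<lambda>t. h t - q * t) 0 \<le> (\<lambda>t. h t - q * t) (1 / q)"
    proof (rule DERIV_nonneg_imp_increasing_open[of 0 "1 / q" "\<lambda>t. h t - q * t"])
      fix s :: real assume "0 < s"
      then show "\<exists>y. ((\<lambda>t. h t - q * t) has_real_derivative y) (at s) \<and> 0 \<le> y"
        using hat[of s] pq[of s] by (intro exI[of _ "p s - q"]) (auto intro!: derivative_eq_intros)
    qed (use q in \<open>auto intro!: continuous_intros continuous_on_subset[OF hc]\<close>)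
    then show False using h0 h01[of "1 / q"] q by simp
  qed
  have peq: "p t = sqrt (2 * W (h t))" if "0 \<le> t" for t
    using E[OF that] ppos[OF that] by (simp add: E0 real_sqrt_unique)
  have hT: "h t \<le> h T" if t: "0 \<le> t" "t \<le> T" for t
  proof (rule DERIV_nonneg_imp_increasing_open[OF t(2), of h])
    show "continuous_on {t..T} h" by (rule continuous_on_subset[OF hc]) (use t in auto)
    fix s assume "t < s" "s < T"
    then have s: "0 < s" using t by simp
    show "\<exists>y. (h has_real_derivative y) (at s) \<and> 0 \<le> y"
      using hat[OF s] ppos[OF less_imp_le[OF s]] less_imp_le by blast
  qed
  have "\<exists>c. \<forall>t\<in>{0..T}. arclen W (h t) - t = c"
  proof (rule has_field_derivative_zero_constant)
    fix t assume "t \<in> {0..T}"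
    then have t: "0 \<le> t" "t \<le> T" by auto
    have img: "h ` {0..T} \<subseteq> {0..h T}" by (intro image_subsetI) (simp add: h01(1) hT)
    have d1: "(arclen W has_real_derivative 1 / sqrt (2 * W (h t))) (at (h t) within {0..h T})"
      by (rule arclen_has_derivative_within[OF W_continuous_Icc
          W_below_1[OF _ _ h01(2)[OF T]] h01(1)[OF t(1)] hT[OF t]])
    have "(h has_real_derivative p t) (at t within {0..T})"
      by (rule DERIV_subset[OF hd[OF t(1)]]) auto
    note DERIV_image_chain[OF DERIV_subset[OF d1 img] this]
    moreover have "1 / sqrt (2 * W (h t)) * p t = 1"
      using ppos[OF t(1)] unfolding peq[OF t(1), symmetric] by simp
    ultimately have "((\<lambda>t. arclen W (h t)) has_real_derivative 1) (at t within {0..T})"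
      by (simp only: o_def)
    then show "((\<lambda>t. arclen W (h t) - t) has_real_derivative 0) (at t within {0..T})"
      by (auto intro!: derivative_eq_intros)
  qed simp
  then obtain c where c: "\<And>t. t \<in> {0..T} \<Longrightarrow> arclen W (h t) - t = c" by blast
  show ?thesis using c[of 0] c[of T] T h0 by simp
qed

lemma arclen_W_inject:
  assumes "0 \<le> r" "r < 1" "0 \<le> s" "s < 1" "arclen W r = arclen W s"
  shows "r = s"
proof (rule ccontr)
  assume "r \<noteq> s"
  have less: "arclen W r < arclen W s" if "0 \<le> r" "r < s" "s < 1" for r s
    by (rule arclen_strict_mono[OF W_continuous_Icc _ that(1,2) order_refl]) (use W_below_1 that in auto)
  show False using less[of r s] less[of s r] assms \<open>r \<noteq> s\<close> by (cases "r < s") auto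
qed

text \<open>Two profiles have the same \<open>arclen W\<close>, which is injective below 1; this is
  the uniqueness that \<open>THE\<close> asks for.\<close>

lemma profile_eqI:
  assumes "is_profile W g" "\<And>t. t < 0 \<Longrightarrow> g t = 0"
  shows "profile W = g"
  unfolding profile_def
proof (rule the_equality)
  fix h assume "is_profile W h \<and> (\<forall>t<0. h t = 0)"
  then have h: "is_profile W h" "\<And>t. t < 0 \<Longrightarrow> h t = 0" by auto
  show "h = g"
  proof
    fix t
    show "h t = g t"
    proof (cases "t < 0")
      case True
      then show ?thesis using h(2) assms(2) by simp
    next
      case False
      then have t: "0 \<le> t" by simp
      have "0 \<le> h t" "h t < 1" "0 \<le> g t" "g t < 1"
        using h(1) assms(1) t unfolding is_profile_def by blast+
      moreover have "arclen W (h t) = arclen W (g t)"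
        unfolding profile_arclen[OF h(1) t] profile_arclen[OF assms(1) t] ..
      ultimately show ?thesis by (rule arclen_W_inject)
    qed
  qed
qed (use assms in auto)

text \<open>Differentiating the first-order equation recovers the second-order one, because
  \<open>W (g t)\<close> stays positive.\<close>

lemma is_profileI:
  assumes g: "\<And>t. 0 \<le> t \<Longrightarrow> 0 \<le> g t" "\<And>t. 0 \<le> t \<Longrightarrow> g t < 1" "g 0 = 0" "(g \<longlongrightarrow> 1) at_top"
    and d: "\<And>t. 0 \<le> t \<Longrightarrow> (g has_real_derivative sqrt (2 * W (g t))) (at t within {0..})"
  shows "is_profile W g"
  unfolding is_profile_def
proof (intro conjI allI impI)
  fix t :: real assume t: "0 \<le> t"
  show "g differentiable (at t within {0..})" using d[OF t] real_differentiable_def by blast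
  have hd: "hderiv g s = sqrt (2 * W (g s))" if "0 \<le> s" for s
  proof -
    have "at s within {0..} \<noteq> bot"
    proof (cases "s = 0")
      case True
      have "at_right (0::real) \<le> at 0 within {0..}" by (rule at_le) auto
      then show ?thesis using True trivial_limit_at_right_real[of 0] by (metis bot.extremum_uniqueI)
    next
      case False
      then show ?thesis using at_within_halfline[of s] that by simp
    qed
    then show ?thesis
      unfolding hderiv_def using d[OF that]
      by (intro vector_derivative_within) (auto simp: has_real_derivative_iff_has_vector_derivative)
  qed
  have Wg: "0 < W (g t)" by (rule W_pos) (use g t in auto)
  have "g ` {0..} \<subseteq> {0..}" using g by auto
  from DERIV_image_chain[OF DERIV_subset[OF W_deriv_within[OF g(1)[OF t]] this] d[OF t]]
  have Wd: "((\<lambda>t. W (g t)) has_real_derivative W1 (g t) * sqrt (2 * W (g t))) (at t within {0..})"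
    by (simp add: o_def)
  define q where "q = sqrt (2 * W (g t))"
  have q: "0 < q" using Wg by (simp add: q_def)
  have "(sqrt has_real_derivative inverse q / 2) (at (2 * W (g t)))"
    unfolding q_def by (rule DERIV_real_sqrt) (use Wg in simp)
  from DERIV_chain2[OF this DERIV_cmult[OF Wd, of 2]]
  have "((\<lambda>t. sqrt (2 * W (g t))) has_real_derivative inverse q / 2 * (2 * (W1 (g t) * q))) (at t within {0..})"
    by (simp only: q_def)
  moreover have "inverse q / 2 * (2 * (W1 (g t) * q)) = W1 (g t)" using q by simp
  ultimately have "((\<lambda>t. sqrt (2 * W (g t))) has_real_derivative W1 (g t)) (at t within {0..})"
    by (simp only:)
  then show "(hderiv g has_real_derivative W1 (g t)) (at t within {0..})"
    by (rule has_field_derivative_transform_within[OF _ zero_less_one]) (use t hd in auto)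
qed (use g in auto)

end

section \<open>The solution in a half plane\<close>

context overdetermined
begin

definition inner_normal :: "real^2"
  where "inner_normal = (1 / sqrt (1 + (\<phi>' 0)\<^sup>2)) *\<^sub>R pt (- \<phi>' 0) 1"

definition offset :: real
  where "offset = \<phi> 0 / sqrt (1 + (\<phi>' 0)\<^sup>2)"

lemma sqrt_pos: "0 < sqrt (1 + (\<phi>' 0)\<^sup>2)"
  by (simp add: add_pos_nonneg)

lemma norm_inner_normal [simp]: "norm inner_normal = 1" "inner_normal \<bullet> inner_normal = 1"
proof -
  have "0 < 1 + (\<phi>' 0)\<^sup>2" by (simp add: add_pos_nonneg)
  then show "norm inner_normal = 1"
    by (simp add: inner_normal_def norm_real2 pt_arith power_divide add_divide_distrib[symmetric] add.commute)
  then show "inner_normal \<bullet> inner_normal = 1" by (simp add: norm_eq_1)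
qed

lemma inner_inner_normal: "x \<bullet> inner_normal - offset = (x$2 - \<phi> (x$1)) / sqrt (1 + (\<phi>' 0)\<^sup>2)"
  using \<phi>_affine[of "x$1"] by (simp add: inner_real2 inner_normal_def offset_def diff_divide_distrib add_divide_distrib mult.commute)

lemma \<Omega>_half_plane: "x \<in> \<Omega> \<longleftrightarrow> offset < x \<bullet> inner_normal"
proof -
  have "x \<in> \<Omega> \<longleftrightarrow> 0 < x \<bullet> inner_normal - offset"
    unfolding inner_inner_normal in_\<Omega> using sqrt_pos by (simp add: zero_less_divide_iff)
  then show ?thesis by simp
qed

lemma closure_half_plane: "x \<in> closure \<Omega> \<longleftrightarrow> offset \<le> x \<bullet> inner_normal"
proof -
  have "x \<in> closure \<Omega> \<longleftrightarrow> 0 \<le> x \<bullet> inner_normal - offset"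
    unfolding inner_inner_normal in_closure using sqrt_pos by (simp add: zero_le_divide_iff)
  then show ?thesis by simp
qed

lemma frontier_half_plane: "x \<in> frontier \<Omega> \<longleftrightarrow> x \<bullet> inner_normal = offset"
  using closure_half_plane[of x] \<Omega>_half_plane[of x] in_frontier in_closure in_\<Omega> by auto

lemma ball_half_plane:
  assumes R: "r \<le> y \<bullet> inner_normal - offset"
  shows "ball y r \<subseteq> \<Omega>"
proof
  fix z assume z: "z \<in> ball y r"
  have "\<bar>(y - z) \<bullet> inner_normal\<bar> \<le> norm (y - z) * norm inner_normal" by (rule Cauchy_Schwarz_ineq2)
  then have "(y - z) \<bullet> inner_normal < r" using z by (simp add: dist_norm)
  then show "z \<in> \<Omega>" using R by (simp add: \<Omega>_half_plane inner_diff_left)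
qed

text \<open>The upper bound is the two-point estimate between \<open>x\<close> and its projection on
  the boundary. The lower bound is \<open>inner_barrier\<close> in balls tangent to the boundary at
  that projection. \<open>arclen_compare\<close> passes from the perturbed potentials to
  \<open>W\<close> at the cost of a factor that tends to 1.\<close>

lemma arclen_u:
  assumes x: "x \<in> \<Omega>"
  shows "arclen W (u x) = x \<bullet> inner_normal - offset"
proof (rule antisym)
  define d where "d = x \<bullet> inner_normal - offset"
  have d: "0 < d" using x by (simp add: d_def \<Omega>_half_plane)
  have xc: "x \<in> closure \<Omega>" using x closure_subset by blast
  define s where "s = u x"
  have s: "0 < s" "s < 1" using u_pos[OF x] u_less_1[OF xc] by (auto simp: s_def)
  define m where "m = W s"
  have m: "0 < m" using W_pos[of s] s by (simp add: m_def)
  have Wm: "m \<le> W t" if "0 \<le> t" "t \<le> s" for t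
    unfolding m_def by (rule W_antimono) (use that s in auto)
  have Wpos: "0 < W t" if "0 \<le> t" "t \<le> s" for t using Wm[OF that] m by simp
  have upper: "arclen W s \<le> sqrt (1 + 3 * k / m) * d" if k: "0 < k" for k
  proof -
    \<comment> \<open>As \<open>W \<ge> m\<close> on \<open>{0..s}\<close>, the perturbation
      \<open>k * (3 - t)\<close> is at most \<open>3 * k / m\<close> times
      \<open>W t\<close>.\<close>
    have q: "0 < 1 + 3 * k / m" using k m by (simp add: add_pos_pos)
    have "arclen W s \<le> sqrt (1 + 3 * k / m) * arclen (outer_potential k) s"
    proof (rule arclen_compare)
      show "continuous_on {0..s} (outer_potential k)" by (rule outer_potential_continuous) auto
      fix t assume t: "0 \<le> t" "t \<le> s"
      show "0 < outer_potential k t" using outer_potential_lower[OF k, of t] t s k by simp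
      show "0 < W t" by (rule Wpos[OF t])
      have "k * (3 - t) \<le> 3 * k * 1" using k t by simp
      also have "\<dots> \<le> 3 * k * (W t / m)" using k m Wm[OF t] by (intro mult_left_mono) auto
      finally show "outer_potential k t \<le> (sqrt (1 + 3 * k / m))\<^sup>2 * W t"
        using q by (simp add: outer_potential_def algebra_simps)
    qed (use q s W_continuous_Icc in auto)
    also have "\<dots> \<le> sqrt (1 + 3 * k / m) * d"
    proof -
      define y where "y = x - d *\<^sub>R inner_normal"
      have y: "y \<in> frontier \<Omega>" by (simp add: y_def frontier_half_plane inner_diff_left d_def)
      then have "y \<in> closure \<Omega>" by (simp add: frontier_def)
      from two_point_estimate[OF k xc this]
      have "arclen (outer_potential k) s \<le> dist x y" using u_frontier[OF y] by (simp add: s_def)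
      also have "\<dots> = d" using d by (simp add: y_def dist_norm)
      finally show ?thesis using q by (intro mult_left_mono) auto
    qed
    finally show ?thesis .
  qed
  have lim: "((\<lambda>k. sqrt (1 + 3 * k / m) * d) \<longlongrightarrow> sqrt (1 + 3 * 0 / m) * d) (at_right 0)"
    using m by (intro tendsto_intros) auto
  have "arclen W s \<le> sqrt (1 + 3 * 0 / m) * d"
    by (rule tendsto_lowerbound[OF lim])
      (use eventually_at_right_less[of "0::real"] upper in \<open>auto elim: eventually_mono\<close>)
  then show "arclen W (u x) \<le> x \<bullet> inner_normal - offset" by (simp add: s_def d_def)
  obtain a1 where a1: "0 < a1" "a1 < 1"
    and pos: "\<And>a s. a1 < a \<Longrightarrow> a < 1 \<Longrightarrow> 0 \<le> s \<Longrightarrow> s < a \<Longrightarrow> 0 < inner_potential a s"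
    and bar: "\<And>a. a1 < a \<Longrightarrow> a < 1 \<Longrightarrow> \<exists>R0. \<forall>R\<ge>R0. \<forall>y. ball y R \<subseteq> \<Omega> \<longrightarrow>
      (\<forall>x\<in>ball y R. u x < a \<longrightarrow> R - dist x y \<le> arclen (inner_potential a) (u x))"
    using inner_barrier by blast
  define \<delta> where "\<delta> = (\<lambda>a. W a - W1 a)"
  have lower: "sqrt (1 - \<delta> a / m) * d \<le> arclen W s"
    if a: "a1 < a" "a < 1" "s < a" "\<delta> a < m" for a
  proof -
    define q where "q = 1 - \<delta> a / m"
    have q: "0 < q" using a(4) m by (simp add: q_def)
    have "d \<le> arclen (inner_potential a) s"
    proof -
      obtain R0 where R0: "\<And>R y x. R0 \<le> R \<Longrightarrow> ball y R \<subseteq> \<Omega> \<Longrightarrow> x \<in> ball y R \<Longrightarrow> u x < a \<Longrightarrow>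
          R - dist x y \<le> arclen (inner_potential a) (u x)"
        using bar[OF a(1,2)] by blast
      \<comment> \<open>Any radius above both \<open>R0\<close> and \<open>d\<close> will do: the
        ball centred at depth \<open>R\<close> on the normal through \<open>x\<close> is tangent to
        the boundary, and \<open>R - dist x y\<close> equals \<open>d\<close> whatever
        \<open>R\<close> is.\<close>
      define R where "R = max R0 (d + 1)"
      define y where "y = x + (R - d) *\<^sub>R inner_normal"
      have R: "R0 \<le> R" "d < R" by (auto simp: R_def)
      have "ball y R \<subseteq> \<Omega>" by (rule ball_half_plane) (simp add: y_def inner_add_left d_def)
      moreover have dist: "dist x y = R - d" using R by (simp add: y_def dist_norm)
      then have "x \<in> ball y R" using d by (simp add: dist_commute)
      ultimately have "R - dist x y \<le> arclen (inner_potential a) (u x)"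
        using R0[OF R(1)] a(3) by (simp add: s_def)
      then show ?thesis by (simp add: dist s_def)
    qed
    also have "arclen (inner_potential a) s \<le> 1 / sqrt q * arclen W s"
    proof (rule arclen_compare)
      show "continuous_on {0..s} (inner_potential a)" by (rule inner_potential_continuous) auto
      fix t assume t: "0 \<le> t" "t \<le> s"
      show "0 < inner_potential a t" using pos[OF a(1,2), of t] t a(3) by simp
      show "0 < W t" by (rule Wpos[OF t])
      have "- W1 a * (a - t) \<le> - W1 a * 1"
        using W1_nonpos[of a] a a1 t by (intro mult_left_mono) auto
      then have 1: "W t - \<delta> a \<le> inner_potential a t"
        unfolding inner_potential_def \<delta>_def by (simp add: algebra_simps)
      have "0 \<le> \<delta> a" unfolding \<delta>_def using W1_nonpos[of a] W_nonneg[of a] a a1 by auto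
      then have "\<delta> a * 1 \<le> \<delta> a * (W t / m)" using m Wm[OF t] by (intro mult_left_mono) auto
      then have "q * W t \<le> W t - \<delta> a" by (simp add: q_def algebra_simps)
      then have "q * W t \<le> inner_potential a t" using 1 by simp
      then show "W t \<le> (1 / sqrt q)\<^sup>2 * inner_potential a t"
        using q by (simp add: power_divide field_simps)
    qed (use q s W_continuous_Icc in auto)
    finally show ?thesis using q by (simp add: q_def[symmetric] field_simps)
  qed
  have "isCont \<delta> 1"
    unfolding \<delta>_def
    by (intro continuous_intros DERIV_isCont[OF W_deriv] DERIV_isCont[OF W1_deriv]) auto
  then have "(\<delta> \<longlongrightarrow> 0) (at 1)" by (simp add: isCont_def \<delta>_def)
  then have \<delta>lim: "(\<delta> \<longlongrightarrow> 0) (at_left 1)" by (rule tendsto_within_subset) simp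
  then have lim': "((\<lambda>a. sqrt (1 - \<delta> a / m) * d) \<longlongrightarrow> sqrt (1 - 0 / m) * d) (at_left 1)"
    using m by (intro tendsto_intros) auto
  have "sqrt (1 - 0 / m) * d \<le> arclen W s"
  proof (rule tendsto_upperbound[OF lim'])
    have "max a1 s < 1" using a1 s by simp
    from eventually_at_left_real[OF this] order_tendstoD(2)[OF \<delta>lim m]
    show "\<forall>\<^sub>F a in at_left 1. sqrt (1 - \<delta> a / m) * d \<le> arclen W s"
      by eventually_elim (use lower in auto)
  qed simp
  then show "x \<bullet> inner_normal - offset \<le> arclen W (u x)" by (simp add: s_def d_def)
qed

text \<open>Existence of the profile comes from the solution itself, restricted to a normal line of
  the boundary.\<close>

definition line_profile :: "real \<Rightarrow> real"
  where "line_profile t = (if t < 0 then 0 else u ((offset + t) *\<^sub>R inner_normal))"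

text \<open>\<open>arclen_u\<close> says that \<open>arclen W\<close> inverts this function;
  differentiating that identity gives the first-order equation of the profile. The limit at infinity
  comes from \<open>u_lower_bound\<close>, since deep points are centres of squares inside
  \<Omega>.\<close>

lemma profile_eq_line_profile: "profile W = line_profile"
proof (rule profile_eqI[OF is_profileI])
  define x0 where "x0 = offset *\<^sub>R inner_normal"
  have line_profile: "line_profile t = u (x0 + t *\<^sub>R inner_normal)" if "0 \<le> t" for t
    using that by (simp add: line_profile_def x0_def scaleR_add_left)
  have x0: "x0 \<in> frontier \<Omega>" by (simp add: frontier_half_plane x0_def)
  have O: "x0 + t *\<^sub>R inner_normal \<in> \<Omega>" if "0 < t" for t
    using that by (simp add: \<Omega>_half_plane x0_def inner_add_left)
  have cl: "x0 + t *\<^sub>R inner_normal \<in> closure \<Omega>" if "0 \<le> t" for t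
    using that by (simp add: closure_half_plane x0_def inner_add_left)
  show "0 \<le> line_profile t" "line_profile t < 1" if "0 \<le> t" for t
    using u_nonneg[OF cl[OF that]] u_less_1[OF cl[OF that]] line_profile[OF that] by auto
  show "line_profile 0 = 0" using line_profile[of 0] u_frontier[OF x0] by simp
  have ar: "arclen W (u (x0 + t *\<^sub>R inner_normal)) = t" if "0 < t" for t
    using arclen_u[OF O[OF that]] by (simp add: x0_def inner_add_left)
  show "(line_profile \<longlongrightarrow> 1) at_top"
  proof (rule order_tendstoI)
    fix a :: real assume "a < 1"
    define b where "b = (max 0 a + 1) / 2"
    have b: "0 < b" "b < 1" "a < b" using \<open>a < 1\<close> by (auto simp: b_def)
    obtain L where L: "0 < L" "\<And>x. sq x L \<subseteq> \<Omega> \<Longrightarrow> b \<le> u x"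
      using u_lower_bound[OF b(1,2)] by blast
    show "\<forall>\<^sub>F t in at_top. a < line_profile t"
      using eventually_gt_at_top[of "2 * L + 1"]
    proof eventually_elim
      case (elim t)
      have "sq (x0 + t *\<^sub>R inner_normal) L \<subseteq> ball (x0 + t *\<^sub>R inner_normal) t"
      proof
        fix w assume w: "w \<in> sq (x0 + t *\<^sub>R inner_normal) L"
        have "norm (w - (x0 + t *\<^sub>R inner_normal)) \<le> \<bar>(w - (x0 + t *\<^sub>R inner_normal)) $ 1\<bar> + \<bar>(w - (x0 + t *\<^sub>R inner_normal)) $ 2\<bar>"
          unfolding norm_real2 by (rule sqrt_sum_squares_le_sum_abs)
        also have "\<dots> \<le> 2 * L" using w by (simp add: sq_def)
        finally show "w \<in> ball (x0 + t *\<^sub>R inner_normal) t" using elim by (simp add: dist_norm norm_minus_commute)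
      qed
      also have "\<dots> \<subseteq> \<Omega>" by (rule ball_half_plane) (simp add: x0_def inner_add_left)
      finally have "b \<le> u (x0 + t *\<^sub>R inner_normal)" by (rule L(2))
      then show ?case using line_profile[of t] b elim L by simp
    qed
  next
    fix a :: real assume "1 < a"
    show "\<forall>\<^sub>F t in at_top. line_profile t < a"
      using eventually_ge_at_top[of 0]
      by eventually_elim (use line_profile cl u_less_1 \<open>1 < a\<close> in \<open>auto intro: less_trans\<close>)
  qed
  show "(line_profile has_real_derivative sqrt (2 * W (line_profile t))) (at t within {0..})" if t: "0 \<le> t" for t
  proof -
    have "((\<lambda>t. u (x0 + t *\<^sub>R inner_normal)) has_real_derivative sqrt (2 * W (u (x0 + t *\<^sub>R inner_normal)))) (at t within {0..})"
    proof (cases "t = 0")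
      case True
      have pW: "0 < W t" if "0 \<le> t" "t \<le> 1 / 2" for t using that by (intro W_pos) auto
      \<comment> \<open>At 0 only a one-sided derivative makes sense: the quotient is constantly 1,
        and its limit is the normal derivative divided by \<open>sqrt (2 * W 0)\<close>.\<close>
      have lim: "((\<lambda>t. arclen W (u (x0 + t *\<^sub>R inner_normal)) / t) \<longlongrightarrow> (Du x0 \<bullet> inner_normal) / sqrt (2 * W 0)) (at_right 0)"
        by (rule arclen_u_right_derivative[where b="1 / 2", OF W_continuous_Icc pW x0 zero_less_one O]) auto
      have "\<forall>\<^sub>F t in at_right (0::real). arclen W (u (x0 + t *\<^sub>R inner_normal)) / t = 1"
        using eventually_at_right_less[of 0] by eventually_elim (use ar in auto)
      then have "((\<lambda>t. arclen W (u (x0 + t *\<^sub>R inner_normal)) / t) \<longlongrightarrow> 1) (at_right 0)"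
        by (rule tendsto_eventually)
      then have "(Du x0 \<bullet> inner_normal) / sqrt (2 * W 0) = 1"
        using tendsto_unique[OF trivial_limit_at_right_real lim] by simp
      then have D: "Du x0 \<bullet> inner_normal = sqrt (2 * W 0)" using W_pos[of 0] by (simp add: divide_eq_1_iff)
      have "((\<lambda>t. u (x0 + t *\<^sub>R inner_normal)) has_real_derivative Du x0 \<bullet> inner_normal) (at 0 within {0..<1})"
        by (rule u_right_derivative[OF x0 zero_less_one O])
      moreover have "at 0 within {0..<1} = at 0 within {0::real..}"
        by (rule at_within_nhd[of _ "{-1<..<1}"]) auto
      ultimately show ?thesis using True D u_frontier[OF x0] by simp
    next
      case False
      then have t: "0 < t" using t by simp
      have ux: "0 < u (x0 + t *\<^sub>R inner_normal)" "u (x0 + t *\<^sub>R inner_normal) < 1"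
        using u_pos[OF O[OF t]] u_less_1[OF cl] t by auto
      define b where "b = (u (x0 + t *\<^sub>R inner_normal) + 1) / 2"
      have b: "u (x0 + t *\<^sub>R inner_normal) < b" "b < 1" using ux by (auto simp: b_def)
      have ud: "((\<lambda>t. u (x0 + t *\<^sub>R inner_normal)) has_real_derivative Du (x0 + t *\<^sub>R inner_normal) \<bullet> inner_normal) (at t)"
        by (rule u_chain[OF O[OF t] line_has_vector_derivative])
      have "(arclen W has_real_derivative 1 / sqrt (2 * W (u (x0 + t *\<^sub>R inner_normal)))) (at (u (x0 + t *\<^sub>R inner_normal)))"
        by (rule arclen_has_derivative[OF W_continuous_Icc _ ux(1) b(1)]) (use W_below_1 b in auto)
      from DERIV_chain2[OF this ud]
      have "((\<lambda>t. t) has_real_derivative 1 / sqrt (2 * W (u (x0 + t *\<^sub>R inner_normal))) * (Du (x0 + t *\<^sub>R inner_normal) \<bullet> inner_normal)) (at t)"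
        by (rule has_field_derivative_transform_within_open[of _ _ _ "{0<..}"]) (use t ar in auto)
      then have "1 / sqrt (2 * W (u (x0 + t *\<^sub>R inner_normal))) * (Du (x0 + t *\<^sub>R inner_normal) \<bullet> inner_normal) = 1"
        using DERIV_ident DERIV_unique by blast
      then have "Du (x0 + t *\<^sub>R inner_normal) \<bullet> inner_normal = sqrt (2 * W (u (x0 + t *\<^sub>R inner_normal)))"
        using W_pos[of "u (x0 + t *\<^sub>R inner_normal)"] ux by (simp add: field_simps)
      then show ?thesis using has_field_derivative_at_within[OF ud] by simp
    qed
    then have "(line_profile has_real_derivative sqrt (2 * W (u (x0 + t *\<^sub>R inner_normal)))) (at t within {0..})"
      by (rule has_field_derivative_transform_within[OF _ zero_less_one]) (use t line_profile in auto)
    then show ?thesis using line_profile[OF t] by simp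
  qed
qed (simp add: line_profile_def)

text \<open>By injectivity of \<open>arclen W\<close>, \<open>u\<close> takes equal values at equal
  distance from the boundary, so \<open>x\<close> may be moved to the point \<open>y\<close> of the
  normal line.\<close>

lemma u_eq_profile:
  assumes x: "x \<in> \<Omega>"
  shows "u x = profile W (x \<bullet> inner_normal - offset)"
proof -
  define d where "d = x \<bullet> inner_normal - offset"
  have d: "0 < d" using x by (simp add: d_def \<Omega>_half_plane)
  define y where "y = (offset + d) *\<^sub>R inner_normal"
  have y: "y \<in> \<Omega>" using d by (simp add: y_def \<Omega>_half_plane)
  have "0 \<le> u x" "u x < 1" "0 \<le> u y" "u y < 1"
    using u_nonneg u_less_1 x y closure_subset by blast+
  moreover have "arclen W (u x) = arclen W (u y)"
    unfolding arclen_u[OF x] arclen_u[OF y] by (simp add: y_def d_def)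
  ultimately have "u x = u y" by (rule arclen_W_inject)
  also have "\<dots> = line_profile d" using d by (simp add: line_profile_def y_def)
  finally show ?thesis unfolding profile_eq_line_profile d_def .
qed

end

section \<open>Normalisation by an isometry\<close>

theorem theorem1p1:
  fixes \<phi> W :: "real \<Rightarrow> real" and u :: "real^2 \<Rightarrow> real"
  assumes "smooth \<phi>"
    and "double_well W"
    and "overdetermined_solution W \<phi> u"
  shows "half_space (epigraph2 \<phi>) \<and>
    (\<exists>T e. plane_isometry T \<and> norm e = 1 \<and>
      T ` epigraph2 \<phi> = {x. x \<bullet> e > 0} \<and>
      (\<forall>x\<in>epigraph2 \<phi>. u x = profile W (T x \<bullet> e)))"
proof -
  interpret overdetermined W \<phi> u
    using assms by unfold_locales
  \<comment> \<open>A translation moving the boundary line through the origin; no rotation occurs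
    since the unit vector \<open>e\<close> may be chosen as \<open>inner_normal\<close>.\<close>
  define T where "T = (\<lambda>x. x - offset *\<^sub>R inner_normal)"
  have Te: "T x \<bullet> inner_normal = x \<bullet> inner_normal - offset" for x by (simp add: T_def inner_diff_left)
  have "surj T" unfolding T_def by (rule surjI[of _ "\<lambda>x. x + offset *\<^sub>R inner_normal"]) simp
  then have iso: "plane_isometry T" by (simp add: plane_isometry_def T_def dist_norm)
  have "T ` \<Omega> = {x. x \<bullet> inner_normal > 0}"
  proof
    show "T ` \<Omega> \<subseteq> {x. x \<bullet> inner_normal > 0}" using \<Omega>_half_plane Te by auto
    show "{x. x \<bullet> inner_normal > 0} \<subseteq> T ` \<Omega>"
    proof
      fix x assume "x \<in> {x. x \<bullet> inner_normal > 0}"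
      then have "x + offset *\<^sub>R inner_normal \<in> \<Omega>" by (simp add: \<Omega>_half_plane inner_add_left)
      moreover have "x = T (x + offset *\<^sub>R inner_normal)" by (simp add: T_def)
      ultimately show "x \<in> T ` \<Omega>" by blast
    qed
  qed
  moreover have "half_space \<Omega>"
    unfolding half_space_def
  proof (intro exI conjI)
    show "inner_normal \<noteq> 0" using norm_inner_normal(1) by (metis norm_zero zero_neq_one)
    show "\<Omega> = {x. offset < x \<bullet> inner_normal}" by (rule set_eqI) (simp add: \<Omega>_half_plane)
  qed
  moreover have "\<forall>x\<in>\<Omega>. u x = profile W (T x \<bullet> inner_normal)" using u_eq_profile Te by simp
  ultimately show ?thesis using iso norm_inner_normal(1)
    by (intro conjI exI[of _ T] exI[of _ inner_normal])
qed

end
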